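(* Let $T\in\mathcal{BC}(X)$, $f\in N(\sigma_S(T))$ and $g\in SH_L(\sigma_S(T))$. Then $$2\big[\mathcal D((\cdot)fg)(T)-\bar T\,\mathcal D(fg)(T)\big]=f(T)\,\mathcal D((\cdot)g)(T)-f(T)\,\bar T\,\mathcal D(g)(T)+\mathcal D(f(\cdot))(T)\,g(T)-\mathcal D(f)(T)\,\bar T\,g(T),$$ where for a function $h$ the symbol $\mathcal D(h)(T)$ denotes the harmonic functional calculus of $h$, and $\mathcal D((\cdot)fg)$, $\mathcal D(fg)$, $\mathcal D((\cdot)g)$, $\mathcal D(g)$, $\mathcal D(f(\cdot))$, $\mathcal D(f)$ refer to the functions $q\mapsto qf(q)g(q)$, $fg$, $q\mapsto qg(q)$, $g$, $q\mapsto f(q)q$, $f$ respectively, while $f(T)$, $g(T)$ denote the $S$-functional calculus.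
   Context: $\mathbb H$ denotes the quaternions with units $e_1,e_2,e_3$; $\mathbb S$ is the sphere of unit purely imaginary quaternions, $\mathbb C_J=\{u+Jv\}$. $X=X_{\mathbb R}\otimes\mathbb H$ is a two-sided quaternionic Banach module over a real Banach space; $\mathcal{BC}(X)$ is the set of $T=T_0+\sum_{i=1}^3T_ie_i$ with pairwise commuting $T_i\in\mathcal B(X_{\mathbb R})$; $\bar T=T_0-\sum T_ie_i$; $\mathcal Q_{c,s}(T)=s^2\mathcal I-s(T+\bar T)+T\bar T$; $\sigma_S(T)$ is the set of $s$ where $\mathcal Q_{c,s}(T)$ has no bounded inverse. Left slice hyperholomorphic functions on an axially symmetric open set are $h(u+Jv)=\alpha(u,v)+J\beta(u,v)$ for all $J\in\mathbb S$, with $\alpha,\beta$ $\mathbb H$-valued differentiable, $\alpha$ even and $\beta$ odd in $v$, satisfying $\partial_u\alpha=\partial_v\beta$, $\partial_v\alpha=-\partial_u\beta$; they are intrinsic if $\alpha,\beta$ are real-valued. $SH_L(\sigma_S(T))$ (resp. $N(\sigma_S(T))$) is the set of left slice hyperholomorphic (resp. intrinsic) functions whose axially symmetric open domain contains $\sigma_S(T)$. Let $U$ be a bounded slice Cauchy domain (axially symmetric open set whose slices $U\cap\mathbb C_J$ have boundary a finite union of nonintersecting piecewise $C^1$ Jordan curves) with $\sigma_S(T)\subset U$, $\overline U\subset\mathrm{dom}(h)$, $J\in\mathbb S$, $ds_J=ds(-J)$, integrals over positively oriented boundaries. For $h\in SH_L(\sigma_S(T))$: the $S$-functional calculus is $h(T)=\frac1{2\pi}\int_{\partial(U\cap\mathbb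 C_J)}S_L^{-1}(s,T)\,ds_J\,h(s)$ with $S_L^{-1}(s,T)=(s\mathcal I-\bar T)\mathcal Q_{c,s}(T)^{-1}$; the harmonic functional calculus is $\mathcal D(h)(T)=-\frac1\pi\int_{\partial(U\cap\mathbb C_J)}\mathcal Q_{c,s}(T)^{-1}\,ds_J\,h(s)$. Both are independent of $U$ and $J$. *)

theory Defs
  imports "HOL-Analysis.Analysis" "HOL-Complex_Analysis.Complex_Analysis"
begin

text \<open>A quaternion q0 + q1 e1 + q2 e2 + q3 e3 is represented by the tuple (q0,q1,q2,q3);
  the product type carries the Euclidean norm and the real vector space structure.\<close>

type_synonym quat = "real \<times> real \<times> real \<times> real"

fun qmul :: "quat \<Rightarrow> quat \<Rightarrow> quat" where
  "qmul (a0,a1,a2,a3) (b0,b1,b2,b3) =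
     (a0*b0 - a1*b1 - a2*b2 - a3*b3,
      a0*b1 + a1*b0 + a2*b3 - a3*b2,
      a0*b2 - a1*b3 + a2*b0 + a3*b1,
      a0*b3 + a1*b2 - a2*b1 + a3*b0)"

definition qreal :: "real \<Rightarrow> quat" where
  "qreal r = (r, 0, 0, 0)"

definition qsphere :: "quat set" where
  "qsphere = {(a0,a1,a2,a3). a0 = 0 \<and> a1\<^sup>2 + a2\<^sup>2 + a3\<^sup>2 = 1}"

definition qJ :: "quat \<Rightarrow> real \<Rightarrow> real \<Rightarrow> quat" where
  "qJ J u v = qreal u + v *\<^sub>R J"

definition cJ :: "quat \<Rightarrow> complex \<Rightarrow> quat" where
  "cJ J z = qJ J (Re z) (Im z)"

definition axially_symmetric :: "quat set \<Rightarrow> bool" where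
  "axially_symmetric U \<longleftrightarrow>
     (\<forall>u v J K. J \<in> qsphere \<longrightarrow> K \<in> qsphere \<longrightarrow> qJ J u v \<in> U \<longrightarrow> qJ K u v \<in> U)"

text \<open>X = X_R (x) H for a real Banach space X_R (type 'x). A (right linear, bounded) operator
  T0 + T1 e1 + T2 e2 + T3 e3 on X, with T_i in B(X_R), is represented by the tuple of the T_i.
  Operators with real coefficients commute with the units e_i.\<close>

type_synonym 'x qop = "('x \<Rightarrow>\<^sub>L 'x) \<times> ('x \<Rightarrow>\<^sub>L 'x) \<times> ('x \<Rightarrow>\<^sub>L 'x) \<times> ('x \<Rightarrow>\<^sub>L 'x)"

fun opmul :: "'x::real_normed_vector qop \<Rightarrow> 'x qop \<Rightarrow> 'x qop" where
  "opmul (a0,a1,a2,a3) (b0,b1,b2,b3) =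
     ((a0 o\<^sub>L b0) - (a1 o\<^sub>L b1) - (a2 o\<^sub>L b2) - (a3 o\<^sub>L b3),
      (a0 o\<^sub>L b1) + (a1 o\<^sub>L b0) + (a2 o\<^sub>L b3) - (a3 o\<^sub>L b2),
      (a0 o\<^sub>L b2) - (a1 o\<^sub>L b3) + (a2 o\<^sub>L b0) + (a3 o\<^sub>L b1),
      (a0 o\<^sub>L b3) + (a1 o\<^sub>L b2) - (a2 o\<^sub>L b1) + (a3 o\<^sub>L b0))"

fun qscal :: "quat \<Rightarrow> 'x::real_normed_vector qop" where
  "qscal (a0,a1,a2,a3) = (a0 *\<^sub>R id_blinfun, a1 *\<^sub>R id_blinfun, a2 *\<^sub>R id_blinfun, a3 *\<^sub>R id_blinfun)"

definition opI :: "'x::real_normed_vector qop" where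
  "opI = (id_blinfun, 0, 0, 0)"

fun opconj :: "'x::real_normed_vector qop \<Rightarrow> 'x qop" where
  "opconj (a0,a1,a2,a3) = (a0, - a1, - a2, - a3)"

fun BC :: "'x::real_normed_vector qop \<Rightarrow> bool" where
  "BC (a0,a1,a2,a3) \<longleftrightarrow>
     (\<forall>A\<in>{a0,a1,a2,a3}. \<forall>B\<in>{a0,a1,a2,a3}. (A o\<^sub>L B) = (B o\<^sub>L A))"

definition op_invertible :: "'x::real_normed_vector qop \<Rightarrow> bool" where
  "op_invertible A \<longleftrightarrow> (\<exists>B. opmul A B = opI \<and> opmul B A = opI)"

definition op_inverse :: "'x::real_normed_vector qop \<Rightarrow> 'x qop" where
  "op_inverse A = (THE B. opmul A B = opI \<and> opmul B A = opI)"

definition Qcs :: "'x::real_normed_vector qop \<Rightarrow> quat \<Rightarrow> 'x qop" where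
  "Qcs T s = qscal (qmul s s) - opmul (qscal s) (T + opconj T) + opmul T (opconj T)"

definition S_spectrum :: "'x::real_normed_vector qop \<Rightarrow> quat set" where
  "S_spectrum T = {s. \<not> op_invertible (Qcs T s)}"

definition SL_resolvent :: "quat \<Rightarrow> 'x::real_normed_vector qop \<Rightarrow> 'x qop" where
  "SL_resolvent s T = opmul (qscal s - opconj T) (op_inverse (Qcs T s))"

text \<open>Parameter domain {(u,v). u + J v in Omega} (independent of J for axially symmetric Omega).\<close>
definition param_dom :: "quat set \<Rightarrow> (real \<times> real) set" where
  "param_dom \<Omega> = {(u,v). \<forall>J\<in>qsphere. qJ J u v \<in> \<Omega>}"

definition slice_repr ::
  "quat set \<Rightarrow> (quat \<Rightarrow> quat) \<Rightarrow> (real \<times> real \<Rightarrow> quat) \<Rightarrow> (real \<times> real \<Rightarrow> quat) \<Rightarrow> bool" where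
  "slice_repr \<Omega> h \<alpha> \<beta> \<longleftrightarrow>
     (\<exists>D\<alpha> D\<beta>. \<forall>p\<in>param_dom \<Omega>.
        (\<alpha> has_derivative D\<alpha> p) (at p) \<and> (\<beta> has_derivative D\<beta> p) (at p) \<and>
        D\<alpha> p (1,0) = D\<beta> p (0,1) \<and> D\<alpha> p (0,1) = - D\<beta> p (1,0)) \<and>
     (\<forall>u v. (u,v) \<in> param_dom \<Omega> \<longrightarrow> \<alpha> (u,-v) = \<alpha> (u,v) \<and> \<beta> (u,-v) = - \<beta> (u,v)) \<and>
     (\<forall>J\<in>qsphere. \<forall>u v. (u,v) \<in> param_dom \<Omega> \<longrightarrow> h (qJ J u v) = \<alpha> (u,v) + qmul J (\<beta> (u,v)))"

definition left_slice_hol :: "quat set \<Rightarrow> (quat \<Rightarrow> quat) \<Rightarrow> bool" where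
  "left_slice_hol \<Omega> h \<longleftrightarrow> open \<Omega> \<and> axially_symmetric \<Omega> \<and> (\<exists>\<alpha> \<beta>. slice_repr \<Omega> h \<alpha> \<beta>)"

definition intrinsic :: "quat set \<Rightarrow> (quat \<Rightarrow> quat) \<Rightarrow> bool" where
  "intrinsic \<Omega> h \<longleftrightarrow> open \<Omega> \<and> axially_symmetric \<Omega> \<and>
     (\<exists>\<alpha> \<beta>. slice_repr \<Omega> h \<alpha> \<beta> \<and>
        (\<forall>p\<in>param_dom \<Omega>. \<alpha> p \<in> range qreal \<and> \<beta> p \<in> range qreal))"

definition SH_L :: "quat set \<Rightarrow> (quat set \<times> (quat \<Rightarrow> quat)) set" where
  "SH_L K = {(\<Omega>, h). left_slice_hol \<Omega> h \<and> K \<subseteq> \<Omega>}"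

definition N_intr :: "quat set \<Rightarrow> (quat set \<times> (quat \<Rightarrow> quat)) set" where
  "N_intr K = {(\<Omega>, h). intrinsic \<Omega> h \<and> K \<subseteq> \<Omega>}"

definition slice :: "quat set \<Rightarrow> quat \<Rightarrow> complex set" where
  "slice U J = {z. cJ J z \<in> U}"

text \<open>The list of paths gs is the positively oriented boundary of the bounded open set V,
  consisting of finitely many nonintersecting piecewise C^1 Jordan curves. Positive orientation
  is expressed by the winding numbers: the cycle winds once around points of V and zero times
  around points outside the closure of V.\<close>
definition pos_boundary :: "complex set \<Rightarrow> (real \<Rightarrow> complex) list \<Rightarrow> bool" where
  "pos_boundary V gs \<longleftrightarrow>
     (\<forall>g\<in>set gs. valid_path g \<and> simple_path g \<and> pathfinish g = pathstart g) \<and>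
     (\<forall>i<length gs. \<forall>j<length gs. i \<noteq> j \<longrightarrow> path_image (gs!i) \<inter> path_image (gs!j) = {}) \<and>
     (\<Union>g\<in>set gs. path_image g) = frontier V \<and>
     (\<forall>z\<in>V. (\<Sum>g\<leftarrow>gs. winding_number g z) = 1) \<and>
     (\<forall>z. z \<notin> closure V \<longrightarrow> (\<Sum>g\<leftarrow>gs. winding_number g z) = 0)"

definition slice_cauchy_domain :: "quat set \<Rightarrow> bool" where
  "slice_cauchy_domain U \<longleftrightarrow> open U \<and> axially_symmetric U \<and> bounded U \<and>
     (\<forall>J\<in>qsphere. \<exists>gs. pos_boundary (slice U J) gs)"

text \<open>Integral over the path g in C_J of F(s) ds_J h(s), with ds_J = ds (-J).\<close>
definition path_int ::
  "quat \<Rightarrow> (real \<Rightarrow> complex) \<Rightarrow> (quat \<Rightarrow> 'x::real_normed_vector qop) \<Rightarrow> (quat \<Rightarrow> quat) \<Rightarrow> 'x qop" where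
  "path_int J g F h = integral {0..1} (\<lambda>t.
      opmul (opmul (F (cJ J (g t))) (qscal (qmul (cJ J (vector_derivative g (at t within {0..1}))) (- J))))
            (qscal (h (cJ J (g t)))))"

definition bdry_int ::
  "quat \<Rightarrow> (real \<Rightarrow> complex) list \<Rightarrow> (quat \<Rightarrow> 'x::real_normed_vector qop) \<Rightarrow> (quat \<Rightarrow> quat) \<Rightarrow> 'x qop" where
  "bdry_int J gs F h = (\<Sum>g\<leftarrow>gs. path_int J g F h)"

definition admissible :: "'x::real_normed_vector qop \<Rightarrow> quat set \<Rightarrow> quat set \<times> quat \<times> (real \<Rightarrow> complex) list \<Rightarrow> bool" where
  "admissible T \<Omega> d \<longleftrightarrow> (case d of (U, J, gs) \<Rightarrow>
     slice_cauchy_domain U \<and> S_spectrum T \<subseteq> U \<and> closure U \<subseteq> \<Omega> \<and> J \<in> qsphere \<and>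
     pos_boundary (slice U J) gs)"

text \<open>S-functional calculus h(T) (independent of the admissible choice).\<close>
definition S_calc :: "'x::real_normed_vector qop \<Rightarrow> quat set \<Rightarrow> (quat \<Rightarrow> quat) \<Rightarrow> 'x qop" where
  "S_calc T \<Omega> h = (case SOME d. admissible T \<Omega> d of (U, J, gs) \<Rightarrow>
      (1 / (2 * pi)) *\<^sub>R bdry_int J gs (\<lambda>s. SL_resolvent s T) h)"

text \<open>Harmonic functional calculus D(h)(T) (independent of the admissible choice).\<close>
definition D_calc :: "'x::real_normed_vector qop \<Rightarrow> quat set \<Rightarrow> (quat \<Rightarrow> quat) \<Rightarrow> 'x qop" where
  "D_calc T \<Omega> h = (case SOME d. admissible T \<Omega> d of (U, J, gs) \<Rightarrow>
      (- 1 / pi) *\<^sub>R bdry_int J gs (\<lambda>s. op_inverse (Qcs T s)) h)"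

end

theory Submission
  imports Defs
begin

text \<open>
  Since \<open>S_L\<^sup>-\<^sup>1(s,T) = s Q\<^sub>s(T)\<^sup>-\<^sup>1 - T' Q\<^sub>s(T)\<^sup>-\<^sup>1\<close> with \<open>T'\<close> the conjugate of \<open>T\<close>, one has
  \<open>-2 h(T) = D((\<cdot>)h)(T) - T' D(h)(T)\<close>, and \<open>D(f)(T)\<close> commutes with \<open>T'\<close> for intrinsic \<open>f\<close>. So both sides
  of the claim reduce to the product rule \<open>(f g)(T) = f(T) g(T)\<close>. Splitting \<open>g\<close> into four
  intrinsic components turns all integrals into integrals of
  \<open>Q(z)\<^sup>-\<^sup>1 H(z)\<close>, where \<open>Q(z) = z\<^sup>2 - 2 z T\<^sub>0 + T T'\<close> lives in the complexification of \<open>B(X\<^sub>R)\<close>, and the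
  product rule follows from the resolvent identity for \<open>Q(z)\<^sup>-\<^sup>1 - Q(w)\<^sup>-\<^sup>1\<close> over two nested
  contours. Continuous functionals
  (Hahn-Banach) reduce the integral theorems to the scalar case. The calculi are defined by a choice
  of an admissible contour, so the argument also needs the existence of such contours (unions
  of small bricks around the spectrum) and the homology form of Cauchy's theorem for cycles.
\<close>

section \<open>Separating functionals\<close>

text \<open>Let \<open>b\<close>, \<open>a\<close> be the integrals of \<open>F\<close> and
  \<open>z * F\<close> against the inverse of \<open>Q\<close>, divided by 2 pi i, and
  \<open>d\<close>, \<open>c\<close> those of \<open>G\<close> and \<open>z * G\<close>. The
  S-resolvent itself does not fit into the complexified algebra, because T' is in general not of the
  form A + J B for the J of the contour. So the work is done on these zeroth and first moments, and
  T' enters only at the end through its quadratic equation T' T' = 2 T0 T' - T T'. The moments of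
  the product are q = b c + a d - 2 b T0 d and p = a c - b (T T') d, and then p - T' q = (a - T'
  b)(c - T' d). Three obstacles shape the rest. The calculi of f, g and f g have different domains
  and choose unrelated contours, so moments must be known to be independent of the contour. The
  moments must have real coefficients, to be independent of J and to commute with T'; this comes
  from symmetry under conjugation. Finally, the derivative of a loop may be unbounded near finitely
  many parameters, so there are no length estimates, and integrals are controlled by primitives and
  by bounds on open neighbourhoods.\<close>

text \<open>Hahn-Banach: partial functionals dominated by the norm are represented by their graphs,
  which are subspaces of the product with the reals; single-valuedness is a consequence of domination.\<close>

lemma dominated_graph_extend:
  fixes G :: "('a::real_normed_vector \<times> real) set"
  assumes G: "subspace G" and dom: "\<And>x r. (x,r) \<in> G \<Longrightarrow> r \<le> norm x"
  shows "\<exists>c G'. subspace G' \<and> G \<subseteq> G' \<and> (x1,c) \<in> G' \<and> (\<forall>x r. (x,r) \<in> G' \<longrightarrow> r \<le> norm x)"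
proof -
  define L where "L = (\<lambda>(x,r). r - norm (x - x1)) ` G"
  have 0: "(0,0) \<in> G" using subspace_0[OF G] by (simp add: zero_prod_def)
  have key: "r - norm (x - x1) \<le> norm (y + x1) - s" if "(x,r) \<in> G" "(y,s) \<in> G" for x r y s
  proof -
    have "(x + y, r + s) \<in> G" using subspace_add[OF G that] by simp
    then have "r + s \<le> norm (x + y)" by (rule dom)
    also have "\<dots> = norm ((x - x1) + (y + x1))" by simp
    also have "\<dots> \<le> norm (x - x1) + norm (y + x1)" by (rule norm_triangle_ineq)
    finally show ?thesis by simp
  qed
  \<comment> \<open>By \<open>key\<close>, every lower bound in \<open>L\<close> for the value at
    \<open>x1\<close> lies below every upper bound \<open>norm (y + x1) - s\<close>; any number in
    between would do.\<close>
  define c where "c = Sup L"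
  have bdd: "bdd_above L"
    unfolding L_def bdd_above_def using key[OF _ 0] by (fastforce)
  have ne: "L \<noteq> {}" using 0 by (auto simp: L_def)
  have lo: "r - norm (x - x1) \<le> c" if "(x,r) \<in> G" for x r
    unfolding c_def by (rule cSup_upper[OF _ bdd]) (use that in \<open>force simp: L_def\<close>)
  have hi: "c \<le> norm (y + x1) - s" if "(y,s) \<in> G" for y s
    unfolding c_def by (rule cSup_least[OF ne]) (use that key in \<open>auto simp: L_def\<close>)
  define G' where "G' = (\<Union>t. (\<lambda>p. p + t *\<^sub>R (x1,c)) ` G)"
  have mem: "p \<in> G' \<longleftrightarrow> (\<exists>q\<in>G. \<exists>t. p = q + t *\<^sub>R (x1,c))" for p
    by (auto simp: G'_def)
  have "subspace G'"
  proof (rule subspaceI)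
    show "0 \<in> G'" unfolding mem using 0 by (intro bexI[of _ "(0,0)"] exI[of _ 0]) (auto simp: zero_prod_def)
  next
    fix p q assume "p \<in> G'" "q \<in> G'"
    then obtain p0 t q0 u where "p0\<in>G" "q0\<in>G" "p = p0 + t *\<^sub>R (x1,c)" "q = q0 + u *\<^sub>R (x1,c)"
      unfolding mem by blast
    then show "p + q \<in> G'" unfolding mem
      by (intro bexI[of _ "p0+q0"] exI[of _ "t+u"]) (auto simp: algebra_simps subspace_add[OF G])
  next
    fix a p assume "p \<in> G'"
    then obtain p0 t where "p0\<in>G" "p = p0 + t *\<^sub>R (x1,c)" unfolding mem by blast
    then show "a *\<^sub>R p \<in> G'" unfolding mem
      by (intro bexI[of _ "a *\<^sub>R p0"] exI[of _ "a*t"]) (auto simp: algebra_simps subspace_scale[OF G])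
  qed
  moreover have "G \<subseteq> G'" unfolding mem subset_eq by (auto intro!: bexI exI[of _ 0])
  moreover have "(x1,c) \<in> G'" unfolding mem using 0 by (intro bexI[of _ "(0,0)"] exI[of _ 1]) auto
  moreover have "r \<le> norm x" if "(x,r) \<in> G'" for x r
  proof -
    obtain y s t where ys: "(y,s) \<in> G" and xr: "x = y + t *\<^sub>R x1" "r = s + t * c"
      using \<open>(x,r) \<in> G'\<close> unfolding mem by (metis add_Pair scaleR_Pair prod.collapse prod.inject real_scaleR_def)
    show ?thesis
    proof (cases t "0::real" rule: linorder_cases)
      case equal then show ?thesis using xr dom[OF ys] by simp
    next
      case greater
      have "((1/t) *\<^sub>R y, (1/t) * s) \<in> G" using subspace_scale[OF G ys, of "1/t"] by simp
      from hi[OF this] have "t * c \<le> t * (norm ((1/t) *\<^sub>R y + x1) - (1/t) * s)"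
        using greater by (intro mult_left_mono) auto
      also have "\<dots> = norm (t *\<^sub>R ((1/t) *\<^sub>R y + x1)) - s"
        using greater by (simp only: norm_scaleR) (simp add: right_diff_distrib)
      also have "t *\<^sub>R ((1/t) *\<^sub>R y + x1) = x" using greater xr by (simp add: algebra_simps)
      finally show ?thesis using xr by simp
    next
      case less
      have "((-1/t) *\<^sub>R y, (-1/t) * s) \<in> G" using subspace_scale[OF G ys, of "-1/t"] by simp
      from lo[OF this] have "(-t) * ((-1/t) * s - norm ((-1/t) *\<^sub>R y - x1)) \<le> (-t) * c"
        using less by (intro mult_left_mono) auto
      then have "s + t * c \<le> norm ((-t) *\<^sub>R ((-1/t) *\<^sub>R y - x1))"
        using less unfolding norm_scaleR by (simp add: right_diff_distrib)
      also have "(-t) *\<^sub>R ((-1/t) *\<^sub>R y - x1) = x" using less xr by (simp add: algebra_simps)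
      finally show ?thesis using xr by simp
    qed
  qed
  ultimately show ?thesis by blast
qed

text \<open>Zorn's lemma is applied to the dominated graphs that already contain
  \<open>(x0, norm x0)\<close>. A maximal one has every vector in its domain, since otherwise it
  could be extended.\<close>

lemma hahn_banach_norming:
  fixes x0 :: "'a::real_normed_vector"
  obtains \<phi> :: "'a \<Rightarrow> real" where "bounded_linear \<phi>" "\<phi> x0 = norm x0"
proof -
  define \<G> where "\<G> = {G :: ('a \<times> real) set. subspace G \<and> (x0, norm x0) \<in> G \<and> (\<forall>x r. (x,r) \<in> G \<longrightarrow> r \<le> norm x)}"
  have "\<exists>M\<in>\<G>. \<forall>X\<in>\<G>. M \<subseteq> X \<longrightarrow> X = M"
  proof (rule subset_Zorn_nonempty)
    have "range (\<lambda>t. t *\<^sub>R (x0, norm x0)) \<in> \<G>"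
    proof -
      have "subspace (range (\<lambda>t. t *\<^sub>R (x0, norm x0)))"
        using subspace_span[of "{(x0, norm x0)}"] by (simp add: span_singleton)
      moreover have "(x0, norm x0) \<in> range (\<lambda>t. t *\<^sub>R (x0, norm x0))"
        by (rule range_eqI[of _ _ 1]) simp
      moreover have "r \<le> norm x" if "(x,r) \<in> range (\<lambda>t. t *\<^sub>R (x0, norm x0))" for x r
        using that by (auto intro!: mult_right_mono)
      ultimately show ?thesis unfolding \<G>_def by blast
    qed
    then show "\<G> \<noteq> {}" by blast
  next
    fix \<C> assume ne: "\<C> \<noteq> {}" and ch: "subset.chain \<G> \<C>"
    have sub: "C \<in> \<G>" if "C \<in> \<C>" for C using ch that by (auto simp: subset.chain_def)
    have "subspace (\<Union>\<C>)"
    proof (rule subspaceI)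
      show "0 \<in> \<Union>\<C>" using ne sub unfolding \<G>_def using subspace_0 by fast
    next
      fix p q assume "p \<in> \<Union>\<C>" "q \<in> \<Union>\<C>"
      then obtain C D where "C \<in> \<C>" "D \<in> \<C>" "p \<in> C" "q \<in> D" by blast
      moreover have "C \<subseteq> D \<or> D \<subseteq> C" using ch calculation by (auto simp: subset.chain_def)
      ultimately obtain E where "E \<in> \<C>" "p \<in> E" "q \<in> E" by blast
      moreover have "subspace E" using sub[OF \<open>E \<in> \<C>\<close>] by (simp add: \<G>_def)
      ultimately show "p + q \<in> \<Union>\<C>" using subspace_add by blast
    next
      fix a p assume "p \<in> \<Union>\<C>"
      then show "a *\<^sub>R p \<in> \<Union>\<C>" using sub unfolding \<G>_def using subspace_scale by fast
    qed
    then show "\<Union>\<C> \<in> \<G>" using ne sub unfolding \<G>_def by blast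
  qed
  then obtain M where M: "M \<in> \<G>" and max: "\<And>X. X \<in> \<G> \<Longrightarrow> M \<subseteq> X \<Longrightarrow> X = M" by blast
  have S: "subspace M" and dom: "\<And>x r. (x,r) \<in> M \<Longrightarrow> r \<le> norm x" and x0: "(x0, norm x0) \<in> M"
    using M by (auto simp: \<G>_def)
  have tot: "\<exists>c. (x,c) \<in> M" for x
  proof -
    obtain c G' where "subspace G'" "M \<subseteq> G'" "(x,c) \<in> G'" "\<forall>x r. (x,r) \<in> G' \<longrightarrow> r \<le> norm x"
      using dominated_graph_extend[OF S dom] by blast
    moreover from this have "G' = M" using x0 by (intro max) (auto simp: \<G>_def)
    ultimately show ?thesis by blast
  qed
  \<comment> \<open>The subspace contains \<open>(0, r - s)\<close> and its negative, and domination
    by the norm of 0 makes both values nonpositive.\<close>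
  have uniq: "r = s" if "(x,r) \<in> M" "(x,s) \<in> M" for x r s
    using dom[of 0 "r - s"] dom[of 0 "s - r"] subspace_diff[OF S that] subspace_diff[OF S that(2,1)] by simp
  define \<phi> where "\<phi> x = (THE r. (x,r) \<in> M)" for x
  have \<phi>: "(x, \<phi> x) \<in> M" for x
    unfolding \<phi>_def by (rule theI') (use tot uniq in blast)
  have "bounded_linear \<phi>"
  proof (rule bounded_linear_intro[where K=1])
    show "\<phi> (x + y) = \<phi> x + \<phi> y" for x y
      using uniq[OF \<phi>] subspace_add[OF S \<phi>[of x] \<phi>[of y]] by simp
    show "\<phi> (r *\<^sub>R x) = r *\<^sub>R \<phi> x" for r x
      using uniq[OF \<phi>] subspace_scale[OF S \<phi>[of x], of r] by simp
    show "norm (\<phi> x) \<le> norm x * 1" for x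
      using dom[OF \<phi>[of x]] dom[of "-x" "- \<phi> x"] subspace_neg[OF S \<phi>[of x]] by (simp add: abs_le_iff)
  qed
  moreover have "\<phi> x0 = norm x0" using uniq[OF \<phi> x0] .
  ultimately show thesis by (rule that)
qed

lemma bounded_linear_separates:
  fixes a b :: "'a::real_normed_vector"
  assumes "\<And>\<phi>::'a \<Rightarrow> real. bounded_linear \<phi> \<Longrightarrow> \<phi> a = \<phi> b"
  shows "a = b"
proof -
  obtain \<phi> :: "'a \<Rightarrow> real" where "bounded_linear \<phi>" "\<phi> (a - b) = norm (a - b)"
    by (rule hahn_banach_norming)
  then show ?thesis using assms[of \<phi>] by (simp add: linear_simps)
qed

section \<open>Cauchy's theorem for cycles\<close>

definition cycle_in :: "complex set \<Rightarrow> (real \<Rightarrow> complex) list \<Rightarrow> bool" where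
  "cycle_in S gs \<longleftrightarrow> (\<forall>g\<in>set gs. valid_path g \<and> pathfinish g = pathstart g \<and> path_image g \<subseteq> S)"

definition cycle_int :: "(real \<Rightarrow> complex) list \<Rightarrow> (complex \<Rightarrow> complex) \<Rightarrow> complex" where
  "cycle_int gs f = (\<Sum>g\<leftarrow>gs. contour_integral g f)"

definition cycle_ind :: "(real \<Rightarrow> complex) list \<Rightarrow> complex \<Rightarrow> complex" where
  "cycle_ind gs z = (\<Sum>g\<leftarrow>gs. winding_number g z)"

lemma cycle_in_Nil [simp]: "cycle_in S []"
  by (simp add: cycle_in_def)

lemma cycle_in_Cons [simp]:
  "cycle_in S (g # gs) \<longleftrightarrow> valid_path g \<and> pathfinish g = pathstart g \<and> path_image g \<subseteq> S \<and> cycle_in S gs"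
  by (auto simp: cycle_in_def)

lemma cycle_in_append [simp]: "cycle_in S (gs @ hs) \<longleftrightarrow> cycle_in S gs \<and> cycle_in S hs"
  by (auto simp: cycle_in_def)

lemma cycle_int_Nil [simp]: "cycle_int [] f = 0"
  and cycle_int_Cons [simp]: "cycle_int (g # gs) f = contour_integral g f + cycle_int gs f"
  and cycle_int_append [simp]: "cycle_int (gs @ hs) f = cycle_int gs f + cycle_int hs f"
  by (simp_all add: cycle_int_def)

lemma cycle_ind_Nil [simp]: "cycle_ind [] z = 0"
  and cycle_ind_Cons [simp]: "cycle_ind (g # gs) z = winding_number g z + cycle_ind gs z"
  and cycle_ind_append [simp]: "cycle_ind (gs @ hs) z = cycle_ind gs z + cycle_ind hs z"
  by (simp_all add: cycle_ind_def)

lemma cycle_int_add: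
  assumes "cycle_in S gs" "open S" "f holomorphic_on S" "h holomorphic_on S"
  shows "cycle_int gs (\<lambda>z. f z + h z) = cycle_int gs f + cycle_int gs h"
  using assms
  by (induction gs) (auto simp: contour_integral_add contour_integrable_holomorphic_simple)

lemma cycle_int_lmul:
  assumes "cycle_in S gs" "open S" "f holomorphic_on S"
  shows "cycle_int gs (\<lambda>z. c * f z) = c * cycle_int gs f"
  using assms
  by (induction gs) (auto simp: contour_integral_lmul contour_integrable_holomorphic_simple algebra_simps)

lemma cycle_int_diff:
  assumes "cycle_in S gs" "open S" "f holomorphic_on S" "h holomorphic_on S"
  shows "cycle_int gs (\<lambda>z. f z - h z) = cycle_int gs f - cycle_int gs h"
  using assms
  by (induction gs) (auto simp: contour_integral_diff contour_integrable_holomorphic_simple)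

lemma cycle_int_cong:
  assumes "cycle_in S gs" "\<And>z. z \<in> S \<Longrightarrow> f z = h z"
  shows "cycle_int gs f = cycle_int gs h"
  using assms by (induction gs) (auto intro!: contour_integral_eq)

lemma cycle_ind_eq_int:
  assumes "cycle_in S gs" "z \<notin> S"
  shows "cycle_int gs (\<lambda>w. 1 / (w - z)) = 2 * of_real pi * \<i> * cycle_ind gs z"
  using assms
proof (induction gs)
  case (Cons g gs)
  then have "winding_number g z = 1 / (2 * of_real pi * \<i>) * contour_integral g (\<lambda>w. 1 / (w - z))"
    using winding_number_valid_path[of g z] by auto
  with Cons show ?case by (simp add: field_simps)
qed simp

lemma cycle_in_reverse: "cycle_in S gs \<Longrightarrow> cycle_in S (map reversepath gs)"
  by (induction gs) (auto simp: valid_path_imp_reverse)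

lemma cycle_int_reverse:
  assumes "cycle_in S gs" "open S" "f holomorphic_on S"
  shows "cycle_int (map reversepath gs) f = - cycle_int gs f"
  using assms by (induction gs) (auto simp: contour_integral_reversepath)

lemma cycle_ind_reverse:
  assumes "cycle_in S gs" "z \<notin> S"
  shows "cycle_ind (map reversepath gs) z = - cycle_ind gs z"
  using assms
proof (induction gs)
  case (Cons g gs)
  then have "z \<notin> path_image g" "path g" by (auto simp: valid_path_imp_path)
  with Cons show ?case by (simp add: winding_number_reversepath)
qed simp

text \<open>Each loop is tied to the base point by a path run there and back. The two runs cancel in
  every integral, so one closed path stands for the whole cycle.\<close>

lemma cycle_join_connected:
  assumes "open C" "connected C" "b \<in> C" "cycle_in C gs"
  obtains p where "valid_path p" "pathstart p = b" "pathfinish p = b" "path_image p \<subseteq> C"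
    "\<And>f. f holomorphic_on C \<Longrightarrow> contour_integral p f = cycle_int gs f"
proof -
  have "\<exists>p. valid_path p \<and> pathstart p = b \<and> pathfinish p = b \<and> path_image p \<subseteq> C \<and>
      (\<forall>f. f holomorphic_on C \<longrightarrow> contour_integral p f = cycle_int gs f)"
    using assms(4)
  proof (induction gs)
    case Nil
    show ?case by (rule exI[of _ "linepath b b"]) (use assms(3) in \<open>simp del: linepath_refl add: linepath_refl[symmetric]\<close>)
  next
    case (Cons g gs)
    then obtain p where p: "valid_path p" "pathstart p = b" "pathfinish p = b" "path_image p \<subseteq> C"
      "\<And>f. f holomorphic_on C \<Longrightarrow> contour_integral p f = cycle_int gs f" by auto
    from Cons.prems have g: "valid_path g" "pathfinish g = pathstart g" "path_image g \<subseteq> C" by auto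
    then have "pathstart g \<in> C" by auto
    then obtain d where "polynomial_function d" and d: "path_image d \<subseteq> C" "pathstart d = b" "pathfinish d = pathstart g"
      using connected_open_polynomial_connected assms(1-3) by metis
    then have vd: "valid_path d" by (simp add: valid_path_polynomial_function)
    define q where "q = d +++ (g +++ (reversepath d +++ p))"
    have "valid_path q" "pathstart q = b" "pathfinish q = b" "path_image q \<subseteq> C"
      unfolding q_def using vd d g p by (auto simp: path_image_join valid_path_imp_reverse)
    moreover have "contour_integral q f = cycle_int (g # gs) f" if f: "f holomorphic_on C" for f
    proof -
      note [simp] = contour_integrable_holomorphic_simple[OF f assms(1)]
      show ?thesis unfolding q_def using vd d g p(1-4) p(5)[OF f]
        by (simp add: contour_integral_join valid_path_imp_reverse contour_integral_reversepath path_image_join)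
    qed
    ultimately show ?case by blast
  qed
  then show thesis using that by blast
qed

text \<open>For a single closed path this is \<open>Cauchy_theorem_global\<close>. The winding
  number of the joined path around a point \<open>w\<close> off \<open>C\<close> is read off from
  the integral of \<open>1 / (z - w)\<close>, which is holomorphic on \<open>C\<close>; so it agrees
  with the index of the cycle.\<close>

lemma Cauchy_cycle_connected:
  assumes "open C" "connected C" "cycle_in C gs" "f holomorphic_on C"
    and "\<And>w. w \<notin> C \<Longrightarrow> cycle_ind gs w = 0"
  shows "cycle_int gs f = 0"
proof (cases "gs = []")
  case False
  then obtain b where "b \<in> C" using assms(3)
    by (metis cycle_in_def list.set_intros(1) neq_Nil_conv pathstart_in_path_image subsetD)
  with assms obtain p where p: "valid_path p" "pathstart p = b" "pathfinish p = b" "path_image p \<subseteq> C"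
    and pf: "\<And>f. f holomorphic_on C \<Longrightarrow> contour_integral p f = cycle_int gs f"
    using cycle_join_connected by blast
  have "winding_number p w = 0" if w: "w \<notin> C" for w
  proof -
    have "(\<lambda>z. 1/(z-w)) holomorphic_on C" using w by (auto intro!: holomorphic_intros)
    from pf[OF this] have "2 * of_real pi * \<i> * winding_number p w = 0"
      using cycle_ind_eq_int[OF assms(3) w] assms(5)[OF w] w p winding_number_valid_path[of p w]
      by (auto simp: field_simps subset_iff)
    then show ?thesis by simp
  qed
  then have "(f has_contour_integral 0) p"
    using Cauchy_theorem_global[OF assms(1,4), of p] p by simp
  then show ?thesis using pf[OF assms(4)] contour_integral_unique by metis
qed auto

lemma continuous_on_cycle_ind:
  assumes "cycle_in S gs" "closed F" "S \<inter> F = {}"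
  shows "continuous_on F (cycle_ind gs)"
  using assms
proof (induction gs)
  case Nil
  have "cycle_ind [] = (\<lambda>z. 0)" by auto
  then show ?case by simp
next
  case (Cons g gs)
  have "cycle_ind (g # gs) = (\<lambda>z. winding_number g z + cycle_ind gs z)" by auto
  moreover have "continuous_on F (winding_number g)"
    using Cons.prems
    by (intro continuous_at_imp_continuous_on ballI continuous_at_winding_number) (auto simp: valid_path_imp_path)
  ultimately show ?case using Cons by (auto intro!: continuous_intros)
qed

lemma cycle_ind_Ints: "cycle_in S gs \<Longrightarrow> z \<notin> S \<Longrightarrow> cycle_ind gs z \<in> \<int>"
  by (induction gs) (auto intro!: integer_winding_number Ints_add simp: valid_path_imp_path)

lemma cycle_ind_at_infinity: "cycle_in S gs \<Longrightarrow> \<exists>B. \<forall>z. norm z \<ge> B \<longrightarrow> cycle_ind gs z = 0"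
proof (induction gs)
  case (Cons g gs)
  then obtain B where B: "\<And>z. norm z \<ge> B \<Longrightarrow> cycle_ind gs z = 0" by auto
  obtain B' where "\<And>z. norm z \<ge> B' \<Longrightarrow> winding_number g z = 0"
    using winding_number_zero_at_infinity[of g] Cons.prems by (auto simp: valid_path_imp_path)
  then show ?case using B by (intro exI[of _ "max B B'"]) auto
qed auto

text \<open>The index of the part of the cycle inside a component \<open>C\<close> vanishes off \<open>C\<close>: off \<open>C\<close> it is
  \<open>n(C-part)\<close>, off the other components it is minus the index of the rest, and these two
  continuous integer-valued functions glue to one on the whole plane which vanishes at infinity.\<close>

lemma cycle_ind_component:
  assumes S: "open S" and C: "C \<in> components S"
    and gs: "cycle_in C gs" and hs: "cycle_in (S - C) hs"
    and zero: "\<And>w. w \<notin> S \<Longrightarrow> cycle_ind gs w + cycle_ind hs w = 0"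
    and w: "w \<notin> C"
  shows "cycle_ind gs w = 0"
proof -
  have CS: "C \<subseteq> S" using C by (rule in_components_subset)
  have "open C" using S C by (rule open_components)
  have "S - C = \<Union>(components S - {C})"
  proof -
    have "x \<in> C" if "X \<in> components S" "x \<in> X" "x \<in> C \<or> X = C" for x X using that C by auto
    moreover have "X = C" if "X \<in> components S" "x \<in> X" "x \<in> C" for x X
      using components_nonoverlap[OF that(1) C] that by auto
    ultimately show ?thesis using Union_components[of S] by blast
  qed
  then have oSC: "open (S - C)" using S by (auto intro: open_components)
  define m where "m z = (if z \<in> - C then cycle_ind gs z else - cycle_ind hs z)" for z
  have "continuous_on (- C \<union> - (S - C)) m"
    unfolding m_def
  proof (rule continuous_on_cases)
    show "closed (- C)" "closed (- (S - C))" using closed_Compl[OF \<open>open C\<close>] closed_Compl[OF oSC] .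
    show "continuous_on (- C) (cycle_ind gs)"
      by (rule continuous_on_cycle_ind[OF gs]) (use \<open>open C\<close> in auto)
    show "continuous_on (- (S - C)) (\<lambda>z. - cycle_ind hs z)"
      by (intro continuous_on_minus continuous_on_cycle_ind[OF hs] closed_Compl[OF oSC]) auto
    show "\<forall>x. x \<in> - C \<and> \<not> x \<in> - C \<or> x \<in> - (S - C) \<and> x \<in> - C \<longrightarrow> cycle_ind gs x = - cycle_ind hs x"
      using zero by (auto simp: eq_neg_iff_add_eq_0)
  qed
  then have cm: "continuous_on UNIV m" by (simp add: Un_Diff_cancel Compl_Diff_eq)
  have mI: "m z \<in> \<int>" for z
    using cycle_ind_Ints[OF gs] cycle_ind_Ints[OF hs] by (auto simp: m_def)
  have "1 \<le> norm (m y - m x)" if "m y \<noteq> m x" for x y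
  proof -
    obtain k where k: "m y - m x = of_int k" using Ints_cases[OF Ints_diff[OF mI[of y] mI[of x]]] by blast
    then have "k \<noteq> 0" using that by auto
    then show ?thesis unfolding k by (simp flip: of_int_abs)
  qed
  then have "m constant_on UNIV"
    by (intro continuous_discrete_range_constant[OF connected_UNIV cm] exI[of _ 1]) auto
  then obtain c where c: "\<And>z. m z = c" by (auto simp: constant_on_def)
  obtain B where B: "\<And>z. norm z \<ge> B \<Longrightarrow> cycle_ind gs z = 0" using cycle_ind_at_infinity[OF gs] by blast
  obtain B' where B': "\<And>z. norm z \<ge> B' \<Longrightarrow> cycle_ind hs z = 0" using cycle_ind_at_infinity[OF hs] by blast
  have "m (of_real (max \<bar>B\<bar> \<bar>B'\<bar>)) = 0" unfolding m_def using B B' by auto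
  then show ?thesis using c[of w] c w by (simp add: m_def)
qed

text \<open>Induction on the number of loops. The loops in the component of the first one form a
  cycle whose index vanishes off that component by \<open>cycle_ind_component\<close>, so the
  connected case settles them; the other loops are fewer.\<close>

theorem Cauchy_cycle:
  assumes "open S" "cycle_in S gs" "f holomorphic_on S"
    and "\<And>w. w \<notin> S \<Longrightarrow> cycle_ind gs w = 0"
  shows "cycle_int gs f = 0"
  using assms(2,4)
proof (induction "length gs" arbitrary: gs rule: less_induct)
  case less
  show ?case
  proof (cases gs)
    case (Cons g gs')
    from less.prems Cons have g: "valid_path g" "path_image g \<subseteq> S" by auto
    define C where "C = connected_component_set S (pathstart g)"
    have "pathstart g \<in> S" using g by auto
    then have C: "C \<in> components S" unfolding C_def by (auto simp: components_def)
    define inC where "inC h \<longleftrightarrow> path_image h \<subseteq> C" for h :: "real \<Rightarrow> complex"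
    define as where "as = filter inC gs"
    define bs where "bs = filter (\<lambda>h. \<not> inC h) gs"
    have conn: "inC h \<or> path_image h \<inter> C = {}" if "h \<in> set gs" for h
    proof -
      have "connected (path_image h)" "path_image h \<subseteq> S"
        using that less.prems by (auto simp: cycle_in_def valid_path_imp_path connected_path_image)
      then show ?thesis unfolding inC_def using C
        by (metis components_maximal disjoint_iff_not_equal inf_commute)
    qed
    have as: "cycle_in C as" and bs: "cycle_in (S - C) bs"
      using less.prems conn by (fastforce simp: as_def bs_def cycle_in_def inC_def)+
    have split: "cycle_int gs h = cycle_int as h + cycle_int bs h" for h
      unfolding as_def bs_def by (induction gs) auto
    have splitn: "cycle_ind gs z = cycle_ind as z + cycle_ind bs z" for z
      unfolding as_def bs_def by (induction gs) auto
    have asC: "cycle_ind as w = 0" if "w \<notin> C" for w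
      by (rule cycle_ind_component[OF assms(1) C as bs _ that]) (use less.prems(2) splitn in metis)
    have CS: "C \<subseteq> S" using C by (rule in_components_subset)
    have "cycle_int as f = 0"
      using assms(1,3) C as asC CS
      by (intro Cauchy_cycle_connected[of C]) (auto intro: open_components in_components_connected holomorphic_on_subset)
    moreover have "inC g" unfolding inC_def C_def
      using g by (intro connected_component_maximal) (auto simp: valid_path_imp_path connected_path_image)
    then have "length bs < length gs" unfolding bs_def Cons by (simp add: le_imp_less_Suc)
    then have "cycle_int bs f = 0"
    proof (rule less.hyps)
      show "cycle_in S bs" using bs by (auto simp: cycle_in_def)
      show "cycle_ind bs w = 0" if "w \<notin> S" for w
        
      proof -
        have "w \<notin> C" using that CS by blast
        then show ?thesis using less.prems(2)[OF that] splitn[of w] asC[of w] by simp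
      qed
    qed
    ultimately show ?thesis using split by simp
  qed simp
qed

corollary Cauchy_cycle_homologous:
  assumes "open S" "cycle_in S gs" "cycle_in S hs" "f holomorphic_on S"
    and "\<And>w. w \<notin> S \<Longrightarrow> cycle_ind gs w = cycle_ind hs w"
  shows "cycle_int gs f = cycle_int hs f"
proof -
  have "cycle_int (gs @ map reversepath hs) f = 0"
    by (rule Cauchy_cycle[OF assms(1) _ assms(4)])
       (use assms(2,3,5) in \<open>auto simp: cycle_in_reverse cycle_ind_reverse\<close>)
  then show ?thesis using cycle_int_reverse[OF assms(3,1,4)] by simp
qed

text \<open>The difference quotient of \<open>f\<close> at \<open>z\<close>, completed by the
  derivative, is holomorphic on \<open>S\<close> and integrates to zero. What remains is
  \<open>f z\<close> times the integral that defines the index.\<close>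

corollary Cauchy_cycle_formula:
  assumes "open S" "cycle_in (S - {z}) gs" "f holomorphic_on S" "z \<in> S"
    and "\<And>w. w \<notin> S \<Longrightarrow> cycle_ind gs w = 0"
  shows "cycle_int gs (\<lambda>w. f w / (w - z)) = 2 * of_real pi * \<i> * cycle_ind gs z * f z"
proof -
  define F where "F w = (if w = z then deriv f z else (f w - f z) / (w - z))" for w
  have F: "F holomorphic_on S"
    unfolding F_def by (rule pole_lemma) (use assms in \<open>auto simp: interior_open\<close>)
  have cS: "cycle_in S gs" using assms(2) by (auto simp: cycle_in_def)
  have o: "open (S - {z})" using assms(1) by auto
  have "cycle_int gs F = 0" by (rule Cauchy_cycle[OF assms(1) cS F assms(5)])
  moreover have "cycle_int gs F = cycle_int gs (\<lambda>w. f w / (w - z) - f z * (1 / (w - z)))"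
    by (rule cycle_int_cong[OF assms(2)]) (auto simp: F_def diff_divide_distrib)
  moreover have "\<dots> = cycle_int gs (\<lambda>w. f w / (w - z)) - f z * cycle_int gs (\<lambda>w. 1 / (w - z))"
  proof -
    have h: "(\<lambda>w. f w / (w - z)) holomorphic_on S - {z}" "(\<lambda>w. 1 / (w - z)) holomorphic_on S - {z}"
      using assms(3) by (auto intro!: holomorphic_intros intro: holomorphic_on_subset)
    then show ?thesis
      using cycle_int_lmul[OF assms(2) o h(2), of "f z"]
      by (subst cycle_int_diff[OF assms(2) o]) (auto intro!: holomorphic_intros)
  qed
  ultimately show ?thesis using cycle_ind_eq_int[OF assms(2), of z] by (simp add: algebra_simps)
qed

section \<open>Decomposing oriented edges into Jordan polygons\<close>

text \<open>The clause for two vertices ends the path without a constant piece, which would spoil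
  injectivity.\<close>

fun poly_path :: "complex list \<Rightarrow> real \<Rightarrow> complex" where
  "poly_path [] = linepath 0 0"
| "poly_path [a] = linepath a a"
| "poly_path [a, b] = linepath a b"
| "poly_path (a # b # c # vs) = linepath a b +++ poly_path (b # c # vs)"

abbreviation walk_edges :: "'a list \<Rightarrow> ('a \<times> 'a) list" where
  "walk_edges vs \<equiv> zip vs (tl vs)"

abbreviation seg :: "complex \<times> complex \<Rightarrow> complex set" where
  "seg e \<equiv> closed_segment (fst e) (snd e)"

definition edge_int :: "(complex \<Rightarrow> complex) \<Rightarrow> complex \<times> complex \<Rightarrow> complex" where
  "edge_int f e = contour_integral (linepath (fst e) (snd e)) f"

definition end_disjoint :: "(complex \<times> complex) set \<Rightarrow> bool" where
  "end_disjoint E \<longleftrightarrow> (\<forall>e\<in>E. \<forall>e'\<in>E. e \<noteq> e' \<longrightarrow> seg e \<inter> seg e' \<subseteq> {fst e, snd e} \<inter> {fst e', snd e'})"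

lemma poly_path_basic:
  "length vs \<ge> 2 \<Longrightarrow> pathstart (poly_path vs) = hd vs \<and> pathfinish (poly_path vs) = last vs \<and>
    valid_path (poly_path vs) \<and> path_image (poly_path vs) = (\<Union>e\<in>set (walk_edges vs). seg e)"
  by (induction vs rule: poly_path.induct) (auto simp: path_image_join)

lemma contour_integral_poly_path:
  assumes "length vs \<ge> 2" "continuous_on (path_image (poly_path vs)) f"
  shows "f contour_integrable_on poly_path vs \<and>
    contour_integral (poly_path vs) f = (\<Sum>e\<leftarrow>walk_edges vs. edge_int f e)"
  using assms
proof (induction vs rule: poly_path.induct)
  case (4 a b c vs)
  have *: "path_image (poly_path (a # b # c # vs)) = closed_segment a b \<union> path_image (poly_path (b # c # vs))"
    using poly_path_basic[of "b # c # vs"] by (simp add: path_image_join)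
  have l: "f contour_integrable_on linepath a b"
    by (rule contour_integrable_continuous_linepath, rule continuous_on_subset[OF 4(3)]) (use * in auto)
  have "f contour_integrable_on poly_path (b # c # vs) \<and>
    contour_integral (poly_path (b # c # vs)) f = (\<Sum>e\<leftarrow>walk_edges (b # c # vs). edge_int f e)"
    by (rule 4(1), simp, rule continuous_on_subset[OF 4(3)]) (use * in auto)
  with l show ?case using poly_path_basic[of "b # c # vs"]
    by (simp add: contour_integral_join edge_int_def)
qed (auto simp: edge_int_def contour_integrable_continuous_linepath)

lemma walk_edges_in: "e \<in> set (walk_edges vs) \<Longrightarrow> fst e \<in> set vs \<and> snd e \<in> set vs"
  by (induction vs rule: induct_list012) auto

lemma arc_poly_path:
  assumes "length vs \<ge> 2" "distinct vs" "end_disjoint (set (walk_edges vs))"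
  shows "arc (poly_path vs)"
  using assms
proof (induction vs rule: poly_path.induct)
  case (4 a b c vs)
  let ?r = "b # c # vs"
  have ed: "seg e \<inter> seg e' \<subseteq> {fst e, snd e} \<inter> {fst e', snd e'}"
    if "e \<in> set (walk_edges (a # ?r))" "e' \<in> set (walk_edges (a # ?r))" "e \<noteq> e'" for e e'
    using 4(4) that unfolding end_disjoint_def by blast
  have "arc (poly_path ?r)"
    by (rule 4(1)) (use 4 in \<open>auto simp: end_disjoint_def\<close>)
  moreover have "closed_segment a b \<inter> seg e \<subseteq> {b}" if e: "e \<in> set (walk_edges ?r)" for e
  proof -
    have "fst e \<noteq> a" "snd e \<noteq> a" using walk_edges_in[OF e] 4(3) by auto
    moreover have "seg (a, b) \<inter> seg e \<subseteq> {fst (a,b), snd (a,b)} \<inter> {fst e, snd e}"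
      by (rule ed) (use e calculation in auto)
    ultimately show ?thesis by auto
  qed
  moreover have "path_image (poly_path ?r) = (\<Union>e\<in>set (walk_edges ?r). seg e)"
    using poly_path_basic[of ?r] by force
  ultimately have "arc (poly_path ?r)" "closed_segment a b \<inter> path_image (poly_path ?r) \<subseteq> {b}"
    by blast+
  then show ?case
    using poly_path_basic[of ?r] 4(3) unfolding poly_path.simps(4) by (intro arc_join) (auto simp: arc_linepath)
qed (auto simp: arc_linepath)

section \<open>Closed walks in a finite relation\<close>

lemma walk_edges_snoc: "vs \<noteq> [] \<Longrightarrow> walk_edges (vs @ [r]) = walk_edges vs @ [(last vs, r)]"
  by (induction vs rule: induct_list012) auto

lemma walk_pred: "v \<in> set vs \<Longrightarrow> v \<noteq> hd vs \<Longrightarrow> \<exists>u. (u, v) \<in> set (walk_edges vs)"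
  by (induction vs rule: induct_list012) auto

lemma walk_succ: "v \<in> set vs \<Longrightarrow> v \<noteq> last vs \<Longrightarrow> \<exists>u. (v, u) \<in> set (walk_edges vs)"
  by (induction vs rule: induct_list012) auto

lemma walk_edges_last: "distinct vs \<Longrightarrow> (last vs, v) \<notin> set (walk_edges vs)"
  by (induction vs rule: induct_list012) (auto dest: set_zip_leftD)

text \<open>A walk of maximal length in a finite relation which is a permutation of its field closes up.\<close>

lemma permutation_graph_cycle:
  assumes fin: "finite E" and ne: "E \<noteq> {}" and sv: "single_valued E" and svc: "single_valued (E\<inverse>)"
    and RD: "Range E \<subseteq> Domain E"
  obtains vs where "vs \<noteq> []" "distinct vs" "set (walk_edges vs) \<subseteq> E" "(last vs, hd vs) \<in> E"
proof -
  define W where "W = {vs. vs \<noteq> [] \<and> distinct vs \<and> set (walk_edges vs) \<subseteq> E \<and> set vs \<subseteq> Domain E}"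
  obtain p where "p \<in> Domain E" using ne by auto
  then have "[p] \<in> W" by (auto simp: W_def)
  moreover have "\<forall>vs. vs \<in> W \<longrightarrow> length vs < Suc (card (Domain E))"
    using fin card_mono[OF finite_Domain[OF fin]] by (auto simp: W_def less_Suc_eq_le simp flip: distinct_card)
  ultimately have "\<exists>vs. vs \<in> W \<and> (\<forall>ws. ws \<in> W \<longrightarrow> length ws \<le> length vs)"
    by (rule ex_has_greatest_nat[of "\<lambda>vs. vs \<in> W"])
  then obtain vs where vs: "vs \<in> W" and max: "\<And>ws. ws \<in> W \<Longrightarrow> length ws \<le> length vs" by blast
  then have ne: "vs \<noteq> []" and "last vs \<in> Domain E" by (auto simp: W_def)
  then obtain r where r: "(last vs, r) \<in> E" by blast
  have "r \<in> set vs"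
  proof (rule ccontr)
    assume "r \<notin> set vs"
    then have "vs @ [r] \<in> W" using vs r RD unfolding W_def mem_Collect_eq walk_edges_snoc[OF ne] by auto
    then show False using max[of "vs @ [r]"] by simp
  qed
  \<comment> \<open>A vertex other than the head has a predecessor in the walk, which must be
    \<open>last vs\<close> because \<open>E\<close> is injective; but no edge of a walk with
    distinct vertices starts at its last one.\<close>
  moreover have "r = hd vs"
  proof (rule ccontr)
    assume "r \<noteq> hd vs"
    with calculation obtain u where u: "(u, r) \<in> set (walk_edges vs)" using walk_pred by metis
    then have "(u, r) \<in> E" using vs by (auto simp: W_def)
    then have "u = last vs" using r single_valuedD[OF svc] by blast
    then show False using u walk_edges_last[of vs r] vs by (simp add: W_def)
  qed
  ultimately show thesis using that[of vs] vs r by (simp add: W_def)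
qed

text \<open>Integrals are recorded in place of winding numbers: they add up edge by edge, and the
  orientation is read off later from the integrals of \<open>1 / (w - z)\<close>.\<close>

definition Jordan_cycle :: "(complex \<times> complex) set \<Rightarrow> (real \<Rightarrow> complex) list \<Rightarrow> bool" where
  "Jordan_cycle E gs \<longleftrightarrow>
     (\<forall>g\<in>set gs. valid_path g \<and> simple_path g \<and> pathfinish g = pathstart g) \<and>
     (\<forall>i<length gs. \<forall>j<length gs. i \<noteq> j \<longrightarrow> path_image (gs!i) \<inter> path_image (gs!j) = {}) \<and>
     (\<Union>g\<in>set gs. path_image g) = (\<Union>e\<in>E. seg e) \<and>
     (\<forall>f. continuous_on (\<Union>e\<in>E. seg e) f \<longrightarrow> cycle_int gs f = (\<Sum>e\<in>E. edge_int f e))"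

text \<open>A closed walk is peeled off and the rest is treated by induction. Each vertex has at
  most one edge in and one edge out, so no remaining edge touches a vertex of the walk; by
  \<open>end_disjoint\<close> the remaining segments then miss it altogether.\<close>

theorem segments_Jordan_decomposition:
  assumes "finite E" "\<And>p q. (p, q) \<in> E \<Longrightarrow> p \<noteq> q" "end_disjoint E"
    "single_valued E" "single_valued (E\<inverse>)" "Range E \<subseteq> Domain E"
  shows "\<exists>gs. Jordan_cycle E gs"
  using assms
proof (induction "card E" arbitrary: E rule: less_induct)
  case less
  show ?case
  proof (cases "E = {}")
    case True
    then show ?thesis by (intro exI[of _ "[]"]) (auto simp: Jordan_cycle_def)
  next
    case False
    note sv = less.prems(4) and svc = less.prems(5)
    obtain vs where vs: "vs \<noteq> []" "distinct vs" "set (walk_edges vs) \<subseteq> E" and cl: "(last vs, hd vs) \<in> E"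
      using permutation_graph_cycle[OF less.prems(1) False sv svc less.prems(6)] by blast
    let ?p = "last vs" and ?q = "hd vs"
    have "?p \<noteq> ?q" using less.prems(2) cl by blast
    then have len: "length vs \<ge> 2" using vs(1) by (cases vs rule: remdups_adj.cases) auto
    define C where "C = insert (?p, ?q) (set (walk_edges vs))"
    have CE: "C \<subseteq> E" using vs cl by (auto simp: C_def)
    have Cin: "fst e \<in> set vs \<and> snd e \<in> set vs" if "e \<in> C" for e
      using that walk_edges_in[of e vs] vs(1) by (auto simp: C_def)
    have notin: "(?p, ?q) \<notin> set (walk_edges vs)" using walk_edges_last[OF vs(2)] by blast
    have edE: "seg e \<inter> seg e' \<subseteq> {fst e, snd e} \<inter> {fst e', snd e'}" if "e \<in> E" "e' \<in> E" "e \<noteq> e'" for e e'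
      using less.prems(3) that unfolding end_disjoint_def by blast
    note pb = poly_path_basic[OF len]
    define g where "g = linepath ?p ?q +++ poly_path vs"
    have "end_disjoint (set (walk_edges vs))" 
      using less.prems(3) vs(3) unfolding end_disjoint_def by blast
    then have arc: "arc (poly_path vs)" by (rule arc_poly_path[OF len vs(2)])
    have "closed_segment ?p ?q \<inter> seg e \<subseteq> {?p, ?q}" if "e \<in> set (walk_edges vs)" for e
      using edE[of "(?p, ?q)" e] that cl vs(3) notin by auto
    then have "simple_path g" unfolding g_def
      using pb arc \<open>?p \<noteq> ?q\<close> by (intro simple_path_join_loop) (auto simp: path_image_join)
    moreover have "valid_path g" "pathfinish g = pathstart g" unfolding g_def using pb by auto
    moreover have pg: "path_image g = (\<Union>e\<in>C. seg e)"
      unfolding g_def using pb by (auto simp: path_image_join C_def)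
    moreover have gint: "contour_integral g f = (\<Sum>e\<in>C. edge_int f e)" if f: "continuous_on (\<Union>e\<in>C. seg e) f" for f
    proof -
      have 1: "f contour_integrable_on linepath ?p ?q"
        by (rule contour_integrable_continuous_linepath, rule continuous_on_subset[OF f]) (auto simp: C_def)
      have 2: "f contour_integrable_on poly_path vs \<and>
        contour_integral (poly_path vs) f = (\<Sum>e\<leftarrow>walk_edges vs. edge_int f e)"
        by (rule contour_integral_poly_path[OF len], rule continuous_on_subset[OF f]) (use pb in \<open>auto simp: C_def\<close>)
      have "(\<Sum>e\<leftarrow>walk_edges vs. edge_int f e) = (\<Sum>e\<in>set (walk_edges vs). edge_int f e)"
        using vs(2) by (intro sum_list_distinct_conv_sum_set distinct_zipI1)
      then show ?thesis using 1 2 pb notin unfolding g_def C_def by (simp add: edge_int_def)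
    qed
    define E' where "E' = E - C"
    have EE': "E = C \<union> E'" "C \<inter> E' = {}" using CE by (auto simp: E'_def)
    have out: "e' \<in> C" if e': "e' \<in> E" "fst e' \<in> set vs" for e'
    proof -
      obtain u where u: "(fst e', u) \<in> C" using walk_succ[OF e'(2)] cl by (auto simp: C_def)
      then have "snd e' = u" using sv e'(1) CE by (cases e') (auto simp: single_valued_def)
      then show ?thesis using u by (cases e') auto
    qed
    have inn: "e' \<in> C" if e': "e' \<in> E" "snd e' \<in> set vs" for e'
    proof -
      obtain u where u: "(u, snd e') \<in> C" using walk_pred[OF e'(2)] cl by (auto simp: C_def)
      then have "fst e' = u" using svc e'(1) CE by (cases e') (auto simp: single_valued_def)
      then show ?thesis using u by (cases e') auto
    qed
    have "\<exists>gs. Jordan_cycle E' gs"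
    proof (rule less.hyps)
      have "E' \<subset> E" using cl by (auto simp: E'_def C_def)
      then show "card E' < card E" using less.prems(1) by (rule psubset_card_mono[rotated])
      show "finite E'" "\<And>p q. (p, q) \<in> E' \<Longrightarrow> p \<noteq> q" "single_valued E'" "single_valued (E'\<inverse>)"
        using less.prems(1,2) sv svc by (auto simp: E'_def single_valued_def)
      show "end_disjoint E'" using less.prems(3) by (auto simp: end_disjoint_def E'_def)
      show "Range E' \<subseteq> Domain E'"
      proof
        fix q assume "q \<in> Range E'"
        then obtain p where p: "(p, q) \<in> E'" by blast
        then obtain r where r: "(q, r) \<in> E" using less.prems(6) by (auto simp: E'_def)
        moreover have "(q, r) \<notin> C"
        proof
          assume "(q, r) \<in> C"
          then have "q \<in> set vs" using Cin by fastforce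
          then show False using inn[of "(p, q)"] p by (auto simp: E'_def)
        qed
        ultimately show "q \<in> Domain E'" by (auto simp: E'_def)
      qed
    qed
    then obtain gs where gs: "\<forall>g\<in>set gs. valid_path g \<and> simple_path g \<and> pathfinish g = pathstart g"
      and dj: "\<forall>i<length gs. \<forall>j<length gs. i \<noteq> j \<longrightarrow> path_image (gs!i) \<inter> path_image (gs!j) = {}"
      and im: "(\<Union>g\<in>set gs. path_image g) = (\<Union>e\<in>E'. seg e)"
      and int: "\<And>f. continuous_on (\<Union>e\<in>E'. seg e) f \<Longrightarrow> cycle_int gs f = (\<Sum>e\<in>E'. edge_int f e)"
      unfolding Jordan_cycle_def by blast
    have djs: "seg e \<inter> seg e' = {}" if "e \<in> C" "e' \<in> E'" for e e'
    proof -
      have "seg e \<inter> seg e' \<subseteq> {fst e, snd e} \<inter> {fst e', snd e'}" by (rule edE) (use that EE' in auto)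
      moreover have "fst e' \<notin> set vs" "snd e' \<notin> set vs" using out inn that EE' by blast+
      moreover have "{fst e, snd e} \<inter> {fst e', snd e'} = {}"
        using Cin[OF that(1)] calculation(2,3) by auto
      ultimately show ?thesis by (simp only: subset_empty)
    qed
    have "path_image g \<inter> (\<Union>e\<in>E'. seg e) = {}"
    proof (rule equals0I)
      fix x assume "x \<in> path_image g \<inter> (\<Union>e\<in>E'. seg e)"
      then obtain e e' where "e \<in> C" "e' \<in> E'" "x \<in> seg e" "x \<in> seg e'"
        unfolding pg by (elim IntE UN_E)
      then show False using djs[of e e'] by (simp add: disjoint_iff)
    qed
    then have djg: "path_image g \<inter> path_image h = {}" if "h \<in> set gs" for h
      using that unfolding im[symmetric] by auto
    have F1: "\<forall>i<length (g#gs). \<forall>j<length (g#gs). i \<noteq> j \<longrightarrow> path_image ((g#gs)!i) \<inter> path_image ((g#gs)!j) = {}"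
    proof (intro allI impI)
      fix i j assume "i < length (g#gs)" "j < length (g#gs)" "i \<noteq> j"
      then show "path_image ((g#gs)!i) \<inter> path_image ((g#gs)!j) = {}"
        using dj djg[OF nth_mem] by (cases i; cases j) (simp_all add: Int_commute)
    qed
    have F2: "cycle_int (g # gs) f = (\<Sum>e\<in>E. edge_int f e)" if "continuous_on (\<Union>e\<in>E. seg e) f" for f
    proof -
      have "continuous_on (\<Union>e\<in>C. seg e) f" "continuous_on (\<Union>e\<in>E'. seg e) f"
        by (rule continuous_on_subset[OF that], simp add: EE'(1) UN_Un)+
      then show ?thesis using gint int EE' less.prems(1) by (simp add: sum.union_disjoint)
    qed
    have F3: "(\<Union>h\<in>set (g # gs). path_image h) = (\<Union>e\<in>E. seg e)"
      using im pg EE'(1) by (simp add: UN_Un)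
    have F4: "\<forall>h\<in>set (g # gs). valid_path h \<and> simple_path h \<and> pathfinish h = pathstart h"
      using gs \<open>simple_path g\<close> \<open>valid_path g\<close> \<open>pathfinish g = pathstart g\<close> by simp
    show ?thesis unfolding Jordan_cycle_def
      by (rule exI[of _ "g # gs"]) (intro conjI F4 F1 F3 allI impI F2)
  qed
qed

section \<open>Regions made of grid squares\<close>

locale square_grid =
  fixes d :: real
  assumes d_pos: "d > 0"
begin

text \<open>The grid is shifted by half a step vertically, so that conjugation maps
  the square \<open>(x, y)\<close> to the square \<open>(x, - y)\<close>.\<close>

definition cX :: "complex \<Rightarrow> real" where "cX z = Re z / d"
definition cY :: "complex \<Rightarrow> real" where "cY z = Im z / d + 1/2"

definition gp :: "int \<times> int \<Rightarrow> complex" where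
  "gp p = Complex (d * of_int (fst p)) (d * (of_int (snd p) - 1/2))"

definition sq :: "int \<times> int \<Rightarrow> complex set" where
  "sq p = {z. of_int (fst p) \<le> cX z \<and> cX z \<le> of_int (fst p) + 1 \<and> of_int (snd p) \<le> cY z \<and> cY z \<le> of_int (snd p) + 1}"

definition osq :: "int \<times> int \<Rightarrow> complex set" where
  "osq p = {z. of_int (fst p) < cX z \<and> cX z < of_int (fst p) + 1 \<and> of_int (snd p) < cY z \<and> cY z < of_int (snd p) + 1}"

lemma cX_gp [simp]: "cX (gp p) = of_int (fst p)" and cY_gp [simp]: "cY (gp p) = of_int (snd p)"
  using d_pos by (auto simp: cX_def cY_def gp_def)

lemma coords_eqI: "cX z = cX w \<Longrightarrow> cY z = cY w \<Longrightarrow> z = w"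
  using d_pos by (auto simp: cX_def cY_def complex_eq_iff)

lemma gp_eq_iff [simp]: "gp p = gp q \<longleftrightarrow> p = q"
  by (metis cX_gp cY_gp of_int_eq_iff prod_eqI)

lemma sq_eq_cbox: "sq (x, y) = cbox (gp (x, y)) (gp (x + 1, y + 1))"
  using d_pos by (auto simp: sq_def in_cbox_complex_iff gp_def cX_def cY_def field_simps)

lemma osq_eq_box: "osq (x, y) = box (gp (x, y)) (gp (x + 1, y + 1))"
  using d_pos by (auto simp: osq_def in_box_complex_iff gp_def cX_def cY_def field_simps)

lemma gp_corner [simp]:
  "Complex (Re (gp (x', y'))) (Im (gp (x, y))) = gp (x', y)"
  by (simp add: gp_def)

lemma box_ne: "box (gp (x, y)) (gp (x + 1, y + 1)) \<noteq> {}"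
  using d_pos by (auto simp: box_ne_empty Basis_complex_def gp_def algebra_simps)

lemma closure_osq: "closure (osq p) = sq p"
  by (cases p) (simp add: sq_eq_cbox osq_eq_box box_ne closure_box)

lemma open_osq: "open (osq p)"
  by (cases p) (simp only: osq_eq_box open_box)

lemma compact_sq: "compact (sq p)"
  by (cases p) (simp only: sq_eq_cbox compact_cbox)

lemma osq_subset_sq: "osq p \<subseteq> sq p"
  by (auto simp: osq_def sq_def)

lemma osq_sq_disjoint: "p \<noteq> q \<Longrightarrow> osq p \<inter> sq q = {}"
proof (rule equals0I)
  fix z assume "p \<noteq> q" "z \<in> osq p \<inter> sq q"
  then have "of_int (fst p) < (of_int (fst q + 1) :: real)" "of_int (fst q) < (of_int (fst p + 1) :: real)"
    "of_int (snd p) < (of_int (snd q + 1) :: real)" "of_int (snd q) < (of_int (snd p + 1) :: real)"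
    unfolding osq_def sq_def by auto
  then have "fst p = fst q" "snd p = snd q" unfolding of_int_less_iff by linarith+
  then show False using \<open>p \<noteq> q\<close> by (simp add: prod_eq_iff)
qed

lemma seg_horizontal: "closed_segment (gp (x, y)) (gp (x + 1, y)) = {z. x \<le> cX z \<and> cX z \<le> x + 1 \<and> cY z = y}"
proof -
  have "Re (gp (x, y)) \<le> Re (gp (x + 1, y))" using d_pos by (simp add: gp_def)
  moreover have "Im (gp (x, y)) = Im (gp (x + 1, y))" by (simp add: gp_def)
  ultimately show ?thesis using d_pos
    by (subst closed_segment_same_Im)
       (auto simp: closed_segment_eq_real_ivl gp_def cX_def cY_def field_simps)
qed

lemma seg_vertical: "closed_segment (gp (x, y)) (gp (x, y + 1)) = {z. cX z = x \<and> y \<le> cY z \<and> cY z \<le> y + 1}"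
proof -
  have "Im (gp (x, y)) \<le> Im (gp (x, y + 1))" using d_pos by (simp add: gp_def)
  moreover have "Re (gp (x, y)) = Re (gp (x, y + 1))" by (simp add: gp_def)
  ultimately show ?thesis using d_pos
    by (subst closed_segment_same_Re)
       (auto simp: closed_segment_eq_real_ivl gp_def cX_def cY_def field_simps)
qed

lemma cnj_sq: "cnj z \<in> sq (x, - y) \<longleftrightarrow> z \<in> sq (x, y)"
  using d_pos by (auto simp: sq_def cX_def cY_def)

end

text \<open>A pinch is a vertex at which exactly two diagonally opposite squares belong to
  \<open>M\<close>. Two boundary edges would leave it, and boundary curves would touch
  there.\<close>

locale pinch_free = square_grid +
  fixes M :: "(int \<times> int) set"
  assumes fin: "finite M"
    and no_pinch: "\<And>x y. \<not> ((x, y) \<in> M \<and> (x-1, y-1) \<in> M \<and> (x-1, y) \<notin> M \<and> (x, y-1) \<notin> M)"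
      "\<And>x y. \<not> ((x-1, y) \<in> M \<and> (x, y-1) \<in> M \<and> (x, y) \<notin> M \<and> (x-1, y-1) \<notin> M)"
begin

section \<open>The interior and the closure of a union of squares\<close>

definition tiles :: "complex set" where "tiles = (\<Union>p\<in>M. sq p)"

definition region :: "complex set" where "region = interior tiles"

lemma compact_tiles: "compact tiles"
  unfolding tiles_def using fin by (intro compact_UN) (auto simp: compact_sq)

lemma closed_tiles: "closed tiles"
  using compact_tiles by (rule compact_imp_closed)

lemma osq_tiles: "p \<notin> M \<Longrightarrow> osq p \<inter> tiles = {}"
  using osq_sq_disjoint[of p] by (fastforce simp: tiles_def)

text \<open>The squares that contain \<open>z\<close> cover a neighbourhood of it. With
  \<open>regionD\<close>, membership in the interior becomes a combinatorial condition on
  \<open>M\<close>.\<close>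

lemma regionI:
  assumes "\<And>p. z \<in> sq p \<Longrightarrow> p \<in> M"
  shows "z \<in> region"
proof -
  \<comment> \<open>\<open>a\<close> differs from the floor of \<open>cX z\<close> exactly when
    \<open>cX z\<close> is an integer, that is, when \<open>z\<close> lies on the common side of two
    columns. The two numbers thus name all columns that contain \<open>z\<close>; the same holds for
    \<open>b\<close> and the rows.\<close>
  define a where "a = \<lceil>cX z\<rceil> - 1"
  define b where "b = \<lceil>cY z\<rceil> - 1"
  define W where "W = {w. a < cX w \<and> cX w < \<lfloor>cX z\<rfloor> + 1 \<and> b < cY w \<and> cY w < \<lfloor>cY z\<rfloor> + 1}"
  have "continuous_on UNIV cX" "continuous_on UNIV cY"
    unfolding cX_def cY_def using d_pos by (auto intro!: continuous_intros)
  then have "open W" unfolding W_def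
    by (intro open_Collect_conj open_Collect_less continuous_intros)
  moreover have "z \<in> W" unfolding W_def a_def b_def by simp linarith
  moreover have "W \<subseteq> tiles"
  proof
    fix w assume w: "w \<in> W"
    define m where "m = (if cX w \<le> a + 1 then a else \<lfloor>cX z\<rfloor>)"
    define n where "n = (if cY w \<le> b + 1 then b else \<lfloor>cY z\<rfloor>)"
    have "m = a \<or> m = \<lfloor>cX z\<rfloor>" "n = b \<or> n = \<lfloor>cY z\<rfloor>" by (auto simp: m_def n_def)
    then have "z \<in> sq (m, n)" unfolding sq_def a_def b_def by simp linarith
    then have "(m, n) \<in> M" by (rule assms)
    moreover have "m \<le> cX w" "cX w \<le> m + 1" "n \<le> cY w" "cY w \<le> n + 1"
      using w unfolding W_def m_def n_def a_def b_def by (auto; linarith)+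
    then have "w \<in> sq (m, n)" unfolding sq_def by simp
    ultimately show "w \<in> tiles" unfolding tiles_def by blast
  qed
  ultimately show ?thesis unfolding region_def by (meson interiorI)
qed

lemma regionD:
  assumes "z \<in> region" "z \<in> sq p"
  shows "p \<in> M"
proof (rule ccontr)
  assume "p \<notin> M"
  then have "osq p \<inter> region = {}" using osq_tiles interior_subset unfolding region_def by blast
  moreover have "z \<in> closure (osq p)" using assms(2) by (simp add: closure_osq)
  moreover have "open region" by (simp add: region_def)
  ultimately show False using assms(1) by (metis IntI empty_iff open_Int_closure_eq_empty inf_commute)
qed

lemma osq_subset_region: "p \<in> M \<Longrightarrow> osq p \<subseteq> region"
  unfolding region_def tiles_def using osq_subset_sq by (intro interior_maximal open_osq) blast

lemma closure_region: "closure region = tiles"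
proof
  show "closure region \<subseteq> tiles" unfolding region_def
    by (intro closure_minimal closed_tiles interior_subset)
  show "tiles \<subseteq> closure region" unfolding tiles_def
    using closure_mono[OF osq_subset_region] closure_osq by blast
qed

text \<open>Boundary edges, oriented with the region on the left.\<close>

definition bedges :: "((int \<times> int) \<times> int \<times> int) set" where
  "bedges = {((a, b), (c, e)).
     c = a + 1 \<and> e = b \<and> (a, b) \<in> M \<and> (a, b-1) \<notin> M \<or>
     c = a - 1 \<and> e = b \<and> (a-1, b-1) \<in> M \<and> (a-1, b) \<notin> M \<or>
     c = a \<and> e = b + 1 \<and> (a-1, b) \<in> M \<and> (a, b) \<notin> M \<or>
     c = a \<and> e = b - 1 \<and> (a, b-1) \<in> M \<and> (a-1, b-1) \<notin> M}"

definition E :: "(complex \<times> complex) set" where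
  "E = map_prod gp gp ` bedges"

text \<open>A horizontal edge with left end \<open>(x, y)\<close> separates the squares
  \<open>(x, y)\<close> and \<open>(x, y - 1)\<close>, so it is a boundary edge iff exactly one of
  \<open>M\<close> and \<open>up\<close> contains \<open>(x, y)\<close>. \<open>rt\<close> does the
  same for vertical edges.\<close>

definition up :: "(int \<times> int) set" where "up = (\<lambda>(x, y). (x, y + 1)) ` M"
definition rt :: "(int \<times> int) set" where "rt = (\<lambda>(x, y). (x + 1, y)) ` M"

lemma mem_up: "(x, y) \<in> up \<longleftrightarrow> (x, y - 1) \<in> M" and mem_rt: "(x, y) \<in> rt \<longleftrightarrow> (x - 1, y) \<in> M"
  by (force simp: up_def rt_def)+

lemma bedges_cases:
  assumes "e \<in> bedges"
  obtains x y where "e = ((x, y), (x + 1, y))" "(x, y) \<in> M" "(x, y - 1) \<notin> M"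
  | x y where "e = ((x + 1, y), (x, y))" "(x, y - 1) \<in> M" "(x, y) \<notin> M"
  | x y where "e = ((x, y), (x, y + 1))" "(x - 1, y) \<in> M" "(x, y) \<notin> M"
  | x y where "e = ((x, y + 1), (x, y))" "(x, y) \<in> M" "(x - 1, y) \<notin> M"
proof -
  obtain a b c f where e: "e = ((a, b), (c, f))" by (metis prod.collapse)
  with assms consider "c = a + 1" "f = b" "(a, b) \<in> M" "(a, b-1) \<notin> M"
    | "c = a - 1" "f = b" "(a-1, b-1) \<in> M" "(a-1, b) \<notin> M"
    | "c = a" "f = b + 1" "(a-1, b) \<in> M" "(a, b) \<notin> M"
    | "c = a" "f = b - 1" "(a, b-1) \<in> M" "(a-1, b-1) \<notin> M"
    unfolding bedges_def by blast
  then show thesis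
    by cases (use that(1)[of a b] that(2)[of c b] that(3)[of a b] that(4)[of a f] e in auto)
qed

lemma bedges_eq:
  "bedges = (\<lambda>(x, y). ((x, y), (x + 1, y))) ` (M - up) \<union> (\<lambda>(x, y). ((x + 1, y), (x, y))) ` (up - M)
    \<union> (\<lambda>(x, y). ((x, y), (x, y + 1))) ` (rt - M) \<union> (\<lambda>(x, y). ((x, y + 1), (x, y))) ` (M - rt)"
    (is "_ = ?A \<union> ?B \<union> ?C \<union> ?D")
proof
  show "bedges \<subseteq> ?A \<union> ?B \<union> ?C \<union> ?D"
  proof
    fix e assume "e \<in> bedges"
    then show "e \<in> ?A \<union> ?B \<union> ?C \<union> ?D"
      by (cases rule: bedges_cases) (force simp: mem_up mem_rt)+
  qed
  show "?A \<union> ?B \<union> ?C \<union> ?D \<subseteq> bedges"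
    by (auto simp: bedges_def mem_up mem_rt)
qed

lemma finite_bedges: "finite bedges"
  unfolding bedges_eq using fin by (auto simp: up_def rt_def)

lemma bedges_out_iff:
  "((a, b), q) \<in> bedges \<longleftrightarrow>
     q = (a + 1, b) \<and> (a, b) \<in> M \<and> (a, b-1) \<notin> M \<or>
     q = (a - 1, b) \<and> (a-1, b-1) \<in> M \<and> (a-1, b) \<notin> M \<or>
     q = (a, b + 1) \<and> (a-1, b) \<in> M \<and> (a, b) \<notin> M \<or>
     q = (a, b - 1) \<and> (a, b-1) \<in> M \<and> (a-1, b-1) \<notin> M"
  by (cases q) (auto simp: bedges_def)

lemma bedges_in_iff:
  "(p, (c, e)) \<in> bedges \<longleftrightarrow>
     p = (c - 1, e) \<and> (c-1, e) \<in> M \<and> (c-1, e-1) \<notin> M \<or>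
     p = (c + 1, e) \<and> (c, e-1) \<in> M \<and> (c, e) \<notin> M \<or>
     p = (c, e - 1) \<and> (c-1, e-1) \<in> M \<and> (c, e-1) \<notin> M \<or>
     p = (c, e + 1) \<and> (c, e) \<in> M \<and> (c-1, e) \<notin> M"
  by (cases p) (auto simp: bedges_def)

text \<open>Of the four squares around a vertex, two edges leaving at a right angle make
  contradictory demands on one, and two edges leaving in opposite directions make a pinch.\<close>

lemma bedges_out_unique: "(p, q) \<in> bedges \<Longrightarrow> (p, q') \<in> bedges \<Longrightarrow> q = q'"
proof -
  obtain a b where p: "p = (a, b)" by (cases p)
  assume "(p, q) \<in> bedges" "(p, q') \<in> bedges"
  then show ?thesis using no_pinch[of a b] unfolding p bedges_out_iff by blast
qed

lemma bedges_in_unique: "(p, q) \<in> bedges \<Longrightarrow> (p', q) \<in> bedges \<Longrightarrow> p = p'"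
proof -
  obtain a b where q: "q = (a, b)" by (cases q)
  assume "(p, q) \<in> bedges" "(p', q) \<in> bedges"
  then show ?thesis using no_pinch[of a b] unfolding q bedges_in_iff by blast
qed

text \<open>On a counterclockwise turn around the vertex, an incoming edge marks a passage out of
  \<open>M\<close> and an outgoing edge a passage into \<open>M\<close>. A full turn that contains
  the one contains the other.\<close>

lemma bedges_continue: "(p, q) \<in> bedges \<Longrightarrow> \<exists>r. (q, r) \<in> bedges"
proof -
  obtain a b where q: "q = (a, b)" by (cases q)
  assume "(p, q) \<in> bedges"
  then show ?thesis unfolding q bedges_in_iff bedges_out_iff by blast
qed

lemma bedges_antisym: "(p, q) \<in> bedges \<Longrightarrow> (q, p) \<notin> bedges"
  by (cases p; cases q) (auto simp: bedges_def)

text \<open>A point on an edge is an end point, or it determines the undirected edge by rounding its coordinates.\<close>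

lemma bedges_point:
  assumes "e \<in> bedges" "z \<in> closed_segment (gp (fst e)) (gp (snd e))"
  defines "a \<equiv> \<lfloor>cX z\<rfloor>" and "b \<equiv> \<lfloor>cY z\<rfloor>"
  shows "if z \<in> range gp then z \<in> {gp (fst e), gp (snd e)}
    else if cX z = a then e \<in> {((a, b), (a, b + 1)), ((a, b + 1), (a, b))}
    else e \<in> {((a, b), (a + 1, b)), ((a + 1, b), (a, b))}"
proof -
  from assms(1) consider x y where "{fst e, snd e} = {(x, y), (x + 1, y)}" "e \<in> {((x, y), (x + 1, y)), ((x + 1, y), (x, y))}"
    | x y where "{fst e, snd e} = {(x, y), (x, y + 1)}" "e \<in> {((x, y), (x, y + 1)), ((x, y + 1), (x, y))}"
    by (cases rule: bedges_cases) auto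
  then show ?thesis
  proof cases
    case (1 x y)
    then have z: "x \<le> cX z" "cX z \<le> x + 1" "cY z = y"
      using assms(2) seg_horizontal[of x y] by (auto simp: closed_segment_commute)
    show ?thesis
    proof (cases "cX z = x \<or> cX z = x + 1")
      case True
      then have "z = gp (x, y) \<or> z = gp (x + 1, y)" using z(3) by (auto intro!: coords_eqI)
      then have "z \<in> gp ` {fst e, snd e}" unfolding 1(1) by blast
      then show ?thesis by auto
    next
      case False
      then have o: "x < cX z" "cX z < x + 1" using z by simp_all
      then have ax: "a = x" unfolding a_def by (intro floor_unique) simp_all
      then have a: "a = x" "b = y" "cX z \<noteq> a" using o z(3) by (simp_all add: b_def)
      have "z \<notin> range gp" using a(3) unfolding a_def by auto
      then show ?thesis using 1(2) a by simp
    qed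
  next
    case (2 x y)
    then have z: "cX z = x" "y \<le> cY z" "cY z \<le> y + 1"
      using assms(2) seg_vertical[of x y] by (auto simp: closed_segment_commute)
    show ?thesis
    proof (cases "cY z = y \<or> cY z = y + 1")
      case True
      then have "z = gp (x, y) \<or> z = gp (x, y + 1)" using z(1) by (auto intro!: coords_eqI)
      then have "z \<in> gp ` {fst e, snd e}" unfolding 2(1) by blast
      then show ?thesis by auto
    next
      case False
      then have o: "y < cY z" "cY z < y + 1" using z by simp_all
      then have bx: "b = y" unfolding b_def by (intro floor_unique) simp_all
      then have b: "a = x" "b = y" "cX z = a" "cY z \<noteq> b" using o z(1) by (simp_all add: a_def)
      have "z \<notin> range gp" using b(4) unfolding b_def by auto
      then show ?thesis using 2(2) b by simp
    qed
  qed
qed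

lemma bedges_ends_disjoint:
  assumes "e \<in> bedges" "e' \<in> bedges" "e \<noteq> e'"
    "z \<in> closed_segment (gp (fst e)) (gp (snd e))" "z \<in> closed_segment (gp (fst e')) (gp (snd e'))"
  shows "z \<in> {gp (fst e), gp (snd e)} \<inter> {gp (fst e'), gp (snd e')}"
  using bedges_point[OF assms(1,4)] bedges_point[OF assms(2,5)] assms(1-3) bedges_antisym
  by (auto split: if_splits)

lemma frontier_region: "frontier region = (\<Union>e\<in>E. seg e)"
proof
  show "(\<Union>e\<in>E. seg e) \<subseteq> frontier region"
  proof
    fix z assume "z \<in> (\<Union>e\<in>E. seg e)"
    then obtain e where e: "e \<in> bedges" and z: "z \<in> closed_segment (gp (fst e)) (gp (snd e))"
      unfolding E_def by auto
    from e have "\<exists>p\<in>M. \<exists>q. q \<notin> M \<and> z \<in> sq p \<and> z \<in> sq q"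
    proof (cases rule: bedges_cases)
      case (1 x y)
      then show ?thesis using z by (intro bexI[of _ "(x,y)"] exI[of _ "(x,y-1)"]) (auto simp: seg_horizontal sq_def)
    next
      case (2 x y)
      then show ?thesis using z
        by (intro bexI[of _ "(x,y-1)"] exI[of _ "(x,y)"]) (auto simp: seg_horizontal sq_def closed_segment_commute)
    next
      case (3 x y)
      then show ?thesis using z by (intro bexI[of _ "(x-1,y)"] exI[of _ "(x,y)"]) (auto simp: seg_vertical sq_def)
    next
      case (4 x y)
      then show ?thesis using z
        by (intro bexI[of _ "(x,y)"] exI[of _ "(x-1,y)"]) (auto simp: seg_vertical sq_def closed_segment_commute)
    qed
    then show "z \<in> frontier region"
      using regionD closure_region unfolding frontier_def by (auto simp: region_def tiles_def)
  qed
  show "frontier region \<subseteq> (\<Union>e\<in>E. seg e)"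
  proof
    fix z assume "z \<in> frontier region"
    then have "z \<in> tiles" "z \<notin> region" using closure_region unfolding frontier_def by (auto simp: region_def)
    then obtain a b a' b' where p: "(a, b) \<in> M" "z \<in> sq (a, b)" and q: "(a', b') \<notin> M" "z \<in> sq (a', b')"
      using regionI[of z] unfolding tiles_def by fastforce
    have ab: "a \<le> cX z" "cX z \<le> a + 1" "b \<le> cY z" "cY z \<le> b + 1"
      "a' \<le> cX z" "cX z \<le> a' + 1" "b' \<le> cY z" "cY z \<le> b' + 1" using p q by (auto simp: sq_def)
    then have "of_int a \<le> (of_int (a' + 1) :: real)" "of_int a' \<le> (of_int (a + 1) :: real)"
      "of_int b \<le> (of_int (b' + 1) :: real)" "of_int b' \<le> (of_int (b + 1) :: real)" by simp_all
    then have nb: "a \<le> a' + 1" "a' \<le> a + 1" "b \<le> b' + 1" "b' \<le> b + 1" unfolding of_int_le_iff by simp_all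
    \<comment> \<open>The square \<open>(a', b)\<close> shares its column with one of the two given
      squares and its row with the other. Whether or not it belongs to \<open>M\<close>, it forms
      with one of them a pair across a common side with just one member in \<open>M\<close>.\<close>
    have "\<exists>e\<in>bedges. z \<in> closed_segment (gp (fst e)) (gp (snd e))"
    proof (cases "(a', b) \<in> M")
      case True
      then have "b' = b + 1 \<or> b = b' + 1" using q nb by (cases "b = b'") auto
      then show ?thesis
      proof
        assume "b' = b + 1"
        then show ?thesis using True q(1) ab
          by (intro bexI[of _ "((a'+1, b'), (a', b'))"]) (auto simp: seg_horizontal closed_segment_commute bedges_def)
      next
        assume "b = b' + 1"
        then show ?thesis using True q(1) ab
          by (intro bexI[of _ "((a', b), (a'+1, b))"]) (auto simp: seg_horizontal bedges_def)
      qed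
    next
      case False
      then have "a' = a + 1 \<or> a = a' + 1" using p nb by (cases "a = a'") auto
      then show ?thesis
      proof
        assume "a' = a + 1"
        then show ?thesis using False p(1) ab
          by (intro bexI[of _ "((a', b), (a', b+1))"]) (auto simp: seg_vertical bedges_def)
      next
        assume "a = a' + 1"
        then show ?thesis using False p(1) ab
          by (intro bexI[of _ "((a, b+1), (a, b))"]) (auto simp: seg_vertical closed_segment_commute bedges_def)
      qed
    qed
    then show "z \<in> (\<Union>e\<in>E. seg e)" unfolding E_def by auto
  qed
qed

text \<open>A side shared by two squares of \<open>M\<close> is run in both directions and cancels.
  Written in bottom sides \<open>H\<close> and left sides \<open>V\<close>, this is a reindexing by
  \<open>up\<close> and \<open>rt\<close>. Continuity is asked on the outlines of the squares only,
  which leaves room for a pole inside a square.\<close>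

lemma edge_int_sum:
  assumes f: "\<And>p. p \<in> M \<Longrightarrow> continuous_on (sq p - osq p) f"
  shows "(\<Sum>e\<in>E. edge_int f e) = (\<Sum>(x, y)\<in>M. contour_integral (rectpath (gp (x, y)) (gp (x + 1, y + 1))) f)"
proof -
  define H where "H = (\<lambda>(x, y). edge_int f (gp (x, y), gp (x + 1, y)))"
  define V where "V = (\<lambda>(x, y). edge_int f (gp (x, y), gp (x, y + 1)))"
  have ch: "continuous_on (closed_segment (gp (x, y)) (gp (x + 1, y))) f" if "(x, y) \<in> M \<or> (x, y - 1) \<in> M" for x y
    using that
  proof
    assume "(x, y) \<in> M"
    then show ?thesis by (rule continuous_on_subset[OF f]) (auto simp: seg_horizontal sq_def osq_def)
  next
    assume "(x, y - 1) \<in> M"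
    then show ?thesis by (rule continuous_on_subset[OF f]) (auto simp: seg_horizontal sq_def osq_def)
  qed
  have cv: "continuous_on (closed_segment (gp (x, y)) (gp (x, y + 1))) f" if "(x, y) \<in> M \<or> (x - 1, y) \<in> M" for x y
    using that
  proof
    assume "(x, y) \<in> M"
    then show ?thesis by (rule continuous_on_subset[OF f]) (auto simp: seg_vertical sq_def osq_def)
  next
    assume "(x - 1, y) \<in> M"
    then show ?thesis by (rule continuous_on_subset[OF f]) (auto simp: seg_vertical sq_def osq_def)
  qed
  have Hr: "edge_int f (gp (x + 1, y), gp (x, y)) = - H (x, y)" if "(x, y) \<in> M \<or> (x, y - 1) \<in> M" for x y
    unfolding H_def edge_int_def
    by (simp add: contour_integral_reverse_linepath[OF ch[OF that]])
  have Vr: "edge_int f (gp (x, y + 1), gp (x, y)) = - V (x, y)" if "(x, y) \<in> M \<or> (x - 1, y) \<in> M" for x y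
    unfolding V_def edge_int_def
    by (simp add: contour_integral_reverse_linepath[OF cv[OF that]])
  have rect: "contour_integral (rectpath (gp (x, y)) (gp (x + 1, y + 1))) f = H (x, y) + V (x + 1, y) - H (x, y + 1) - V (x, y)"
    if "(x, y) \<in> M" for x y
  proof -
    have i: "f contour_integrable_on linepath (gp (x, y)) (gp (x + 1, y))"
      "f contour_integrable_on linepath (gp (x + 1, y)) (gp (x + 1, y + 1))"
      "f contour_integrable_on linepath (gp (x + 1, y + 1)) (gp (x, y + 1))"
      "f contour_integrable_on linepath (gp (x, y + 1)) (gp (x, y))"
      using ch[of x y] ch[of x "y + 1"] cv[of x y] cv[of "x + 1" y] that
      by (auto intro!: contour_integrable_continuous_linepath simp: closed_segment_commute)
    have "contour_integral (rectpath (gp (x, y)) (gp (x + 1, y + 1))) f =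
      edge_int f (gp (x, y), gp (x + 1, y)) + (edge_int f (gp (x + 1, y), gp (x + 1, y + 1))
      + (edge_int f (gp (x + 1, y + 1), gp (x, y + 1)) + edge_int f (gp (x, y + 1), gp (x, y))))"
      using i by (simp add: rectpath_def Let_def edge_int_def)
    then show ?thesis using Hr[of x "y + 1"] Vr[of x y] that by (simp add: H_def V_def)
  qed
  have fu: "finite up" "finite rt" using fin by (auto simp: up_def rt_def)
  have "(\<Sum>e\<in>E. edge_int f e) = (\<Sum>e\<in>bedges. edge_int f (map_prod gp gp e))"
    unfolding E_def by (subst sum.reindex) (auto simp: inj_on_def)
  also have "\<dots> = (\<Sum>p\<in>M - up. H p) + (\<Sum>p\<in>up - M. - H p) + (\<Sum>p\<in>rt - M. V p) + (\<Sum>p\<in>M - rt. - V p)"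
  proof -
    have "(\<Sum>p\<in>M - up. H p) = (\<Sum>e\<in>(\<lambda>(x, y). ((x, y), (x + 1, y))) ` (M - up). edge_int f (map_prod gp gp e))"
      by (subst sum.reindex) (auto simp: inj_on_def H_def intro!: sum.cong)
    moreover have "(\<Sum>p\<in>up - M. - H p) = (\<Sum>e\<in>(\<lambda>(x, y). ((x + 1, y), (x, y))) ` (up - M). edge_int f (map_prod gp gp e))"
      by (subst sum.reindex) (auto simp: inj_on_def Hr mem_up intro!: sum.cong)
    moreover have "(\<Sum>p\<in>rt - M. V p) = (\<Sum>e\<in>(\<lambda>(x, y). ((x, y), (x, y + 1))) ` (rt - M). edge_int f (map_prod gp gp e))"
      by (subst sum.reindex) (auto simp: inj_on_def V_def intro!: sum.cong)
    moreover have "(\<Sum>p\<in>M - rt. - V p) = (\<Sum>e\<in>(\<lambda>(x, y). ((x, y + 1), (x, y))) ` (M - rt). edge_int f (map_prod gp gp e))"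
      by (subst sum.reindex) (auto simp: inj_on_def Vr intro!: sum.cong)
    ultimately show ?thesis unfolding bedges_eq using fin fu
      by (subst sum.union_disjoint, simp, simp, fastforce)+ simp
  qed
  also have "\<dots> = (\<Sum>p\<in>M. H p) - (\<Sum>p\<in>up. H p) + (\<Sum>p\<in>rt. V p) - (\<Sum>p\<in>M. V p)"
  proof -
    have dif: "(\<Sum>p\<in>A - B. h p) - (\<Sum>p\<in>B - A. h p) = (\<Sum>p\<in>A. h p) - (\<Sum>p\<in>B. h p)"
      if "finite A" "finite B" for A B and h :: "int \<times> int \<Rightarrow> complex"
      using sum.Int_Diff[OF that(1), of h B] sum.Int_Diff[OF that(2), of h A] by (simp add: Int_commute)
    show ?thesis using dif[OF fin fu(1), of H] dif[OF fu(2) fin, of V] by (simp add: sum_negf)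
  qed
  also have "(\<Sum>p\<in>up. H p) = (\<Sum>(x, y)\<in>M. H (x, y + 1))"
    unfolding up_def by (subst sum.reindex) (auto simp: inj_on_def intro!: sum.cong)
  also have "(\<Sum>p\<in>rt. V p) = (\<Sum>(x, y)\<in>M. V (x + 1, y))"
    unfolding rt_def by (subst sum.reindex) (auto simp: inj_on_def intro!: sum.cong)
  also have "(\<Sum>p\<in>M. H p) - (\<Sum>(x, y)\<in>M. H (x, y + 1)) + (\<Sum>(x, y)\<in>M. V (x + 1, y)) - (\<Sum>p\<in>M. V p)
    = (\<Sum>(x, y)\<in>M. contour_integral (rectpath (gp (x, y)) (gp (x + 1, y + 1))) f)"
    unfolding sum_subtractf[symmetric] sum.distrib[symmetric]
    by (intro sum.cong refl) (auto simp: rect split: prod.split)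
  finally show ?thesis .
qed

text \<open>The outline of a square winds once around its interior and not at all around points
  outside. Points of the region on grid lines may lie on such outlines;
  \<open>region_pos_boundary\<close> reaches them by local constancy of the index.\<close>

lemma E_winding:
  assumes "z \<in> osq p \<or> z \<notin> tiles"
  shows "(\<Sum>e\<in>E. edge_int (\<lambda>w. 1 / (w - z)) e) = 2 * of_real pi * \<i> * (if z \<in> tiles then 1 else 0)"
proof -
  have zb: "z \<notin> sq q - osq q" if "q \<in> M" for q
    using assms that osq_sq_disjoint[of p q] unfolding tiles_def by auto
  have "(\<Sum>e\<in>E. edge_int (\<lambda>w. 1 / (w - z)) e) =
    (\<Sum>(x, y)\<in>M. contour_integral (rectpath (gp (x, y)) (gp (x + 1, y + 1))) (\<lambda>w. 1 / (w - z)))"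
    by (rule edge_int_sum) (use zb in \<open>auto intro!: continuous_intros\<close>)
  also have "\<dots> = (\<Sum>q\<in>M. 2 * of_real pi * \<i> * (if z \<in> osq q then 1 else 0))"
  proof (intro sum.cong refl)
    fix q assume q: "q \<in> M"
    obtain x y where xy: "q = (x, y)" by (cases q)
    let ?r = "rectpath (gp (x, y)) (gp (x + 1, y + 1))"
    have le: "Re (gp (x, y)) \<le> Re (gp (x + 1, y + 1))" "Im (gp (x, y)) \<le> Im (gp (x + 1, y + 1))"
      using d_pos by (auto simp: gp_def)
    have "path_image ?r = sq q - osq q"
      using path_image_rectpath_cbox_minus_box[OF le] by (simp add: xy sq_eq_cbox osq_eq_box)
    then have nz: "z \<notin> path_image ?r" using zb[OF q] by simp
    have "winding_number ?r z = (if z \<in> osq q then 1 else 0)"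
    proof (cases "z \<in> osq q")
      case True
      then show ?thesis using winding_number_rectpath[of z] by (simp add: xy osq_eq_box)
    next
      case False
      then have "z \<notin> cbox (gp (x, y)) (gp (x + 1, y + 1))" using zb[OF q] by (simp add: xy sq_eq_cbox)
      then show ?thesis using winding_number_rectpath_outside[OF le] False by simp
    qed
    then show "(case q of (x, y) \<Rightarrow> contour_integral (rectpath (gp (x, y)) (gp (x + 1, y + 1))) (\<lambda>w. 1 / (w - z)))
      = 2 * of_real pi * \<i> * (if z \<in> osq q then 1 else 0)"
      using winding_number_valid_path[of ?r z] nz by (simp add: xy field_simps)
  qed
  also have "\<dots> = 2 * of_real pi * \<i> * (\<Sum>q\<in>M. if z \<in> osq q then 1 else 0)"
    by (simp add: sum_distrib_left)
  also have "(\<Sum>q\<in>M. if z \<in> osq q then 1 else (0::complex)) = (if z \<in> tiles then 1 else 0)"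
  proof (cases "z \<in> tiles")
    case True
    then have z: "z \<in> osq p" using assms by simp
    moreover have "p \<in> M" using True z osq_tiles[of p] by blast
    moreover have "z \<in> osq q \<longleftrightarrow> q = p" for q
      using z osq_sq_disjoint[of p q] osq_subset_sq[of q] by auto
    ultimately show ?thesis using True fin by simp
  next
    case False
    then have "z \<notin> osq q" if "q \<in> M" for q using that osq_subset_sq[of q] by (auto simp: tiles_def)
    then show ?thesis using False by simp
  qed
  finally show ?thesis .
qed

lemma region_pos_boundary: "\<exists>gs. pos_boundary region gs"
proof -
  have "\<exists>gs. Jordan_cycle E gs"
  proof (rule segments_Jordan_decomposition)
    show "finite E" unfolding E_def using finite_bedges by simp
    show "p \<noteq> q" if "(p, q) \<in> E" for p q using that unfolding E_def bedges_def by auto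
    show "end_disjoint E"
      unfolding end_disjoint_def
    proof (intro ballI impI subsetI)
      fix e e' z assume "e \<in> E" "e' \<in> E" "e \<noteq> e'" "z \<in> seg e \<inter> seg e'"
      from \<open>e \<in> E\<close> obtain b where "b \<in> bedges" "e = map_prod gp gp b" unfolding E_def by (elim imageE)
      moreover from \<open>e' \<in> E\<close> obtain b' where "b' \<in> bedges" "e' = map_prod gp gp b'" unfolding E_def by (elim imageE)
      ultimately have b: "b \<in> bedges" "b' \<in> bedges" "b \<noteq> b'" "e = map_prod gp gp b" "e' = map_prod gp gp b'"
        using \<open>e \<noteq> e'\<close> by auto
      then show "z \<in> {fst e, snd e} \<inter> {fst e', snd e'}"
        using bedges_ends_disjoint[OF b(1-3), of z] \<open>z \<in> seg e \<inter> seg e'\<close> by simp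
    qed
    show "single_valued E" unfolding E_def single_valued_def using bedges_out_unique by fastforce
    show "single_valued (E\<inverse>)" unfolding E_def single_valued_def using bedges_in_unique by fastforce
    show "Range E \<subseteq> Domain E" unfolding E_def using bedges_continue by fastforce
  qed
  then obtain gs where gs: "\<forall>g\<in>set gs. valid_path g \<and> simple_path g \<and> pathfinish g = pathstart g"
      and dj: "\<forall>i<length gs. \<forall>j<length gs. i \<noteq> j \<longrightarrow> path_image (gs!i) \<inter> path_image (gs!j) = {}"
      and im: "(\<Union>g\<in>set gs. path_image g) = (\<Union>e\<in>E. seg e)"
      and int: "\<And>f. continuous_on (\<Union>e\<in>E. seg e) f \<Longrightarrow> cycle_int gs f = (\<Sum>e\<in>E. edge_int f e)"
    unfolding Jordan_cycle_def by blast
  have fr: "frontier region = (\<Union>g\<in>set gs. path_image g)" using im frontier_region by simp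
  have cyc: "cycle_in (frontier region) gs" unfolding cycle_in_def fr using gs by auto
  have nfr: "frontier region \<inter> region = {}" "frontier region \<inter> - tiles = {}"
    using closure_region unfolding frontier_def by (auto simp: region_def)
  have ind: "cycle_ind gs z = (if z \<in> tiles then 1 else 0)" if "z \<in> osq p \<or> z \<notin> tiles" "z \<notin> frontier region" for z p
  proof -
    have "cycle_int gs (\<lambda>w. 1 / (w - z)) = (\<Sum>e\<in>E. edge_int (\<lambda>w. 1 / (w - z)) e)"
      by (rule int) (use that(2) in \<open>auto intro!: continuous_intros simp: fr im\<close>)
    then show ?thesis
      using E_winding[OF that(1)] cycle_ind_eq_int[OF cyc that(2)] by (auto split: if_splits)
  qed
  \<comment> \<open>A point of the region on a grid line still lies in the closure of an open square
    of \<open>M\<close>, and the index is constant on a ball inside the region.\<close>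
  have one: "cycle_ind gs z = 1" if z: "z \<in> region" for z
  proof -
    obtain r where r: "r > 0" "ball z r \<subseteq> region"
      using z openE[of region z] by (auto simp: region_def)
    obtain p where p: "p \<in> M" "z \<in> closure (osq p)"
      using z closure_region closure_subset unfolding tiles_def closure_osq by blast
    then obtain w where w: "w \<in> osq p" "dist w z < r" using r(1) by (meson closure_approachable)
    then have wb: "w \<in> ball z r" by (simp add: dist_commute)
    have "w \<in> tiles" using w p osq_subset_sq unfolding tiles_def by blast
    moreover have "w \<notin> frontier region" using wb r(2) nfr(1) by blast
    ultimately have "cycle_ind gs w = 1" using ind[of w p] w(1) by simp
    moreover have "winding_number g z = winding_number g w" if "g \<in> set gs" for g
    proof -
      have "path g" "pathfinish g = pathstart g" "ball z r \<inter> path_image g = {}"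
        using gs that r(2) nfr(1) fr by (auto simp: valid_path_imp_path)
      then show ?thesis
        using wb r(1) by (intro winding_number_eq[where S = "ball z r"]) auto
    qed
    then have "cycle_ind gs z = cycle_ind gs w"
      unfolding cycle_ind_def by (intro arg_cong[of _ _ sum_list] map_cong) auto
    ultimately show ?thesis by simp
  qed
  have "cycle_ind gs z = 0" if "z \<notin> closure region" for z
    using ind[of z] that nfr by (auto simp: closure_region)
  then show ?thesis
    unfolding pos_boundary_def using gs dj fr one by (intro exI[of _ gs]) (auto simp: cycle_ind_def)
qed

end

section \<open>Existence of symmetric Cauchy domains\<close>

text \<open>The region consists of all bricks (horizontal dominoes in a running bond pattern) meeting \<open>K\<close>;
  only three bricks meet at a vertex, so the boundary has no pinch points.\<close>

theorem symmetric_Cauchy_domain_exists: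
  assumes K: "compact K" and D: "open D" and KD: "K \<subseteq> D" and sym: "\<And>z. z \<in> K \<Longrightarrow> cnj z \<in> K"
  obtains V gs where "open V" "bounded V" "\<And>z. z \<in> V \<Longrightarrow> cnj z \<in> V" "K \<subseteq> V" "closure V \<subseteq> D"
    "pos_boundary V gs"
proof -
  obtain \<epsilon> where \<epsilon>: "\<epsilon> > 0" "(\<Union>k\<in>K. ball k \<epsilon>) \<subseteq> D"
    using compact_subset_open_imp_ball_epsilon_subset[OF K D KD] by blast
  \<comment> \<open>Two points of one brick differ by at most two steps horizontally and one
    vertically, hence by at most 3/4 of \<epsilon>. So a brick that meets \<open>K\<close> stays
    inside \<open>D\<close>.\<close>
  interpret square_grid "\<epsilon> / 4" by unfold_locales (use \<epsilon> in simp)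
  define hit where "hit p \<longleftrightarrow> sq p \<inter> K \<noteq> {}" for p
  \<comment> \<open>The other half of the brick. The parity of \<open>x + y\<close> shifts the
    bricks by one square from each row to the next.\<close>
  define mate where "mate = (\<lambda>(x, y). if even (x + y) then (x + 1, y) else (x - 1, y :: int))"
  define M where "M = {p. hit p \<or> hit (mate p)}"
  have mate_mate: "mate (mate p) = p" for p by (cases p) (auto simp: mate_def)
  have M_mate: "mate p \<in> M \<longleftrightarrow> p \<in> M" for p by (auto simp: M_def mate_mate)
  obtain B where B: "\<And>k. k \<in> K \<Longrightarrow> norm k \<le> B" using compact_imp_bounded[OF K] by (auto simp: bounded_iff)
  \<comment> \<open>The slack 2 absorbs the width of a square and the half step in
    \<open>cY\<close>.\<close>
  define N where "N = \<lceil>\<bar>B\<bar> / (\<epsilon> / 4)\<rceil> + 2"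
  have hitN: "p \<in> {-N..N} \<times> {-N..N}" if "hit p" for p
  proof -
    obtain k where k: "k \<in> sq p" "k \<in> K" using \<open>hit p\<close> by (auto simp: hit_def)
    have "\<bar>Re k\<bar> \<le> \<bar>B\<bar>" "\<bar>Im k\<bar> \<le> \<bar>B\<bar>"
      using B[OF k(2)] abs_Re_le_cmod[of k] abs_Im_le_cmod[of k] by linarith+
    then have "\<bar>Re k / (\<epsilon>/4)\<bar> \<le> \<bar>B\<bar> / (\<epsilon>/4)" "\<bar>Im k / (\<epsilon>/4)\<bar> \<le> \<bar>B\<bar> / (\<epsilon>/4)"
      using \<epsilon>(1) by (simp_all only: abs_divide) (auto intro!: divide_right_mono)
    moreover have "\<bar>B\<bar> / (\<epsilon> / 4) \<le> of_int N - 2" unfolding N_def by simp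
    ultimately have "\<bar>cX k\<bar> \<le> of_int N - 2" "\<bar>cY k - 1/2\<bar> \<le> of_int N - 2"
      unfolding cX_def cY_def by linarith+
    then have "- of_int N \<le> (of_int (fst p) :: real)" "(of_int (fst p) :: real) \<le> of_int N"
      "- of_int N \<le> (of_int (snd p) :: real)" "(of_int (snd p) :: real) \<le> of_int N"
      using k(1) unfolding sq_def by auto
    then have "- N \<le> fst p" "fst p \<le> N" "- N \<le> snd p" "snd p \<le> N" by linarith+
    then show ?thesis by (cases p) auto
  qed
  have "finite {p. hit p}" by (rule finite_subset[of _ "{-N..N} \<times> {-N..N}"]) (use hitN in auto)
  moreover have "{p. hit (mate p)} \<subseteq> mate ` {p. hit p}" 
  proof
    fix p assume "p \<in> {p. hit (mate p)}"
    then show "p \<in> mate ` {p. hit p}" by (intro image_eqI[of _ _ "mate p"]) (simp_all add: mate_mate)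
  qed
  ultimately have finM: "finite M" unfolding M_def Collect_disj_eq

    by (meson finite_Un finite_imageI finite_subset)
  have near: "\<exists>k\<in>K. w \<in> ball k \<epsilon>" if p: "p \<in> M" "w \<in> sq p" for p w
  proof -
    obtain q where q: "q = p \<or> q = mate p" "hit q" using p(1) unfolding M_def by blast
    then obtain k where k: "k \<in> K" "k \<in> sq q" by (auto simp: hit_def)
    have "fst q - 1 \<le> fst p" "fst p \<le> fst q + 1" "snd q = snd p"
      using q(1) by (auto simp: mate_def split: prod.splits)
    then have "of_int (fst q) - 1 \<le> (of_int (fst p) :: real)" "(of_int (fst p) :: real) \<le> of_int (fst q) + 1" "snd q = snd p"
      by linarith+
    then have "\<bar>cX k - cX w\<bar> \<le> 2" "\<bar>cY k - cY w\<bar> \<le> 1" using k(2) p(2) unfolding sq_def by auto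
    moreover have "Re k - Re w = (cX k - cX w) * (\<epsilon> / 4)" "Im k - Im w = (cY k - cY w) * (\<epsilon> / 4)"
      using \<epsilon>(1) by (simp_all add: cX_def cY_def field_simps)
    ultimately have "\<bar>Re k - Re w\<bar> \<le> 2 * (\<epsilon> / 4)" "\<bar>Im k - Im w\<bar> \<le> 1 * (\<epsilon> / 4)"
      using \<epsilon>(1) by (simp_all only: abs_mult abs_of_pos[OF d_pos] mult_right_mono[OF _ less_imp_le[OF d_pos]])
    then have "norm (k - w) < \<epsilon>" using cmod_le[of "k - w"] \<epsilon>(1) by simp
    then show ?thesis using k(1) by (auto simp: dist_norm)
  qed
  interpret pinch_free "\<epsilon> / 4" M
  proof
    show "finite M" by (rule finM)
    fix x y :: int
    \<comment> \<open>Depending on the parity, the two squares above the vertex or the two below it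
      form one brick and lie in \<open>M\<close> together or not at all. This excludes both kinds of
      pinch.\<close>
    have "(x, y) \<in> M \<longleftrightarrow> (x - 1, y) \<in> M" if "odd (x + y)"
      using M_mate[of "(x, y)"] that by (auto simp: mate_def)
    moreover have "(x - 1, y - 1) \<in> M \<longleftrightarrow> (x, y - 1) \<in> M" if "even (x + y)"
      using M_mate[of "(x - 1, y - 1)"] that by (auto simp: mate_def)
    ultimately show "\<not> ((x, y) \<in> M \<and> (x-1, y-1) \<in> M \<and> (x-1, y) \<notin> M \<and> (x, y-1) \<notin> M)"
      "\<not> ((x-1, y) \<in> M \<and> (x, y-1) \<in> M \<and> (x, y) \<notin> M \<and> (x-1, y-1) \<notin> M)" by blast+
  qed
  have tilesD: "tiles \<subseteq> D" using near \<epsilon>(2) unfolding tiles_def by blast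
  have hsym: "hit (x, - y) \<longleftrightarrow> hit (x, y)" for x y
  proof -
    have "hit (x, - y)" if "hit (x, y)" for x y
    proof -
      obtain k where "k \<in> sq (x, y)" "k \<in> K" using \<open>hit (x, y)\<close> by (auto simp: hit_def)
      then have "cnj k \<in> sq (x, - y) \<inter> K" using sym cnj_sq by blast
      then show ?thesis unfolding hit_def by blast
    qed
    from this[of x y] this[of x "-y"] show ?thesis by auto
  qed
  \<comment> \<open>A change of sign of \<open>y\<close> keeps the parity of \<open>x + y\<close>,
    so reflection maps bricks to bricks.\<close>
  have Msym: "(x, - y) \<in> M \<longleftrightarrow> (x, y) \<in> M" for x y
  proof -
    have "mate (x, - y) = (fst (mate (x, y)), - y)" "mate (x, y) = (fst (mate (x, y)), y)" by (auto simp: mate_def)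
    then show ?thesis using hsym unfolding M_def mem_Collect_eq by metis
  qed
  obtain gs where gs: "pos_boundary region gs" using region_pos_boundary by blast
  show thesis
  proof (rule that[of region gs])
    show "open region" by (simp add: region_def)
    show "bounded region" using compact_imp_bounded[OF compact_tiles] interior_subset bounded_subset
      unfolding region_def by blast
    show "cnj z \<in> region" if z: "z \<in> region" for z
    proof (rule regionI)
      fix p assume "cnj z \<in> sq p"
      then have "z \<in> sq (fst p, - snd p)" using cnj_sq[of "cnj z" "fst p" "snd p"] by simp
      then have "(fst p, - snd p) \<in> M" by (rule regionD[OF z])
      then show "p \<in> M" using Msym[of "fst p" "snd p"] by simp
    qed
    show "K \<subseteq> region" 
    proof (intro subsetI regionI)
      fix k p assume "k \<in> K" "k \<in> sq p"
      then show "p \<in> M" unfolding M_def hit_def by blast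
    qed
    show "closure region \<subseteq> D" using closure_region tilesD by simp
    show "pos_boundary region gs" by (rule gs)
  qed
qed

section \<open>The complexified operator algebra\<close>

text \<open>A pair \<open>(A, B)\<close> of operators stands for \<open>A + i B\<close> in the complexification of \<open>B(X_R)\<close>.\<close>

type_synonym 'x cop = "('x \<Rightarrow>\<^sub>L 'x) \<times> ('x \<Rightarrow>\<^sub>L 'x)"

definition cm :: "'x::real_normed_vector cop \<Rightarrow> 'x cop \<Rightarrow> 'x cop" where
  "cm a b = ((fst a o\<^sub>L fst b) - (snd a o\<^sub>L snd b), (fst a o\<^sub>L snd b) + (snd a o\<^sub>L fst b))"

definition cunit :: "'x::real_normed_vector cop" where
  "cunit = (id_blinfun, 0)"

definition cs :: "complex \<Rightarrow> 'x::real_normed_vector cop \<Rightarrow> 'x cop" where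
  "cs c a = (Re c *\<^sub>R fst a - Im c *\<^sub>R snd a, Re c *\<^sub>R snd a + Im c *\<^sub>R fst a)"

definition cconj :: "'x::real_normed_vector cop \<Rightarrow> 'x cop" where
  "cconj a = (fst a, - snd a)"

lemma blinfun_compose_simps:
  "(a + b) o\<^sub>L c = (a o\<^sub>L c) + (b o\<^sub>L c)" "a o\<^sub>L (b + c) = (a o\<^sub>L b) + (a o\<^sub>L c)"
  "(a - b) o\<^sub>L c = (a o\<^sub>L c) - (b o\<^sub>L c)" "a o\<^sub>L (b - c) = (a o\<^sub>L b) - (a o\<^sub>L c)"
  "(- a) o\<^sub>L c = - (a o\<^sub>L c)" "a o\<^sub>L (- c) = - (a o\<^sub>L c)"
  "(r *\<^sub>R a) o\<^sub>L c = r *\<^sub>R (a o\<^sub>L c)" "a o\<^sub>L (r *\<^sub>R c) = r *\<^sub>R (a o\<^sub>L c)"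
  "0 o\<^sub>L c = 0" "a o\<^sub>L 0 = 0" "id_blinfun o\<^sub>L a = a" "a o\<^sub>L id_blinfun = a"
  "(a o\<^sub>L b) o\<^sub>L c = a o\<^sub>L (b o\<^sub>L c)"
  by (auto intro!: blinfun_eqI simp: blinfun.bilinear_simps)

lemma cm_assoc: "cm (cm a b) c = cm a (cm b c)"
  by (simp add: cm_def blinfun_compose_simps)

lemma cm_one [simp]: "cm cunit a = a" "cm a cunit = a"
  by (simp_all add: cm_def cunit_def blinfun_compose_simps)

interpretation cm: bounded_bilinear "cm :: 'x::real_normed_vector cop \<Rightarrow> 'x cop \<Rightarrow> 'x cop"
proof
  fix a b c :: "'x cop" and r :: real
  show "cm (a + b) c = cm a c + cm b c" "cm a (b + c) = cm a b + cm a c"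
    "cm (r *\<^sub>R a) b = r *\<^sub>R cm a b" "cm a (r *\<^sub>R b) = r *\<^sub>R cm a b"
    by (simp_all add: cm_def blinfun_compose_simps algebra_simps)
  have "norm (cm a b) \<le> norm a * norm b * 4" for a b :: "'x cop"
  proof -
    have c: "norm (x o\<^sub>L y) \<le> norm a * norm b" if "norm x \<le> norm a" "norm y \<le> norm b" for x y :: "'x \<Rightarrow>\<^sub>L 'x"
      using norm_blinfun_compose[of x y] mult_mono[OF that] by (meson norm_ge_zero order_trans)
    have f: "norm (fst a) \<le> norm a" "norm (snd a) \<le> norm a" "norm (fst b) \<le> norm b" "norm (snd b) \<le> norm b"
      by (metis norm_fst_le prod.collapse, metis norm_snd_le prod.collapse)+
    have "norm (cm a b) \<le> norm ((fst a o\<^sub>L fst b) - (snd a o\<^sub>L snd b)) + norm ((fst a o\<^sub>L snd b) + (snd a o\<^sub>L fst b))"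
      unfolding cm_def by (rule norm_Pair_le)
    also have "\<dots> \<le> (norm (fst a o\<^sub>L fst b) + norm (snd a o\<^sub>L snd b)) + (norm (fst a o\<^sub>L snd b) + norm (snd a o\<^sub>L fst b))"
      by (intro add_mono norm_triangle_ineq4 norm_triangle_ineq)
    also have "\<dots> \<le> (norm a * norm b + norm a * norm b) + (norm a * norm b + norm a * norm b)"
      by (intro add_mono c f)
    finally show ?thesis by simp
  qed
  then show "\<exists>K. \<forall>a b :: 'x cop. norm (cm a b) \<le> norm a * norm b * K" by blast
qed

interpretation cs: bounded_bilinear "cs :: complex \<Rightarrow> 'x::real_normed_vector cop \<Rightarrow> 'x cop"
proof
  fix a b :: complex and c d :: "'x cop" and r :: real
  show "cs (a + b) c = cs a c + cs b c" "cs a (c + d) = cs a c + cs a d"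
    "cs (r *\<^sub>R a) c = r *\<^sub>R cs a c" "cs a (r *\<^sub>R c) = r *\<^sub>R cs a c"
    by (simp_all add: cs_def algebra_simps)
  have "norm (cs a c) \<le> norm a * norm c * 4" for a and c :: "'x cop"
  proof -
    have s: "norm (r *\<^sub>R x) \<le> norm a * norm c" if "\<bar>r\<bar> \<le> norm a" "norm x \<le> norm c" for r and x :: "'x \<Rightarrow>\<^sub>L 'x"
      using mult_mono[OF that] by simp
    have f: "norm (fst c) \<le> norm c" "norm (snd c) \<le> norm c"
      by (metis norm_fst_le prod.collapse, metis norm_snd_le prod.collapse)
    have "norm (cs a c) \<le> norm (Re a *\<^sub>R fst c - Im a *\<^sub>R snd c) + norm (Re a *\<^sub>R snd c + Im a *\<^sub>R fst c)"
      unfolding cs_def by (rule norm_Pair_le)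
    also have "\<dots> \<le> (norm (Re a *\<^sub>R fst c) + norm (Im a *\<^sub>R snd c)) + (norm (Re a *\<^sub>R snd c) + norm (Im a *\<^sub>R fst c))"
      by (intro add_mono norm_triangle_ineq4 norm_triangle_ineq)
    also have "\<dots> \<le> (norm a * norm c + norm a * norm c) + (norm a * norm c + norm a * norm c)"
      by (intro add_mono s f abs_Re_le_cmod abs_Im_le_cmod)
    finally show ?thesis by simp
  qed
  then show "\<exists>K. \<forall>a (c :: 'x cop). norm (cs a c) \<le> norm a * norm c * K" by blast
qed

lemma cs_cs: "cs c (cs d a) = cs (c * d) a"
  by (simp add: cs_def algebra_simps)

lemma cs_one [simp]: "cs 1 a = a"
  by (simp add: cs_def)

lemma cm_cs: "cm (cs c a) b = cs c (cm a b)" "cm a (cs c b) = cs c (cm a b)"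
  by (simp_all add: cm_def cs_def blinfun_compose_simps algebra_simps)

lemma cconj_simps: "cconj (a + b) = cconj a + cconj b" "cconj (a - b) = cconj a - cconj b"
  "cconj (cm a b) = cm (cconj a) (cconj b)" "cconj (cs c a) = cs (cnj c) (cconj a)"
  "cconj cunit = cunit" "cconj (A, 0) = (A, 0)" "cconj (cconj a) = a"
  by (simp_all add: cconj_def cm_def cs_def cunit_def blinfun_compose_simps)

definition cinverse :: "'x::real_normed_vector cop \<Rightarrow> 'x cop \<Rightarrow> bool" where
  "cinverse a b \<longleftrightarrow> cm a b = cunit \<and> cm b a = cunit"

lemma cinverse_unique:
  assumes "cinverse a b" "cinverse a c"
  shows "b = c"
proof -
  have "b = cm (cm c a) b" using assms(2) by (simp add: cinverse_def)
  also have "\<dots> = c" using assms(1) by (simp add: cinverse_def cm_assoc)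
  finally show ?thesis .
qed

lemma cinverse_commute:
  assumes "cinverse a b" "cm c a = cm a c"
  shows "cm c b = cm b c"
proof -
  have "cm c b = cm (cm b a) (cm c b)" using assms(1) by (simp add: cinverse_def)
  also have "\<dots> = cm b (cm (cm c a) b)" using assms(2) by (simp add: cm_assoc)
  also have "\<dots> = cm b c" using assms(1) by (simp add: cinverse_def cm_assoc)
  finally show ?thesis .
qed

text \<open>Both one-sided inverses of the perturbed element are fixed points of contractions.\<close>

lemma cinverse_perturb:
  fixes a b a' :: "'x::banach cop"
  assumes K: "\<And>x y :: 'x cop. norm (cm x y) \<le> norm x * norm y * K" "K \<ge> 0"
    and inv: "cinverse a b" and small: "K * K * norm b * norm (a - a') < 1"
  shows "\<exists>b'. cinverse a' b'"
proof -
  let ?e = "a - a'"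
  have bound: "norm (cm x (cm y z)) \<le> K * K * norm x * norm y * norm z" for x y z :: "'x cop"
  proof -
    have "norm (cm x (cm y z)) \<le> norm x * norm (cm y z) * K" by (rule K)
    also have "\<dots> \<le> norm x * (norm y * norm z * K) * K"
      by (intro mult_right_mono mult_left_mono K) auto
    finally show ?thesis by (simp add: mult_ac)
  qed
  have nn: "0 \<le> K * K * norm b * norm ?e" using K(2) by simp
  have "\<exists>!x. b + cm b (cm ?e x) = x"
  proof (rule banach_fix_type[OF nn small])
    show "\<forall>x y. dist (b + cm b (cm ?e x)) (b + cm b (cm ?e y)) \<le> K * K * norm b * norm ?e * dist x y"
      using bound by (simp add: dist_norm flip: cm.diff_right)
  qed
  then obtain x where x: "x = b + cm b (cm ?e x)" by metis
  have "\<exists>!y. b + cm y (cm ?e b) = y"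
  proof (rule banach_fix_type[OF nn small])
    show "\<forall>x y. dist (b + cm x (cm ?e b)) (b + cm y (cm ?e b)) \<le> K * K * norm b * norm ?e * dist x y"
    proof (intro allI)
      fix x y
      have "norm (cm (x - y) (cm ?e b)) \<le> K * K * norm (x - y) * norm ?e * norm b" by (rule bound)
      then show "dist (b + cm x (cm ?e b)) (b + cm y (cm ?e b)) \<le> K * K * norm b * norm ?e * dist x y"
        by (simp add: dist_norm cm.diff_left mult_ac)
    qed
  qed
  then obtain y where y: "y = b + cm y (cm ?e b)" by metis
  have "cm a x = cunit + cm ?e x"
    using arg_cong[OF x, of "cm a"] inv by (simp add: cm.add_right cinverse_def flip: cm_assoc)
  then have x1: "cm a' x = cunit" by (simp add: cm.diff_left)
  have "cm y a = cunit + cm y ?e"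
    using arg_cong[OF y, of "\<lambda>u. cm u a"] inv by (simp add: cm.add_left cinverse_def cm_assoc)
  then have y1: "cm y a' = cunit" by (simp add: cm.diff_right)
  have "x = cm (cm y a') x" using y1 by simp
  also have "\<dots> = y" using x1 by (simp add: cm_assoc)
  finally have "x = y" .
  then show ?thesis using x1 y1 unfolding cinverse_def by blast
qed

section \<open>The quadratic polynomial \<open>Q\<close> and its resolvent\<close>

locale commuting_op =
  fixes T0 T1 T2 T3 :: "'x::banach \<Rightarrow>\<^sub>L 'x"
  assumes comm: "A \<in> {T0, T1, T2, T3} \<Longrightarrow> B \<in> {T0, T1, T2, T3} \<Longrightarrow> A o\<^sub>L B = B o\<^sub>L A"
begin

text \<open>As the components commute, this is \<open>T\<close> times its conjugate; see
  \<open>Qcs_eq\<close>.\<close>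

definition NT :: "'x \<Rightarrow>\<^sub>L 'x" where
  "NT = (T0 o\<^sub>L T0) + (T1 o\<^sub>L T1) + (T2 o\<^sub>L T2) + (T3 o\<^sub>L T3)"

definition Q :: "complex \<Rightarrow> 'x cop" where
  "Q z = cs (z\<^sup>2) cunit - cs z (2 *\<^sub>R T0, 0) + (NT, 0)"

definition spec :: "complex set" where
  "spec = {z. \<not> (\<exists>b. cinverse (Q z) b)}"

definition Qi :: "complex \<Rightarrow> 'x cop" where
  "Qi z = (SOME b. cinverse (Q z) b)"

lemma Qi: "z \<notin> spec \<Longrightarrow> cinverse (Q z) (Qi z)"
  unfolding spec_def Qi_def by (auto intro: someI_ex)

lemma Qi_eqI: "cinverse (Q z) b \<Longrightarrow> Qi z = b"
  using Qi cinverse_unique unfolding spec_def by blast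

lemma Q_cnj: "Q (cnj z) = cconj (Q z)"
  by (simp add: Q_def cconj_simps)

lemma cinverse_cnj: "cinverse (Q z) b \<Longrightarrow> cinverse (Q (cnj z)) (cconj b)"
  unfolding cinverse_def Q_cnj by (simp flip: cconj_simps(3) add: cconj_simps(5))

lemma spec_cnj: "z \<in> spec \<Longrightarrow> cnj z \<in> spec"
  unfolding spec_def mem_Collect_eq by (metis complex_cnj_cnj cinverse_cnj)

lemma Qi_cnj: "z \<notin> spec \<Longrightarrow> Qi (cnj z) = cconj (Qi z)"
  by (intro Qi_eqI cinverse_cnj Qi)

text \<open>The divided difference of \<open>Q\<close> at \<open>w\<close> and \<open>z\<close> is
  \<open>Lin (w + z)\<close>; it depends on the sum alone because \<open>Q\<close> is
  quadratic.\<close>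

definition Lin :: "complex \<Rightarrow> 'x cop" where
  "Lin s = cs s cunit - (2 *\<^sub>R T0, 0)"

lemma Q_diff: "Q w - Q z = cs (w - z) (Lin (w + z))"
proof -
  have "w\<^sup>2 - z\<^sup>2 = (w - z) * (w + z)" by (simp add: power2_eq_square algebra_simps)
  then have "cs (w\<^sup>2) cunit - cs (z\<^sup>2) cunit = cs ((w - z) * (w + z)) (cunit :: 'x cop)"
    by (simp flip: cs.diff_left)
  then show ?thesis
    by (simp add: Q_def Lin_def cs.diff_right cs_cs cs.diff_left algebra_simps)
qed

lemma continuous_Lin [continuous_intros]: "continuous_on S f \<Longrightarrow> continuous_on S (\<lambda>x. Lin (f x))"
  unfolding Lin_def by (intro continuous_intros cs.continuous_on)

lemma continuous_Q: "continuous_on S Q"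
  unfolding Q_def by (intro continuous_intros cs.continuous_on)

lemma open_resolvent_set: "open (- spec)"
proof -
  obtain K where K: "K > 0" "\<And>x y :: 'x cop. norm (cm x y) \<le> norm x * norm y * K"
    using cm.pos_bounded by blast
  have "\<exists>e>0. ball z e \<subseteq> - spec" if z: "z \<notin> spec" for z
  proof -
    have "((\<lambda>w. K * K * norm (Qi z) * norm (Q z - Q w)) \<longlongrightarrow> K * K * norm (Qi z) * norm (Q z - Q z)) (at z)"
      using continuous_Q[of UNIV] by (intro tendsto_intros) (simp add: continuous_on_def)
    then have "\<forall>\<^sub>F w in at z. K * K * norm (Qi z) * norm (Q z - Q w) < 1"
      by (intro order_tendstoD(2)) auto
    then obtain e where e: "e > 0" "\<And>w. w \<noteq> z \<Longrightarrow> dist w z < e \<Longrightarrow> K * K * norm (Qi z) * norm (Q z - Q w) < 1"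
      by (auto simp: eventually_at)
    have "w \<notin> spec" if "dist w z < e" for w
    proof (cases "w = z")
      case False
      then show ?thesis using cinverse_perturb[OF K(2) _ Qi[OF z] e(2)[OF False that]] K(1)
        by (auto simp: spec_def)
    qed (use z in simp)
    then show ?thesis using e(1) by (auto simp: dist_commute intro!: exI[of _ e])
  qed
  then show ?thesis unfolding open_contains_ball by auto
qed

text \<open>For large \<open>z\<close> the element \<open>Q z\<close> is a small perturbation of
  \<open>z\<^sup>2\<close> times the unit: the error grows linearly, while the inverse of the main
  term decays quadratically.\<close>

lemma bounded_spec: "bounded spec"
proof -
  obtain K where K: "K > 0" "\<And>x y :: 'x cop. norm (cm x y) \<le> norm x * norm y * K"
    using cm.pos_bounded by blast
  obtain C where C: "C > 0" "\<And>x (y :: 'x cop). norm (cs x y) \<le> norm x * norm y * C"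
    using cs.pos_bounded by blast
  define a where "a = norm (cunit :: 'x cop) * C"
  define b where "b = norm ((2 *\<^sub>R T0, 0) :: 'x cop) * C"
  define c where "c = norm ((NT, 0) :: 'x cop)"
  have "((\<lambda>r::real. K * K * (1 / r ^ 2 * a) * (r * b + c)) \<longlongrightarrow> 0) at_top"
    by real_asymp
  then have "\<forall>\<^sub>F r::real in at_top. K * K * (1 / r ^ 2 * a) * (r * b + c) < 1"
    by (rule order_tendstoD) simp
  then obtain R where R: "\<And>r::real. r \<ge> R \<Longrightarrow> K * K * (1 / r ^ 2 * a) * (r * b + c) < 1"
    by (auto simp: eventually_at_top_linorder)
  have "norm z \<le> max R 1" if "z \<in> spec" for z
  proof (rule ccontr)
    assume "\<not> norm z \<le> max R 1"
    then have n: "norm z \<ge> R" "norm z > 0" "z \<noteq> 0" by auto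
    let ?A = "cs (z\<^sup>2) cunit :: 'x cop" and ?B = "cs (1 / z\<^sup>2) cunit :: 'x cop"
    have "cinverse ?A ?B" using n by (simp add: cinverse_def cm_cs cs_cs)
    moreover have "K * K * norm ?B * norm (?A - Q z) < 1"
    proof -
      have "norm ?B \<le> 1 / norm z ^ 2 * a"
        using C(2)[of "1 / z\<^sup>2" cunit] by (simp add: a_def norm_divide norm_power mult_ac)
      moreover have "norm (?A - Q z) \<le> norm z * b + c"
      proof -
        have "?A - Q z = cs z (2 *\<^sub>R T0, 0) - (NT, 0)" by (simp add: Q_def)
        also have "norm \<dots> \<le> norm (cs z (2 *\<^sub>R T0, 0)) + c" unfolding c_def by (rule norm_triangle_ineq4)
        also have "norm (cs z (2 *\<^sub>R T0, 0)) \<le> norm z * b"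
          using C(2)[of z "(2 *\<^sub>R T0, 0)"] by (simp add: b_def mult_ac)
        finally show ?thesis by simp
      qed
      ultimately have "K * K * norm ?B * norm (?A - Q z) \<le> K * K * (1 / norm z ^ 2 * a) * (norm z * b + c)"
        using K(1) C(1) by (intro mult_mono) (auto simp: a_def)
      then show ?thesis using R[OF n(1)] by simp
    qed
    ultimately have "\<exists>b'. cinverse (Q z) b'" using K by (intro cinverse_perturb[OF K(2)]) auto
    then show False using that by (simp add: spec_def)
  qed
  then show ?thesis by (auto simp: bounded_iff)
qed

lemma compact_spec: "compact spec"
  using bounded_spec open_resolvent_set by (simp add: compact_eq_bounded_closed closed_def)

text \<open>The analogue of the resolvent identity: \<open>Q w - Q z\<close> is placed between the
  two inverses. For a quadratic \<open>Q\<close> it leaves the linear factor \<open>Lin\<close> in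
  the middle.\<close>

lemma Qi_diff:
  assumes "z \<notin> spec" "w \<notin> spec"
  shows "Qi z - Qi w = cs (w - z) (cm (Qi z) (cm (Lin (w + z)) (Qi w)))"
proof -
  have "cm (Qi z) (cm (Q w - Q z) (Qi w)) = cm (Qi z) (cm (Q w) (Qi w)) - cm (cm (Qi z) (Q z)) (Qi w)"
    by (simp add: cm.diff_left cm.diff_right cm_assoc)
  also have "\<dots> = Qi z - Qi w" using Qi[OF assms(1)] Qi[OF assms(2)] by (simp add: cinverse_def)
  finally show ?thesis by (simp add: Q_diff cm_cs)
qed

lemma Qi_commute:
  assumes "z \<notin> spec" "A o\<^sub>L T0 = T0 o\<^sub>L A" "A o\<^sub>L NT = NT o\<^sub>L A"
  shows "cm (A, 0) (Qi z) = cm (Qi z) (A, 0)"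
  by (rule cinverse_commute[OF Qi[OF assms(1)]])
     (simp add: Q_def cm.diff_left cm.diff_right cm.add_left cm.add_right cm_cs,
      simp add: cm_def assms blinfun_compose_simps)

text \<open>The resolvent identity bounds the increment by \<open>norm (Qi w) * m w\<close> with
  \<open>m\<close> tending to 0. As soon as \<open>m w < 1/2\<close>, the norm of
  \<open>Qi w\<close> is at most twice that of \<open>Qi z\<close>, which gives a bound free of
  \<open>Qi w\<close>.\<close>

lemma isCont_Qi:
  assumes z: "z \<notin> spec"
  shows "isCont Qi z"
proof -
  obtain K where K: "K > 0" "\<And>x y :: 'x cop. norm (cm x y) \<le> norm x * norm y * K"
    using cm.pos_bounded by blast
  define q where "q = norm (Qi z)"
  define m where "m w = norm (Q z - Q w) * q * K * K" for w
  have key: "norm (Qi w - Qi z) \<le> norm (Qi w) * m w" if "w \<notin> spec" for w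
  proof -
    have "Qi w - Qi z = cm (Qi w) (cm (Q z - Q w) (Qi z))"
      using Qi_diff[OF that z] by (simp add: Q_diff cm_cs)
    also have "norm \<dots> \<le> norm (Qi w) * norm (cm (Q z - Q w) (Qi z)) * K" by (rule K)
    also have "\<dots> \<le> norm (Qi w) * (norm (Q z - Q w) * norm (Qi z) * K) * K"
      using K by (intro mult_right_mono mult_left_mono K) auto
    finally show ?thesis by (simp add: m_def q_def mult_ac)
  qed
  have m: "(m \<longlongrightarrow> 0) (at z)"
  proof -
    have "(m \<longlongrightarrow> norm (Q z - Q z) * q * K * K) (at z)" unfolding m_def
      using continuous_Q[of UNIV] by (intro tendsto_intros) (simp add: continuous_on_def)
    then show ?thesis by simp
  qed
  have "\<forall>\<^sub>F w in at z. norm (Qi w - Qi z) \<le> 2 * q * m w"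
  proof -
    have "\<forall>\<^sub>F w in at z. w \<in> - spec"
      using open_resolvent_set z by (intro eventually_at_in_open') auto
    moreover have "\<forall>\<^sub>F w in at z. m w < 1/2" using m by (rule order_tendstoD) simp
    ultimately show ?thesis
    proof eventually_elim
      case (elim w)
      have m0: "m w \<ge> 0" using K(1) by (simp add: m_def q_def)
      have "norm (Qi w) \<le> q + norm (Qi w - Qi z)" unfolding q_def using norm_triangle_sub[of "Qi w" "Qi z"] by simp
      also have "\<dots> \<le> q + norm (Qi w) * m w" using key[of w] elim by simp
      also have "\<dots> \<le> q + norm (Qi w) * (1/2)" using elim by (intro add_left_mono mult_left_mono) auto
      finally have "norm (Qi w) \<le> 2 * q" by simp
      then show ?case using key[of w] elim mult_right_mono[OF _ m0, of "norm (Qi w)" "2 * q"] by simp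
    qed
  qed
  moreover have "((\<lambda>w. 2 * q * m w) \<longlongrightarrow> 0) (at z)" using tendsto_mult_left[OF m, of "2 * q"] by simp
  ultimately have "((\<lambda>w. Qi w - Qi z) \<longlongrightarrow> 0) (at z)" by (rule Lim_null_comparison)
  then show ?thesis by (simp add: isCont_def LIM_zero_iff)
qed

lemma continuous_on_Qi: "S \<inter> spec = {} \<Longrightarrow> continuous_on S Qi"
  by (intro continuous_at_imp_continuous_on) (auto intro: isCont_Qi)

end

text \<open>The derivative is required to be continuous because
  \<open>vhol_on_ball_primitive\<close> differentiates under the integral sign.\<close>

definition vhol_on :: "(complex \<Rightarrow> 'x::banach cop) \<Rightarrow> complex set \<Rightarrow> bool" where
  "vhol_on F S \<longleftrightarrow> (\<exists>F'. continuous_on S F' \<and> (\<forall>z\<in>S. (F has_derivative (\<lambda>h. cs h (F' z))) (at z)))"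

text \<open>By \<open>Qi_diff\<close> the difference quotient at \<open>w\<close> is
  \<open>- R w\<close>, so the error of the linear approximation is governed by the continuity of
  \<open>R\<close> at \<open>z\<close>.\<close>

lemma (in commuting_op) vhol_on_Qi: "vhol_on Qi (- spec)"
  unfolding vhol_on_def
proof (intro exI conjI ballI)
  let ?D = "\<lambda>z. - cm (Qi z) (cm (Lin (z + z)) (Qi z))"
  show "continuous_on (- spec) ?D"
    by (intro continuous_intros cm.continuous_on continuous_on_Qi) auto
  fix z assume "z \<in> - spec"
  then have z: "z \<notin> spec" by simp
  obtain C where C: "C > 0" "\<And>x (y :: 'x cop). norm (cs x y) \<le> norm x * norm y * C"
    using cs.pos_bounded by blast
  define R where "R w = cm (Qi w) (cm (Lin (z + w)) (Qi z))" for w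
  have "(R \<longlongrightarrow> R z) (at z)"
  proof -
    have "isCont R z" unfolding R_def
      using isCont_Qi[OF z] continuous_Lin[of UNIV "\<lambda>w. z + w"]
      by (intro cm.isCont continuous_const) (auto simp: continuous_on_eq_continuous_at intro!: continuous_intros)
    then show ?thesis by (simp add: isCont_def)
  qed
  then have lim: "((\<lambda>w. C * norm (R z - R w)) \<longlongrightarrow> C * norm (R z - R z)) (at z)"
    by (intro tendsto_intros)
  show "(Qi has_derivative (\<lambda>h. cs h (?D z))) (at z)"
  proof (rule has_derivativeI)
    show "bounded_linear (\<lambda>h. cs h (?D z))" by (rule cs.bounded_linear_left)
    have "\<forall>\<^sub>F w in at z. norm ((Qi w - Qi z - cs (w - z) (?D z)) /\<^sub>R norm (w - z)) \<le> C * norm (R z - R w)"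
    proof -
      have "\<forall>\<^sub>F w in at z. w \<in> - spec"
        using open_resolvent_set z by (intro eventually_at_in_open') auto
      moreover have "\<forall>\<^sub>F w in at z. w \<noteq> z" by (simp add: eventually_at_filter)
      ultimately show ?thesis
      proof eventually_elim
        case (elim w)
        have "Qi w - Qi z = cs (z - w) (R w)" unfolding R_def using Qi_diff[of w z] elim z by simp
        then have "Qi w - Qi z - cs (w - z) (?D z) = cs (w - z) (R z - R w)"
          by (simp add: R_def cs_def algebra_simps)
        also have "norm \<dots> \<le> norm (w - z) * norm (R z - R w) * C" by (rule C)
        finally show ?case using elim(2) by (simp add: divide_simps mult_ac)
      qed
    qed
    from Lim_null_comparison[OF this] lim
    show "((\<lambda>w. (Qi w - Qi z - cs (w - z) (?D z)) /\<^sub>R norm (w - z)) \<longlongrightarrow> 0) (at z)" by simp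
  qed
qed

section \<open>Path integrals of operator-valued holomorphic functions\<close>

definition clinear_fun :: "('x::real_normed_vector cop \<Rightarrow> complex) \<Rightarrow> bool" where
  "clinear_fun L \<longleftrightarrow> bounded_linear L \<and> (\<forall>c a. L (cs c a) = c * L a)"

lemma clinear_funD: "clinear_fun L \<Longrightarrow> bounded_linear L" "clinear_fun L \<Longrightarrow> L (cs c a) = c * L a"
  unfolding clinear_fun_def by blast+

lemma clinear_fun_cm_left: "clinear_fun L \<Longrightarrow> clinear_fun (\<lambda>a. L (cm b a))"
  and clinear_fun_cm_right: "clinear_fun L \<Longrightarrow> clinear_fun (\<lambda>a. L (cm a b))"
  unfolding clinear_fun_def cm_cs
  by (blast intro: bounded_linear_compose[OF _ cm.bounded_linear_right]
    bounded_linear_compose[OF _ cm.bounded_linear_left])+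

text \<open>Turns the real functionals of Hahn-Banach into complex linear ones; the real and
  imaginary parts of the value recover \<open>\<phi>\<close> on the two components.\<close>

definition complexify :: "(('x::real_normed_vector \<Rightarrow>\<^sub>L 'x) \<Rightarrow> real) \<Rightarrow> 'x cop \<Rightarrow> complex" where
  "complexify \<phi> a = Complex (\<phi> (fst a)) (\<phi> (snd a))"

lemma clinear_fun_complexify:
  assumes "bounded_linear \<phi>"
  shows "clinear_fun (complexify \<phi>)"
proof -
  have "bounded_linear (\<lambda>a. complex_of_real (\<phi> (fst a)) + \<i> * complex_of_real (\<phi> (snd a)))"
    by (intro bounded_linear_add bounded_linear_const_mult
      bounded_linear_compose[OF bounded_linear_of_real] bounded_linear_compose[OF assms]
      bounded_linear_fst bounded_linear_snd)
  moreover have "complexify \<phi> = (\<lambda>a. complex_of_real (\<phi> (fst a)) + \<i> * complex_of_real (\<phi> (snd a)))"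
    by (auto simp: complexify_def Complex_eq)
  moreover interpret bounded_linear \<phi> by (rule assms)
  have "complexify \<phi> (cs c a) = c * complexify \<phi> a" for c a
    by (simp add: complexify_def cs_def complex_eq_iff add diff scale)
  ultimately show ?thesis unfolding clinear_fun_def by metis
qed

lemma clinear_funs_separate:
  fixes a b :: "'x::real_normed_vector cop"
  assumes "\<And>L. clinear_fun L \<Longrightarrow> L a = L b"
  shows "a = b"
proof (rule prod_eqI)
  show "fst a = fst b"
  proof (rule bounded_linear_separates)
    fix \<phi> :: "('x \<Rightarrow>\<^sub>L 'x) \<Rightarrow> real" assume "bounded_linear \<phi>"
    from assms[OF clinear_fun_complexify[OF this]] show "\<phi> (fst a) = \<phi> (fst b)" by (simp add: complexify_def)
  qed
  show "snd a = snd b"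
  proof (rule bounded_linear_separates)
    fix \<phi> :: "('x \<Rightarrow>\<^sub>L 'x) \<Rightarrow> real" assume "bounded_linear \<phi>"
    from assms[OF clinear_fun_complexify[OF this]] show "\<phi> (snd a) = \<phi> (snd b)" by (simp add: complexify_def)
  qed
qed

lemma vhol_on_subset: "vhol_on F S \<Longrightarrow> T \<subseteq> S \<Longrightarrow> vhol_on F T"
  unfolding vhol_on_def by (meson continuous_on_subset subsetD)

lemma vhol_on_imp_continuous_on: "vhol_on F S \<Longrightarrow> continuous_on S F"
  unfolding vhol_on_def by (meson continuous_at_imp_continuous_on has_derivative_continuous)

lemma vhol_on_cs:
  assumes "open S" "c holomorphic_on S" "vhol_on F S"
  shows "vhol_on (\<lambda>z. cs (c z) (F z)) S"
proof -
  obtain F' where F': "continuous_on S F'" "\<And>z. z \<in> S \<Longrightarrow> (F has_derivative (\<lambda>h. cs h (F' z))) (at z)"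
    using assms(3) unfolding vhol_on_def by blast
  let ?D = "\<lambda>z. cs (c z) (F' z) + cs (deriv c z) (F z)"
  have "continuous_on S ?D"
    using assms F'(1) vhol_on_imp_continuous_on[OF assms(3)]
    by (intro continuous_on_add cs.continuous_on holomorphic_on_imp_continuous_on holomorphic_deriv)
  moreover have "((\<lambda>z. cs (c z) (F z)) has_derivative (\<lambda>h. cs h (?D z))) (at z)" if z: "z \<in> S" for z
  proof -
    have "(c has_derivative (\<lambda>h. deriv c z * h)) (at z)"
      using holomorphic_derivI[OF assms(2,1) z] by (simp add: has_field_derivative_def)
    from cs.FDERIV[OF this F'(2)[OF z]]
    show ?thesis by (rule has_derivative_eq_rhs) (simp add: fun_eq_iff cs.add_right cs_cs mult.commute)
  qed
  ultimately show ?thesis unfolding vhol_on_def by blast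
qed

lemma vhol_on_holomorphic:
  assumes "vhol_on F S" "clinear_fun L"
  shows "(\<lambda>z. L (F z)) holomorphic_on S"
  unfolding holomorphic_on_def field_differentiable_def
proof
  obtain F' where F': "\<And>z. z \<in> S \<Longrightarrow> (F has_derivative (\<lambda>h. cs h (F' z))) (at z)"
    using assms(1) unfolding vhol_on_def by blast
  fix z assume z: "z \<in> S"
  have "((\<lambda>z. L (F z)) has_derivative (\<lambda>h. L (cs h (F' z)))) (at z within S)"
    using bounded_linear.has_derivative[OF clinear_funD(1)[OF assms(2)] has_derivative_at_withinI[OF F'[OF z]]] .
  then show "\<exists>D. ((\<lambda>z. L (F z)) has_field_derivative D) (at z within S)"
    unfolding has_field_derivative_def clinear_funD(2)[OF assms(2)] mult.commute[of _ "L (F' z)"] by blast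
qed

text \<open>Complex multiplication of \<open>a\<close> as an element of the space of bounded linear
  maps, the form in which \<open>leibniz_rule\<close> takes derivatives.\<close>

definition csB :: "'x::real_normed_vector cop \<Rightarrow> complex \<Rightarrow>\<^sub>L 'x cop" where
  "csB a = Blinfun (\<lambda>h. cs h a)"

lemma csB_apply [simp]: "blinfun_apply (csB a) h = cs h a"
  unfolding csB_def by (simp add: bounded_linear_Blinfun_apply cs.bounded_linear_left)

lemma bounded_linear_csB: "bounded_linear (csB :: 'x::real_normed_vector cop \<Rightarrow> _)"
proof -
  obtain C where C: "C > 0" "\<And>x (y :: 'x cop). norm (cs x y) \<le> norm x * norm y * C"
    using cs.pos_bounded by blast
  show ?thesis
  proof (rule bounded_linear_intro[where K = C])
    show "norm (csB a) \<le> norm a * C" for a :: "'x cop"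
      by (rule norm_blinfun_bound) (use C in \<open>simp_all add: mult_ac\<close>)
    show "csB (a + b) = csB a + csB b" for a b :: "'x cop"
      by (rule blinfun_eqI) (simp only: csB_apply cs.add_right blinfun.add_left)
    show "csB (r *\<^sub>R a) = r *\<^sub>R csB a" for r and a :: "'x cop"
      by (rule blinfun_eqI) (simp only: csB_apply cs.scaleR_right blinfun.scaleR_left)
  qed
qed

text \<open>Local primitives exist for operator-valued holomorphic functions: integrate along radii.\<close>

lemma vhol_on_ball_primitive:
  fixes F :: "complex \<Rightarrow> 'x::banach cop"
  assumes "vhol_on F (ball a r)"
  obtains G where "\<And>z. z \<in> ball a r \<Longrightarrow> (G has_derivative (\<lambda>h. cs h (F z))) (at z)"
proof -
  let ?U = "ball a r"
  obtain F' where F': "continuous_on ?U F'" "\<And>z. z \<in> ?U \<Longrightarrow> (F has_derivative (\<lambda>h. cs h (F' z))) (at z)"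
    using assms unfolding vhol_on_def by blast
  have cF: "continuous_on ?U F" by (rule vhol_on_imp_continuous_on[OF assms])
  define p where "p z t = a + of_real t * (z - a)" for z and t :: real
  \<comment> \<open>\<open>V z t\<close> has two roles: multiplication by it is the derivative of
    \<open>f z t\<close> in \<open>z\<close>, and it is the derivative of
    \<open>t *\<^sub>R F (p z t)\<close> in \<open>t\<close>. The second role makes its integral
    equal to \<open>F z\<close>.\<close>
  define V where "V z t = F (p z t) + cs (of_real t * (z - a)) (F' (p z t))" for z and t :: real
  define f where "f z t = cs (z - a) (F (p z t))" for z and t :: real
  define G where "G z = integral (cbox 0 1) (f z)" for z
  have pU: "p z t \<in> ?U" if "z \<in> ?U" "t \<in> cbox 0 1" for z and t :: real
  proof -
    have "norm (of_real t * (z - a)) \<le> 1 * norm (z - a)"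
      unfolding norm_mult using that by (intro mult_right_mono) auto
    then show ?thesis using that by (simp add: p_def dist_norm norm_minus_commute)
  qed
  have pder: "((\<lambda>z. p z t) has_derivative (\<lambda>h. of_real t * h)) (at z within S)" for z t S
    unfolding p_def by (auto intro!: derivative_eq_intros)
  have fder: "((\<lambda>z. f z t) has_derivative blinfun_apply (csB (V z t))) (at z within ?U)"
    if z: "z \<in> ?U" and t: "t \<in> cbox 0 1" for z t
  proof -
    have "((\<lambda>z. F (p z t)) has_derivative (\<lambda>h. cs (of_real t * h) (F' (p z t)))) (at z within ?U)"
      by (rule has_derivative_compose[OF pder F'(2)[OF pU[OF z t]]])
    moreover have "((\<lambda>z. z - a) has_derivative (\<lambda>h. h)) (at z within ?U)"
      by (auto intro!: derivative_eq_intros)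
    ultimately have "((\<lambda>z. cs (z - a) (F (p z t))) has_derivative
        (\<lambda>h. cs (z - a) (cs (of_real t * h) (F' (p z t))) + cs h (F (p z t)))) (at z within ?U)"
      by (intro cs.FDERIV)
    then show ?thesis unfolding f_def
      by (rule has_derivative_eq_rhs) (simp add: fun_eq_iff V_def cs.add_right cs_cs mult_ac)
  qed
  have cp: "continuous_on (?U \<times> cbox 0 1) (\<lambda>x. p (fst x) (snd x))"
    unfolding p_def by (intro continuous_intros)
  have cFp: "continuous_on (?U \<times> cbox 0 1) (\<lambda>x. F (p (fst x) (snd x)))"
    "continuous_on (?U \<times> cbox 0 1) (\<lambda>x. F' (p (fst x) (snd x)))"
    by (rule continuous_on_compose2[OF cF cp] continuous_on_compose2[OF F'(1) cp]; use pU in fastforce)+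
  have cV: "continuous_on (?U \<times> cbox 0 1) (\<lambda>x. V (fst x) (snd x))"
    unfolding V_def by (intro continuous_intros cs.continuous_on cFp)
  have intf: "f z integrable_on cbox 0 1" if z: "z \<in> ?U" for z
  proof (rule integrable_continuous)
    have "continuous_on (cbox 0 1) (\<lambda>t. F (p z t))"
    proof (rule continuous_on_compose2[OF cF])
      show "continuous_on (cbox 0 1) (p z)" unfolding p_def by (intro continuous_intros)
      show "p z ` cbox 0 1 \<subseteq> ?U" using pU[OF z] by blast
    qed
    then show "continuous_on (cbox 0 1) (f z)" unfolding f_def by (intro cs.continuous_on continuous_intros)
  qed
  have intV: "(V z has_integral F z) (cbox 0 1)" if z: "z \<in> ?U" for z
  proof -
    have "((\<lambda>t. t *\<^sub>R F (p z t)) has_vector_derivative V z t) (at t within {0..1})" if t: "t \<in> {0..1}" for t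
    proof -
      have "((\<lambda>t. p z t) has_derivative (\<lambda>h. of_real h * (z - a))) (at t within {0..1})"
        unfolding p_def by (auto intro!: derivative_eq_intros)
      from has_derivative_compose[OF this F'(2)[OF pU[OF z]]] t
      have "((\<lambda>t. F (p z t)) has_derivative (\<lambda>h. cs (of_real h * (z - a)) (F' (p z t)))) (at t within {0..1})" by simp
      moreover have "((\<lambda>t. t) has_derivative (\<lambda>h. h)) (at t within {0..1})" by (rule has_derivative_ident)
      ultimately have "((\<lambda>t. t *\<^sub>R F (p z t)) has_derivative
          (\<lambda>h. t *\<^sub>R cs (of_real h * (z - a)) (F' (p z t)) + h *\<^sub>R F (p z t))) (at t within {0..1})"
        by (intro has_derivative_scaleR)
      then show ?thesis unfolding has_vector_derivative_def
        by (rule has_derivative_eq_rhs) (simp add: fun_eq_iff V_def scaleR_add_right mult_ac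
          flip: scaleR_conv_of_real cs.scaleR_left)
    qed
    then have "(V z has_integral 1 *\<^sub>R F (p z 1) - 0 *\<^sub>R F (p z 0)) {0..1}"
      by (intro fundamental_theorem_of_calculus) auto
    then show ?thesis by (simp add: p_def)
  qed
  show thesis
  proof
    fix z assume z: "z \<in> ?U"
    have "continuous_on (?U \<times> cbox 0 1) (\<lambda>(z, t). csB (V z t))"
      unfolding split_beta by (rule bounded_linear.continuous_on[OF bounded_linear_csB cV])
    from leibniz_rule[OF fder intf this z convex_ball]
    have "(G has_derivative blinfun_apply (integral (cbox 0 1) (\<lambda>t. csB (V z t)))) (at z within ?U)"
      unfolding G_def .
    moreover have "integral (cbox 0 1) (\<lambda>t. csB (V z t)) = csB (F z)"
      using has_integral_linear[OF intV[OF z] bounded_linear_csB] by (simp add: o_def integral_unique)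
    moreover have "blinfun_apply (csB (F z)) = (\<lambda>h. cs h (F z))" by (simp add: fun_eq_iff)
    ultimately show "(G has_derivative (\<lambda>h. cs h (F z))) (at z)"
      unfolding at_within_open[OF z open_ball] by (simp only:)
  qed
qed

definition vpath_int :: "(real \<Rightarrow> complex) \<Rightarrow> (complex \<Rightarrow> 'x::banach cop) \<Rightarrow> 'x cop" where
  "vpath_int g F = integral {0..1} (\<lambda>t. cs (vector_derivative g (at t within {0..1})) (F (g t)))"

text \<open>A valid path need not be rectifiable, so integrability rests on local primitives.\<close>

lemma vhol_on_path_integrable:
  fixes F :: "complex \<Rightarrow> 'x::banach cop"
  assumes "open S" "vhol_on F S" "valid_path g" "path_image g \<subseteq> S"
  shows "(\<lambda>t. cs (vector_derivative g (at t within {0..1})) (F (g t))) integrable_on {0..1}"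
proof -
  obtain N where N: "finite N" "g C1_differentiable_on {0..1} - N" and cg: "continuous_on {0..1} g"
    using assms(3) unfolding valid_path_def piecewise_C1_differentiable_on_def by blast
  have "(\<lambda>t. cs (vector_derivative g (at t within {0..1})) (F (g t))) integrable_on cbox 0 1"
  proof (rule integrable_on_little_subintervals, intro ballI)
    fix x :: real assume x: "x \<in> cbox 0 1"
    then have "g x \<in> S" using assms(4) by (auto simp: path_image_def)
    then obtain r where r: "r > 0" "ball (g x) r \<subseteq> S" using assms(1) openE by blast
    \<comment> \<open>On a short interval around \<open>x\<close> the integrand is the derivative of
      \<open>G \<circ> g\<close> off the finite set \<open>N\<close>. The fundamental theorem for
      the gauge integral then gives integrability with no bound on the derivative of
      \<open>g\<close>.\<close>
    obtain G where G: "\<And>z. z \<in> ball (g x) r \<Longrightarrow> (G has_derivative (\<lambda>h. cs h (F z))) (at z)"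
      using vhol_on_ball_primitive[OF vhol_on_subset[OF assms(2) r(2)]] by blast
    obtain d where d: "d > 0" "\<And>y. y \<in> {0..1} \<Longrightarrow> dist y x < d \<Longrightarrow> dist (g y) (g x) < r"
      using cg x r(1) unfolding continuous_on_iff by (metis cbox_interval)
    have "(\<lambda>t. cs (vector_derivative g (at t within {0..1})) (F (g t))) integrable_on cbox u v"
      if uv: "x \<in> cbox u v" "cbox u v \<subseteq> ball x d" "cbox u v \<subseteq> cbox 0 1" for u v
    proof -
      have le: "u \<le> v" and u0: "0 \<le> u" and v1: "v \<le> 1" using uv(1,3) by auto
      have inb: "g y \<in> ball (g x) r" if "y \<in> {u..v}" for y
        using d(2)[of y] that uv(2,3) by (auto simp: dist_commute subset_iff)
      have "((\<lambda>t. cs (vector_derivative g (at t within {0..1})) (F (g t))) has_integral (G \<circ> g) v - (G \<circ> g) u) {u..v}"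
      proof (rule fundamental_theorem_of_calculus_interior_strong[OF N(1) le])
        have "continuous_on (ball (g x) r) G"
          using G by (meson continuous_at_imp_continuous_on has_derivative_continuous)
        moreover have "continuous_on {u..v} g" using cg u0 v1 by (auto intro: continuous_on_subset)
        moreover have "g ` {u..v} \<subseteq> ball (g x) r" using inb by blast
        ultimately show "continuous_on {u..v} (G \<circ> g)"
          by (meson continuous_on_compose continuous_on_subset)
        fix y assume y: "y \<in> {u<..<v} - N"
        then have "y \<in> {0..1} - N" using u0 v1 by auto
        then obtain D where D: "(g has_vector_derivative D) (at y)"
          using N(2) unfolding C1_differentiable_on_def by blast
        then have "vector_derivative g (at y within {0..1}) = D"
          using y u0 v1 by (intro vector_derivative_at_within_ivl) auto
        moreover have "((G \<circ> g) has_vector_derivative cs D (F (g y))) (at y)"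
        proof -
          have "(G has_derivative (\<lambda>h. cs h (F (g y)))) (at (g y))" using y by (intro G inb) auto
          from has_derivative_compose[OF D[unfolded has_vector_derivative_def] this]
          show ?thesis by (simp add: has_vector_derivative_def o_def cs.scaleR_left)
        qed
        ultimately show "((G \<circ> g) has_vector_derivative cs (vector_derivative g (at y within {0..1})) (F (g y))) (at y)"
          by simp
      qed
      then show ?thesis by (auto simp: integrable_on_def)
    qed
    then show "\<exists>d>0. \<forall>u v. x \<in> cbox u v \<and> cbox u v \<subseteq> ball x d \<and> cbox u v \<subseteq> cbox 0 1 \<longrightarrow>
      (\<lambda>t. cs (vector_derivative g (at t within {0..1})) (F (g t))) integrable_on cbox u v"
      using d(1) by blast
  qed
  then show ?thesis by simp
qed

lemma clinear_fun_vpath_int: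
  assumes "open S" "vhol_on F S" "valid_path g" "path_image g \<subseteq> S" "clinear_fun L"
  shows "L (vpath_int g F) = contour_integral g (\<lambda>z. L (F z))"
proof -
  have "((\<lambda>t. cs (vector_derivative g (at t within {0..1})) (F (g t))) has_integral vpath_int g F) {0..1}"
    unfolding vpath_int_def by (intro integrable_integral vhol_on_path_integrable[OF assms(1-4)])
  from has_integral_linear[OF this clinear_funD(1)[OF assms(5)]]
  have "((\<lambda>z. L (F z)) has_contour_integral L (vpath_int g F)) g"
    by (simp add: has_contour_integral_def o_def clinear_funD(2)[OF assms(5)] mult.commute)
  then show ?thesis by (simp add: contour_integral_unique)
qed

definition vcycle_int :: "(real \<Rightarrow> complex) list \<Rightarrow> (complex \<Rightarrow> 'x::banach cop) \<Rightarrow> 'x cop" where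
  "vcycle_int gs F = (\<Sum>g\<leftarrow>gs. vpath_int g F)"

lemma clinear_fun_vcycle_int:
  assumes "open S" "vhol_on F S" "cycle_in S gs" "clinear_fun L"
  shows "L (vcycle_int gs F) = cycle_int gs (\<lambda>z. L (F z))"
proof -
  interpret bounded_linear L using assms(4) by (rule clinear_funD)
  show ?thesis using assms(3)
    by (induction gs) (simp_all add: vcycle_int_def zero add clinear_fun_vpath_int[OF assms(1,2) _ _ assms(4)])
qed

text \<open>Reflection in the real axis flips the orientation, and reversal restores it. A cycle
  around a symmetric domain therefore stays homologous to its conjugate.\<close>

abbreviation conj_cycle :: "(real \<Rightarrow> complex) list \<Rightarrow> (real \<Rightarrow> complex) list" where
  "conj_cycle gs \<equiv> map (\<lambda>g. reversepath (cnj \<circ> g)) gs"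

lemma path_image_cnj: "path_image (cnj \<circ> g) = cnj ` path_image g"
  by (auto simp: path_image_def)

lemma cycle_in_conj:
  assumes "cycle_in S gs" "\<And>z. z \<in> S \<Longrightarrow> cnj z \<in> S"
  shows "cycle_in S (conj_cycle gs)"
  using assms(1)
  by (induction gs)
     (auto simp: valid_path_imp_reverse valid_path_cnj path_image_cnj assms(2) subset_iff pathfinish_compose pathstart_compose)

lemma cycle_int_conj:
  assumes "cycle_in S gs" "open S" "\<And>z. z \<in> S \<Longrightarrow> cnj z \<in> S" "f holomorphic_on S"
  shows "cycle_int (conj_cycle gs) f = - cnj (cycle_int gs (\<lambda>z. cnj (f (cnj z))))"
  using assms(1)
proof (induction gs)
  case (Cons g gs)
  then have g: "valid_path g" "path_image (cnj \<circ> g) \<subseteq> S" using assms(3) by (auto simp: path_image_cnj)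
  then have "contour_integral (reversepath (cnj \<circ> g)) f = - contour_integral (cnj \<circ> g) f"
    by (intro contour_integral_reversepath) (simp add: valid_path_cnj)
  also have "\<dots> = - cnj (contour_integral g (\<lambda>z. cnj (f (cnj z))))"
    using contour_integral_cnj[OF g(1)] by (simp add: o_def)
  finally show ?case using Cons by (simp add: o_def)
qed simp

lemma cycle_ind_conj:
  assumes "cycle_in S gs" "open S" "\<And>z. z \<in> S \<Longrightarrow> cnj z \<in> S" "w \<notin> S"
  shows "cycle_ind (conj_cycle gs) w = cnj (cycle_ind gs (cnj w))"
proof -
  have cw: "cnj w \<notin> S" using assms(3)[of "cnj w"] assms(4) by auto
  have "(\<lambda>z. 1 / (z - w)) holomorphic_on S" using assms(4) by (auto intro!: holomorphic_intros)
  from cycle_int_conj[OF assms(1-3) this]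
  have "2 * of_real pi * \<i> * cycle_ind (conj_cycle gs) w = - cnj (2 * of_real pi * \<i> * cycle_ind gs (cnj w))"
    using cycle_ind_eq_int[OF assms(1) cw] cycle_ind_eq_int[OF cycle_in_conj[OF assms(1,3)] assms(4)] by simp
  then show ?thesis by simp
qed

text \<open>With no length available for the path, the difference quotients are estimated by
  \<open>contour_integral_bound_exists\<close>, which uses a bound of the integrand on an open
  neighbourhood of the path.\<close>

lemma Cauchy_type_integral_holomorphic:
  assumes S: "open S" and g: "valid_path g" "path_image g \<subseteq> S" and c: "c holomorphic_on S"
  shows "(\<lambda>z. contour_integral g (\<lambda>w. c w / (w - z))) holomorphic_on - path_image g"
  unfolding holomorphic_on_def
proof
  fix z0 assume "z0 \<in> - path_image g"
  moreover have cpt: "compact (path_image g)" using g(1) by (simp add: compact_valid_path_image)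
  then have "open (- path_image g)" by (simp add: compact_imp_closed open_Compl)
  ultimately obtain \<epsilon> where \<epsilon>: "\<epsilon> > 0" "ball z0 \<epsilon> \<subseteq> - path_image g" using openE by blast
  define \<delta> where "\<delta> = \<epsilon> / 3"
  have \<delta>: "\<delta> > 0" using \<epsilon>(1) by (simp add: \<delta>_def)
  have cc: "continuous_on S c" using c by (rule holomorphic_on_imp_continuous_on)
  obtain B where B: "\<And>w. w \<in> path_image g \<Longrightarrow> norm (c w) < B" "B > 0"
  proof -
    have "compact (c ` path_image g)" using cpt cc g(2) by (intro compact_continuous_image continuous_on_subset[OF cc])
    then obtain b where "\<And>w. w \<in> path_image g \<Longrightarrow> norm (c w) \<le> b" 
      by (metis bounded_iff compact_imp_bounded image_eqI)
    then show thesis using that[of "\<bar>b\<bar> + 1"] by fastforce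
  qed
  \<comment> \<open>The path keeps distance 3 \<delta> from \<open>z0\<close>. Removing the ball of
    radius 2 \<delta> leaves an open set around the path that is at least \<delta> away from every
    \<open>z\<close> in \<open>ball z0 \<delta>\<close>, and on which \<open>c\<close> is
    bounded.\<close>
  define S' where "S' = {w \<in> S. norm (c w) < B} - cball z0 (2 * \<delta>)"
  have "open {w \<in> S. norm (c w) < B}"
  proof -
    have "{w \<in> S. norm (c w) < B} = S \<inter> c -` ball 0 B" by auto
    then show ?thesis using continuous_open_preimage[OF cc S, of "ball 0 B"] by simp
  qed
  then have oS': "open S'" unfolding S'_def by (intro open_Diff) auto
  have gS': "path_image g \<subseteq> S'"
  proof
    fix w assume w: "w \<in> path_image g"
    then have "w \<notin> ball z0 \<epsilon>" using \<epsilon>(2) by auto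
    then show "w \<in> S'" using w B g(2) \<delta> by (auto simp: S'_def \<delta>_def)
  qed
  obtain L where L: "L > 0" "\<And>f b. f holomorphic_on S' \<Longrightarrow> (\<forall>z\<in>S'. norm (f z) \<le> b) \<Longrightarrow> norm (contour_integral g f) \<le> L * b"
    using contour_integral_bound_exists[OF oS' g(1) gS'] by blast
  have cS': "c holomorphic_on S'" using c by (rule holomorphic_on_subset) (auto simp: S'_def)
  have far: "\<delta> \<le> norm (w - z)" if "w \<in> S'" "z \<in> ball z0 \<delta>" for w z
  proof -
    have "2 * \<delta> < dist z0 w" "dist z0 z < \<delta>" using that by (auto simp: S'_def)
    then show ?thesis using dist_triangle[of z0 w z] by (simp add: dist_norm norm_minus_commute)
  qed
  have hol: "(\<lambda>w. c w / ((w - z) * (w - y))) holomorphic_on S'" "(\<lambda>w. c w / (w - z)) holomorphic_on S'"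
    if "z \<in> ball z0 \<delta>" "y \<in> ball z0 \<delta>" for z y
  proof -
    have "w - z \<noteq> 0" "w - y \<noteq> 0" if w: "w \<in> S'" for w
      using far[OF w \<open>z \<in> ball z0 \<delta>\<close>] far[OF w \<open>y \<in> ball z0 \<delta>\<close>] \<delta> by auto
    then show "(\<lambda>w. c w / ((w - z) * (w - y))) holomorphic_on S'" "(\<lambda>w. c w / (w - z)) holomorphic_on S'"
      by (auto intro!: holomorphic_intros cS')
  qed
  note ci = contour_integrable_holomorphic_simple[OF _ oS' g(1) gS']
  have z0b: "z0 \<in> ball z0 \<delta>" using \<delta> by simp
  define k where "k z = contour_integral g (\<lambda>w. c w / (w - z))" for z
  define D where "D = contour_integral g (\<lambda>w. c w / ((w - z0) * (w - z0)))"
  have "\<forall>\<^sub>F z in at z0. norm ((k z - k z0) / (z - z0) - D) \<le> L * (B / \<delta> ^ 3) * norm (z - z0)"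
    unfolding eventually_at
  proof (intro exI[of _ \<delta>] conjI \<delta> ballI impI)
    fix z assume z: "z \<noteq> z0 \<and> dist z z0 < \<delta>"
    then have zb: "z \<in> ball z0 \<delta>" by (simp add: dist_commute)
    have nz: "w - z \<noteq> 0" "w - z0 \<noteq> 0" if "w \<in> path_image g" for w
      using far[of w z] far[of w z0] gS' that zb z0b \<delta> by auto
    have "k z - k z0 = contour_integral g (\<lambda>w. c w / (w - z) - c w / (w - z0))"
      unfolding k_def by (rule contour_integral_diff[symmetric]) (intro ci hol(2)[OF zb z0b] hol(2)[OF z0b zb])+
    also have "\<dots> = contour_integral g (\<lambda>w. (z - z0) * (c w / ((w - z) * (w - z0))))"
      by (intro contour_integral_eq) (use nz in \<open>auto simp: field_simps\<close>)
    also have "\<dots> = (z - z0) * contour_integral g (\<lambda>w. c w / ((w - z) * (w - z0)))"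
      by (intro contour_integral_lmul ci hol(1)[OF zb z0b])
    finally have "(k z - k z0) / (z - z0) - D =
        contour_integral g (\<lambda>w. c w / ((w - z) * (w - z0))) - D" using z by simp
    also have "\<dots> = contour_integral g (\<lambda>w. c w / ((w - z) * (w - z0)) - c w / ((w - z0) * (w - z0)))"
      unfolding D_def by (rule contour_integral_diff[symmetric]) (intro ci hol(1)[OF zb z0b] hol(1)[OF z0b z0b])+
    also have "norm \<dots> \<le> L * (B / \<delta> ^ 3 * norm (z - z0))"
    proof (rule L(2))
      show "(\<lambda>w. c w / ((w - z) * (w - z0)) - c w / ((w - z0) * (w - z0))) holomorphic_on S'"
        by (intro holomorphic_on_diff hol(1)[OF zb z0b] hol(1)[OF z0b z0b])
      show "\<forall>w\<in>S'. norm (c w / ((w - z) * (w - z0)) - c w / ((w - z0) * (w - z0))) \<le> B / \<delta> ^ 3 * norm (z - z0)"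
      proof
        fix w assume w: "w \<in> S'"
        have f: "\<delta> \<le> norm (w - z)" "\<delta> \<le> norm (w - z0)" using far[OF w] zb z0b by auto
        then have nz: "w - z \<noteq> 0" "w - z0 \<noteq> 0" using \<delta> by auto
        \<comment> \<open>The difference of the two kernels gains a factor \<open>z - z0\<close>,
          and three denominators of size at least \<delta> remain; hence
          \<open>B / \<delta> ^ 3\<close>.\<close>
        have "c w / ((w - z) * (w - z0)) - c w / ((w - z0) * (w - z0)) = c w * (z - z0) / ((w - z) * (w - z0) * (w - z0))"
          using nz by (simp add: divide_simps) (simp add: algebra_simps)
        also have "norm \<dots> = norm (c w) * norm (z - z0) / (norm (w - z) * norm (w - z0) * norm (w - z0))"
          by (simp add: norm_mult norm_divide)
        also have "\<dots> \<le> B * norm (z - z0) / (\<delta> * \<delta> * \<delta>)"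
          using w f \<delta> B(2) by (intro frac_le mult_mono) (auto simp: S'_def)
        finally show "norm (c w / ((w - z) * (w - z0)) - c w / ((w - z0) * (w - z0))) \<le> B / \<delta> ^ 3 * norm (z - z0)"
          by (simp add: power3_eq_cube)
      qed
    qed
    finally show "norm ((k z - k z0) / (z - z0) - D) \<le> L * (B / \<delta> ^ 3) * norm (z - z0)" by (simp add: mult_ac)
  qed
  moreover have "((\<lambda>z. L * (B / \<delta> ^ 3) * norm (z - z0)) \<longlongrightarrow> L * (B / \<delta> ^ 3) * norm (z0 - z0)) (at z0)"
    by (intro tendsto_intros)
  then have "((\<lambda>z. L * (B / \<delta> ^ 3) * norm (z - z0)) \<longlongrightarrow> 0) (at z0)" by simp
  ultimately have "((\<lambda>z. (k z - k z0) / (z - z0) - D) \<longlongrightarrow> 0) (at z0)" by (rule Lim_null_comparison)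
  then have "(k has_field_derivative D) (at z0)" by (simp add: has_field_derivative_iff LIM_zero_iff)
  then show "(\<lambda>z. contour_integral g (\<lambda>w. c w / (w - z))) field_differentiable at z0 within - path_image g"
    unfolding k_def by (meson field_differentiable_at_within field_differentiable_def)
qed

lemma Cauchy_type_cycle_integral_holomorphic:
  assumes "open S" "cycle_in S gs" "c holomorphic_on S" "\<And>g. g \<in> set gs \<Longrightarrow> V \<inter> path_image g = {}"
  shows "(\<lambda>z. cycle_int gs (\<lambda>w. c w / (w - z))) holomorphic_on V"
  using assms(2,4)
proof (induction gs)
  case (Cons g gs)
  then have "(\<lambda>z. contour_integral g (\<lambda>w. c w / (w - z))) holomorphic_on V"
    by (intro holomorphic_on_subset[OF Cauchy_type_integral_holomorphic[OF assms(1) _ _ assms(3)]]) auto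
  with Cons show ?case by (auto intro!: holomorphic_intros)
qed simp

section \<open>The intrinsic functional calculus\<close>

context commuting_op
begin

text \<open>The counterpart of \<open>admissible\<close> in the parameter plane; axial symmetry
  becomes invariance under \<open>cnj\<close>.\<close>

definition adm :: "complex set \<Rightarrow> complex set \<Rightarrow> (real \<Rightarrow> complex) list \<Rightarrow> bool" where
  "adm D V gs \<longleftrightarrow> open V \<and> bounded V \<and> (\<forall>z\<in>V. cnj z \<in> V) \<and> spec \<subseteq> V \<and> closure V \<subseteq> D \<and> pos_boundary V gs"

lemma adm_exists:
  assumes "open D" "spec \<subseteq> D"
  obtains V gs where "adm D V gs"
proof -
  obtain V gs where "open V" "bounded V" "\<And>z. z \<in> V \<Longrightarrow> cnj z \<in> V" "spec \<subseteq> V" "closure V \<subseteq> D" "pos_boundary V gs"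
    using symmetric_Cauchy_domain_exists[OF compact_spec assms spec_cnj] by blast
  then show thesis using that unfolding adm_def by blast
qed

lemma adm_mono: "adm D V gs \<Longrightarrow> D \<subseteq> D' \<Longrightarrow> adm D' V gs"
  by (auto simp: adm_def)

lemma adm_path_image:
  assumes "adm D V gs" "g \<in> set gs"
  shows "V \<inter> path_image g = {}" "path_image g \<subseteq> closure V"
proof -
  have "path_image g \<subseteq> frontier V" using assms unfolding adm_def pos_boundary_def by blast
  moreover have "V \<inter> frontier V = {}" using assms(1) by (auto simp: adm_def frontier_def interior_open)
  ultimately show "V \<inter> path_image g = {}" "path_image g \<subseteq> closure V" by (auto simp: frontier_def)
qed

lemma adm_cycle_in:
  assumes "adm D V gs"
  shows "cycle_in (D - V) gs"
  unfolding cycle_in_def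
proof (intro ballI conjI)
  fix g assume g: "g \<in> set gs"
  show "valid_path g" "pathfinish g = pathstart g"
    using assms g by (simp_all add: adm_def pos_boundary_def)
  have "closure V \<subseteq> D" using assms by (simp add: adm_def)
  then show "path_image g \<subseteq> D - V" using adm_path_image[OF assms g] by auto
qed

lemma cycle_in_mono: "cycle_in S gs \<Longrightarrow> S \<subseteq> S' \<Longrightarrow> cycle_in S' gs"
  by (auto simp: cycle_in_def)

lemma adm_cycle_in_spec: "adm D V gs \<Longrightarrow> cycle_in (D - spec) gs"
  by (rule cycle_in_mono[OF adm_cycle_in]) (auto simp: adm_def)

lemma adm_cycle_ind:
  assumes "adm D V gs"
  shows "z \<in> V \<Longrightarrow> cycle_ind gs z = 1" "z \<notin> closure V \<Longrightarrow> cycle_ind gs z = 0"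
  using assms by (auto simp: adm_def pos_boundary_def cycle_ind_def)

lemma adm_cycle_ind_out: "adm D V gs \<Longrightarrow> w \<notin> D \<Longrightarrow> cycle_ind gs w = 0"
  using adm_cycle_ind(2)[of D V gs w] unfolding adm_def by blast

lemma adm_cycle_ind_off: "adm D V gs \<Longrightarrow> w \<notin> D - spec \<Longrightarrow> cycle_ind gs w = (if w \<in> spec then 1 else 0)"
  using adm_cycle_ind(1)[of D V gs w] adm_cycle_ind_out[of D V gs w] unfolding adm_def by auto

lemma open_Diff_spec: "open D \<Longrightarrow> open (D - spec)"
  using compact_spec by (intro open_Diff compact_imp_closed)

lemma vhol_on_integrand:
  assumes "open D" "H holomorphic_on D"
  shows "vhol_on (\<lambda>z. cs (H z) (Qi z)) (D - spec)"
  using assms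
  by (intro vhol_on_cs open_Diff_spec vhol_on_subset[OF vhol_on_Qi]) (auto intro: holomorphic_on_subset)

lemma resolvent_holomorphic:
  assumes "clinear_fun L"
  shows "(\<lambda>z. L (Qi z)) holomorphic_on - spec"
  by (rule vhol_on_holomorphic[OF vhol_on_Qi assms])

text \<open>\<open>A\<close> is the integral of \<open>H\<close> against the inverse of
  \<open>Q\<close>, divided by 2 pi i. Two claims are built in: the value is the same for every
  contour, and its imaginary component is zero.\<close>

definition calc :: "complex set \<Rightarrow> (complex \<Rightarrow> complex) \<Rightarrow> ('x \<Rightarrow>\<^sub>L 'x) \<Rightarrow> bool" where
  "calc D H A \<longleftrightarrow> (\<forall>V gs. adm D V gs \<longrightarrow>
     vcycle_int gs (\<lambda>z. cs (H z) (Qi z)) = cs (2 * of_real pi * \<i>) (A, 0))"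

lemma calc_zero: "calc D (\<lambda>z. 0) 0"
proof -
  have "vcycle_int gs (\<lambda>z. 0 :: 'x cop) = 0" for gs
    by (induction gs) (simp_all add: vcycle_int_def vpath_int_def cs.zero_right)
  then show ?thesis by (simp add: calc_def cs.zero_left cs_def zero_prod_def)
qed

text \<open>Admissible cycles have index 1 on the spectrum and 0 off \<open>D\<close>, so they are
  homologous in \<open>D - spec\<close>. For the vanishing component, the conjugated cycle is
  homologous to the original one and the integrand commutes with conjugation; hence the integral is
  minus its own conjugate.\<close>

lemma calc_exists:
  assumes D: "open D" "spec \<subseteq> D" and H: "H holomorphic_on D"
    and sym: "\<And>z. z \<in> D \<Longrightarrow> cnj z \<in> D" "\<And>z. z \<in> D \<Longrightarrow> H (cnj z) = cnj (H z)"
  obtains A where "calc D H A"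
proof -
  let ?S = "D - spec" and ?F = "\<lambda>z. cs (H z) (Qi z)"
  note oS = open_Diff_spec[OF D(1)] and vF = vhol_on_integrand[OF D(1) H]
  obtain V0 gs0 where a0: "adm D V0 gs0" using adm_exists[OF D] by blast
  define I where "I = vcycle_int gs0 ?F"
  have indep: "vcycle_int gs ?F = I" if a: "adm D V gs" for V gs
  proof (rule clinear_funs_separate)
    fix L :: "'x cop \<Rightarrow> complex" assume L: "clinear_fun L"
    have "cycle_int gs (\<lambda>z. L (?F z)) = cycle_int gs0 (\<lambda>z. L (?F z))"
      using adm_cycle_ind_off[OF a] adm_cycle_ind_off[OF a0]
      by (intro Cauchy_cycle_homologous[OF oS adm_cycle_in_spec[OF a] adm_cycle_in_spec[OF a0]
        vhol_on_holomorphic[OF vF L]]) simp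
    then show "L (vcycle_int gs ?F) = L I"
      unfolding I_def by (simp only: clinear_fun_vcycle_int[OF oS vF adm_cycle_in_spec[OF a] L]
        clinear_fun_vcycle_int[OF oS vF adm_cycle_in_spec[OF a0] L])
  qed
  have symS: "cnj z \<in> ?S" if "z \<in> ?S" for z using that sym(1) spec_cnj[of "cnj z"] by auto
  have "fst I = 0"
  proof (rule bounded_linear_separates)
    fix \<phi> :: "('x \<Rightarrow>\<^sub>L 'x) \<Rightarrow> real" assume \<phi>: "bounded_linear \<phi>"
    interpret bounded_linear \<phi> by (rule \<phi>)
    let ?L = "complexify \<phi>"
    note L = clinear_fun_complexify[OF \<phi>]
    let ?f = "\<lambda>z. ?L (?F z)"
    note hf = vhol_on_holomorphic[OF vF L] and c0 = adm_cycle_in_spec[OF a0]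
    have Lc: "?L (cconj a) = cnj (?L a)" for a by (simp add: complexify_def cconj_def complex_eq_iff neg)
    have "cnj (?f (cnj z)) = ?f z" if "z \<in> ?S" for z
      using that sym(2)[of z] Qi_cnj[of z] by (simp add: clinear_funD(2)[OF L] Lc)
    then have "cycle_int gs0 (\<lambda>z. cnj (?f (cnj z))) = cycle_int gs0 ?f"
      by (intro cycle_int_cong[OF c0]) auto
    then have "cycle_int (conj_cycle gs0) ?f = - cnj (cycle_int gs0 ?f)"
      using cycle_int_conj[OF c0 oS symS hf] by simp
    moreover have "cycle_int (conj_cycle gs0) ?f = cycle_int gs0 ?f"
    proof (rule Cauchy_cycle_homologous[OF oS cycle_in_conj[OF c0 symS] c0 hf])
      fix w assume w: "w \<notin> ?S"
      then have "cnj w \<notin> ?S" using symS[of "cnj w"] by auto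
      moreover have "cnj w \<in> spec \<longleftrightarrow> w \<in> spec" using spec_cnj[of w] spec_cnj[of "cnj w"] by auto
      ultimately show "cycle_ind (conj_cycle gs0) w = cycle_ind gs0 w"
        using cycle_ind_conj[OF c0 oS symS w] adm_cycle_ind_off[OF a0 w] adm_cycle_ind_off[OF a0, of "cnj w"]
        by simp
    qed simp
    moreover have "?L I = cycle_int gs0 ?f"
      unfolding I_def by (rule clinear_fun_vcycle_int[OF oS vF c0 L])
    ultimately have "?L I = - cnj (?L I)" by simp
    then have "Re (?L I) = 0" by (simp add: complex_eq_iff)
    then show "\<phi> (fst I) = \<phi> 0" by (simp add: complexify_def zero)
  qed
  then have "I = cs (2 * of_real pi * \<i>) ((1 / (2 * pi)) *\<^sub>R snd I, 0)"
    by (simp add: cs_def prod_eq_iff)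
  then show thesis using that indep unfolding calc_def by metis
qed

lemma calc_cycle_int:
  assumes "calc D H A" "adm D V gs" "open D" "H holomorphic_on D" "clinear_fun L"
  shows "cycle_int gs (\<lambda>z. H z * L (Qi z)) = 2 * of_real pi * \<i> * L (A, 0)"
proof -
  have "cycle_int gs (\<lambda>z. L (cs (H z) (Qi z))) = L (vcycle_int gs (\<lambda>z. cs (H z) (Qi z)))"
    using clinear_fun_vcycle_int[OF open_Diff_spec[OF assms(3)] vhol_on_integrand[OF assms(3,4)]
      adm_cycle_in_spec[OF assms(2)] assms(5)] by simp
  then show ?thesis using assms(1,2) by (simp add: calc_def clinear_funD(2)[OF assms(5)])
qed

lemma calc_commute:
  assumes "calc D H A" "open D" "spec \<subseteq> D" "H holomorphic_on D"
    and X: "X o\<^sub>L T0 = T0 o\<^sub>L X" "X o\<^sub>L NT = NT o\<^sub>L X"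
  shows "X o\<^sub>L A = A o\<^sub>L X"
proof -
  obtain V gs where a: "adm D V gs" using adm_exists[OF assms(2,3)] by blast
  have "cm (X, 0) (A, 0) = cm (A, 0) (X, 0)"
  proof (rule clinear_funs_separate)
    fix L :: "'x cop \<Rightarrow> complex" assume L: "clinear_fun L"
    have "cycle_int gs (\<lambda>z. H z * L (cm (X, 0) (Qi z))) = cycle_int gs (\<lambda>z. H z * L (cm (Qi z) (X, 0)))"
      by (rule cycle_int_cong[OF adm_cycle_in_spec[OF a]]) (use Qi_commute X in auto)
    then show "L (cm (X, 0) (A, 0)) = L (cm (A, 0) (X, 0))"
      using calc_cycle_int[OF assms(1) a assms(2,4) clinear_fun_cm_left[OF L]]
        calc_cycle_int[OF assms(1) a assms(2,4) clinear_fun_cm_right[OF L]] by simp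
  qed
  then show ?thesis by (simp add: cm_def blinfun_compose_simps)
qed

text \<open>The double integral of a difference quotient over a cycle and a larger one: the first half is
  evaluated by Cauchy's formula, and the second half vanishes because the inner Cauchy-type integral is
  holomorphic inside the larger cycle. No exchange of integrals is needed.\<close>

lemma nested_cycle_int:
  assumes F: "F holomorphic_on Df" "open Df" and G: "G holomorphic_on Dg" "open Dg"
    and e: "e holomorphic_on - spec"
    and a2: "adm Dg V2 gs2" and a1: "adm (Df \<inter> V2) V1 gs1"
    and R: "\<And>z. z \<in> Df \<inter> V2 - spec \<Longrightarrow>
      2 * of_real pi * \<i> * R z = cycle_int gs2 (\<lambda>w. G w * (e z - e w) / (w - z))"
  shows "cycle_int gs1 (\<lambda>z. F z * R z) = cycle_int gs1 (\<lambda>z. F z * G z * e z)"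
proof -
  let ?S1 = "Df \<inter> V2 - spec" and ?c = "2 * of_real pi * \<i> :: complex"
  have V2: "open V2" "V2 \<subseteq> Dg" "spec \<subseteq> V2"
    using a2 closure_subset[of V2] by (auto simp: adm_def)
  have oS1: "open ?S1" using F(2) V2(1) by (intro open_Diff_spec) auto
  have c1: "cycle_in ?S1 gs1" by (rule adm_cycle_in_spec[OF a1])
  have c2: "cycle_in (Dg - V2) gs2" by (rule adm_cycle_in[OF a2])
  then have c2s: "cycle_in (Dg - spec) gs2" using V2(3) by (auto simp: cycle_in_def)
  define k where "k z = cycle_int gs2 (\<lambda>w. G w * e w / (w - z))" for z
  have Ge: "(\<lambda>w. G w * e w) holomorphic_on Dg - spec"
    using G(1) e by (auto intro!: holomorphic_intros intro: holomorphic_on_subset)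
  have k: "k holomorphic_on V2"
    unfolding k_def
    by (rule Cauchy_type_cycle_integral_holomorphic[OF open_Diff_spec[OF G(2)] c2s Ge])
       (use adm_path_image(1)[OF a2] in auto)
  have Rk: "?c * R z = ?c * (G z * e z) - k z" if z: "z \<in> ?S1" for z
  proof -
    have zD: "z \<in> Dg" "z \<in> V2" using z V2(2) by auto
    have c2z: "cycle_in (Dg - spec - {z}) gs2" using c2 V2(3) zD(2) by (fastforce simp: cycle_in_def)
    have o: "open (Dg - spec - {z})" using open_Diff_spec[OF G(2)] by auto
    have h: "(\<lambda>w. G w / (w - z)) holomorphic_on Dg - spec - {z}" "(\<lambda>w. G w * e w / (w - z)) holomorphic_on Dg - spec - {z}"

    proof -
      have "Dg - spec - {z} \<subseteq> Dg - spec" "Dg - spec - {z} \<subseteq> Dg" by auto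
      note s = holomorphic_on_subset[OF Ge this(1)] holomorphic_on_subset[OF G(1) this(2)]
      show "(\<lambda>w. G w / (w - z)) holomorphic_on Dg - spec - {z}" "(\<lambda>w. G w * e w / (w - z)) holomorphic_on Dg - spec - {z}"
        by (intro holomorphic_on_divide s holomorphic_intros; simp)+
    qed
    have "?c * R z = cycle_int gs2 (\<lambda>w. e z * (G w / (w - z)) - G w * e w / (w - z))"
      unfolding R[OF z] by (rule cycle_int_cong[OF c2z]) (simp add: algebra_simps flip: diff_divide_distrib)
    also have "\<dots> = e z * cycle_int gs2 (\<lambda>w. G w / (w - z)) - k z"
      unfolding k_def cycle_int_lmul[OF c2z o h(1), symmetric]
      by (rule cycle_int_diff[OF c2z o holomorphic_on_mult[OF holomorphic_on_const h(1)] h(2)])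
    also have "cycle_int gs2 (\<lambda>w. G w / (w - z)) = ?c * cycle_ind gs2 z * G z"
    proof (rule Cauchy_cycle_formula[OF G(2) _ G(1) zD(1)])
      show "cycle_in (Dg - {z}) gs2" using c2z by (auto simp: cycle_in_def)
      show "cycle_ind gs2 w = 0" if "w \<notin> Dg" for w
        by (rule adm_cycle_ind_out[OF a2 that])
    qed
    also have "cycle_ind gs2 z = 1" by (rule adm_cycle_ind(1)[OF a2 zD(2)])
    finally show ?thesis by (simp add: mult_ac)
  qed
  have FG: "(\<lambda>z. F z * G z * e z) holomorphic_on ?S1"
    using F(1) G(1) e V2(2) by (auto intro!: holomorphic_intros intro: holomorphic_on_subset)
  have Fk: "(\<lambda>z. F z * k z) holomorphic_on Df \<inter> V2"
    using F(1) k by (auto intro!: holomorphic_intros intro: holomorphic_on_subset)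
  then have Fk1: "(\<lambda>z. F z * k z) holomorphic_on ?S1" by (rule holomorphic_on_subset) auto
  have "cycle_int gs1 (\<lambda>z. F z * R z) = cycle_int gs1 (\<lambda>z. F z * G z * e z - (1 / ?c) * (F z * k z))"
  proof (rule cycle_int_cong[OF c1])
    fix z assume "z \<in> ?S1"
    from Rk[OF this] have "R z = G z * e z - (1 / ?c) * k z" by (simp add: field_simps)
    then show "F z * R z = F z * G z * e z - (1 / ?c) * (F z * k z)"
      by (simp only: right_diff_distrib mult_ac)
  qed
  also have "\<dots> = cycle_int gs1 (\<lambda>z. F z * G z * e z) - cycle_int gs1 (\<lambda>z. (1 / ?c) * (F z * k z))"
    by (rule cycle_int_diff[OF c1 oS1 FG holomorphic_on_mult[OF holomorphic_on_const Fk1]])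
  also have "cycle_int gs1 (\<lambda>z. (1 / ?c) * (F z * k z)) = (1 / ?c) * cycle_int gs1 (\<lambda>z. F z * k z)"
    by (rule cycle_int_lmul[OF c1 oS1 Fk1])
  also have "cycle_int gs1 (\<lambda>z. F z * k z) = 0"
  proof (rule Cauchy_cycle[OF _ _ Fk])
    show "open (Df \<inter> V2)" using F(2) V2(1) by auto
    show "cycle_in (Df \<inter> V2) gs1" using c1 by (auto simp: cycle_in_def)
    show "cycle_ind gs1 w = 0" if "w \<notin> Df \<inter> V2" for w
      by (rule adm_cycle_ind_out[OF a1 that])
  qed
  finally show ?thesis by simp
qed

text \<open>By \<open>Qi_diff\<close>, the quotient of \<open>Qi z - Qi w\<close> by
  \<open>w - z\<close> is \<open>Qi z\<close> times \<open>w + z - 2 T0\<close> times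
  \<open>Qi w\<close>. Integrated against \<open>F z\<close> and \<open>G w\<close>, the summand
  \<open>w\<close> gives \<open>b c\<close>, the summand \<open>z\<close> gives \<open>a d\<close>,
  and \<open>- 2 T0\<close> gives the last term; \<open>nested_cycle_int\<close> evaluates the same
  double integral as \<open>q\<close>.\<close>

lemma calc_product:
  assumes F: "F holomorphic_on Df" "open Df" "spec \<subseteq> Df" and G: "G holomorphic_on Dg" "open Dg" "spec \<subseteq> Dg"
    and b: "calc Df F b" and a: "calc Df (\<lambda>z. z * F z) a"
    and d: "calc Dg G d" and c: "calc Dg (\<lambda>z. z * G z) c" and q: "calc (Df \<inter> Dg) (\<lambda>z. F z * G z) q"
  shows "q = (b o\<^sub>L c) + (a o\<^sub>L d) - (b o\<^sub>L (2 *\<^sub>R T0) o\<^sub>L d)"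
proof -
  let ?c = "2 * of_real pi * \<i> :: complex"
  obtain V2 gs2 where a2: "adm Dg V2 gs2" using adm_exists[OF G(2,3)] by blast
  have V2: "open V2" "V2 \<subseteq> Dg" "spec \<subseteq> V2"
    using a2 closure_subset[of V2] by (auto simp: adm_def)
  \<comment> \<open>Admissibility relative to \<open>Df \<inter> V2\<close> puts the closure of
    \<open>V1\<close> inside \<open>V2\<close>: the contours are nested, and \<open>w - z\<close>
    does not vanish on them.\<close>
  obtain V1 gs1 where a1: "adm (Df \<inter> V2) V1 gs1" using adm_exists[of "Df \<inter> V2"] F V2 by auto
  have a1f: "adm Df V1 gs1" and a1fg: "adm (Df \<inter> Dg) V1 gs1"
    using adm_mono[OF a1] V2(2) by blast+
  have zF: "(\<lambda>z. z * F z) holomorphic_on Df" and zG: "(\<lambda>z. z * G z) holomorphic_on Dg"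
    and FG: "(\<lambda>z. F z * G z) holomorphic_on Df \<inter> Dg"
    and oFG: "open (Df \<inter> Dg)"
    using F G by (auto intro!: holomorphic_intros intro: holomorphic_on_subset)
  have c1: "cycle_in (Df \<inter> V2 - spec) gs1" by (rule adm_cycle_in_spec[OF a1])
  have oS1: "open (Df \<inter> V2 - spec)" using F(2) V2(1) by (intro open_Diff_spec) auto
  have c2: "cycle_in (Dg - V2) gs2" by (rule adm_cycle_in[OF a2])
  have c2s: "cycle_in (Dg - spec) gs2" by (rule adm_cycle_in_spec[OF a2])
  note o2 = open_Diff_spec[OF G(2)]
  have holL: "(\<lambda>z. H z * L (Qi z)) holomorphic_on D - spec" if "clinear_fun L" "H holomorphic_on D" for L H D
    using resolvent_holomorphic[OF that(1)] that(2)
    by (auto intro!: holomorphic_intros intro: holomorphic_on_subset)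
  have holL1: "(\<lambda>z. H z * L (Qi z)) holomorphic_on Df \<inter> V2 - spec" if "clinear_fun L" "H holomorphic_on Df" for L H
    using holL[OF that] by (rule holomorphic_on_subset) auto
  have "(q, 0) = ((b o\<^sub>L c) + (a o\<^sub>L d) - (b o\<^sub>L (2 *\<^sub>R T0) o\<^sub>L d), 0 :: 'x \<Rightarrow>\<^sub>L 'x)"
  proof (rule clinear_funs_separate)
    fix L :: "'x cop \<Rightarrow> complex" assume L: "clinear_fun L"
    interpret L: bounded_linear L using L by (rule clinear_funD)
    define e where "e z = L (Qi z)" for z
    \<comment> \<open>The inner integral over \<open>gs2\<close> for fixed \<open>z\<close>, divided
      by 2 pi i and expressed by the moments of \<open>G\<close>.\<close>
    define R where "R z = L (cm (Qi z) (c, 0)) + z * L (cm (Qi z) (d, 0)) - L (cm (Qi z) (cm (2 *\<^sub>R T0, 0) (d, 0)))" for z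
    have 1: "?c * R z = cycle_int gs2 (\<lambda>w. G w * (e z - e w) / (w - z))" if z: "z \<in> Df \<inter> V2 - spec" for z
    proof -
      note L1 = clinear_fun_cm_left[OF L, of "Qi z"]
      note L2 = clinear_fun_cm_left[OF L1, of "(2 *\<^sub>R T0, 0)"]
      note h1 = holL[OF L1 zG] and h2 = holL[OF L1 G(1)] and h3 = holL[OF L2 G(1)]
      have h2': "(\<lambda>w. z * (G w * L (cm (Qi z) (Qi w)))) holomorphic_on Dg - spec"
        by (rule holomorphic_on_mult[OF holomorphic_on_const h2])
      have "?c * R z = cycle_int gs2 (\<lambda>w. w * G w * L (cm (Qi z) (Qi w)))
          + z * cycle_int gs2 (\<lambda>w. G w * L (cm (Qi z) (Qi w)))
          - cycle_int gs2 (\<lambda>w. G w * L (cm (Qi z) (cm (2 *\<^sub>R T0, 0) (Qi w))))"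
        using calc_cycle_int[OF c a2 G(2) zG L1] calc_cycle_int[OF d a2 G(2,1) L1] calc_cycle_int[OF d a2 G(2,1) L2]
        by (simp add: R_def algebra_simps)
      also have "\<dots> = cycle_int gs2 (\<lambda>w. w * G w * L (cm (Qi z) (Qi w)) + z * (G w * L (cm (Qi z) (Qi w)))
          - G w * L (cm (Qi z) (cm (2 *\<^sub>R T0, 0) (Qi w))))"
        using cycle_int_diff[OF c2s o2 holomorphic_on_add[OF h1 h2'] h3] cycle_int_add[OF c2s o2 h1 h2']
          cycle_int_lmul[OF c2s o2 h2, of z] by simp
      also have "\<dots> = cycle_int gs2 (\<lambda>w. G w * (e z - e w) / (w - z))"
      proof (rule cycle_int_cong[OF c2])
        fix w assume w: "w \<in> Dg - V2"
        then have ws: "w \<notin> spec" "w \<noteq> z" using V2 z by auto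
        have "e z - e w = (w - z) * L (cm (Qi z) (cm (Lin (w + z)) (Qi w)))"
          unfolding e_def using Qi_diff[of z w] ws z by (simp add: clinear_funD(2)[OF L] flip: L.diff)
        also have "L (cm (Qi z) (cm (Lin (w + z)) (Qi w))) = (w + z) * L (cm (Qi z) (Qi w)) - L (cm (Qi z) (cm (2 *\<^sub>R T0, 0) (Qi w)))"
          by (simp add: Lin_def cm.diff_left cm.diff_right cm_cs L.diff clinear_funD(2)[OF L])
        finally have "(e z - e w) / (w - z) = (w + z) * L (cm (Qi z) (Qi w)) - L (cm (Qi z) (cm (2 *\<^sub>R T0, 0) (Qi w)))"
          using ws(2) by simp
        then have "G w * ((e z - e w) / (w - z)) = G w * ((w + z) * L (cm (Qi z) (Qi w)) - L (cm (Qi z) (cm (2 *\<^sub>R T0, 0) (Qi w))))"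
          by simp
        then show "w * G w * L (cm (Qi z) (Qi w)) + z * (G w * L (cm (Qi z) (Qi w))) - G w * L (cm (Qi z) (cm (2 *\<^sub>R T0, 0) (Qi w)))
          = G w * (e z - e w) / (w - z)" by (simp add: algebra_simps)
      qed
      finally show ?thesis .
    qed
    have eh: "e holomorphic_on - spec" unfolding e_def by (rule resolvent_holomorphic[OF L])
    note R1 = clinear_fun_cm_right[OF L, of "(c, 0)"] and R2 = clinear_fun_cm_right[OF L, of "(d, 0)"]
      and R3 = clinear_fun_cm_right[OF L, of "cm (2 *\<^sub>R T0, 0) (d, 0)"]
    note k1 = holL1[OF R1 F(1)] and k2 = holL1[OF R2 zF] and k3 = holL1[OF R3 F(1)]
    have "?c * L ((b o\<^sub>L c) + (a o\<^sub>L d) - (b o\<^sub>L (2 *\<^sub>R T0) o\<^sub>L d), 0)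
        = ?c * (L (cm (b, 0) (c, 0)) + L (cm (a, 0) (d, 0)) - L (cm (b, 0) (cm (2 *\<^sub>R T0, 0) (d, 0))))"
      by (simp add: cm_def blinfun_compose_simps flip: L.add L.diff)
    also have "\<dots> = cycle_int gs1 (\<lambda>z. F z * L (cm (Qi z) (c, 0))) + cycle_int gs1 (\<lambda>z. z * F z * L (cm (Qi z) (d, 0)))
        - cycle_int gs1 (\<lambda>z. F z * L (cm (Qi z) (cm (2 *\<^sub>R T0, 0) (d, 0))))"
      using calc_cycle_int[OF b a1f F(2,1) R1] calc_cycle_int[OF a a1f F(2) zF R2] calc_cycle_int[OF b a1f F(2,1) R3]
      by (simp add: algebra_simps)
    also have "\<dots> = cycle_int gs1 (\<lambda>z. F z * L (cm (Qi z) (c, 0)) + z * F z * L (cm (Qi z) (d, 0))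
        - F z * L (cm (Qi z) (cm (2 *\<^sub>R T0, 0) (d, 0))))"
      using cycle_int_diff[OF c1 oS1 holomorphic_on_add[OF k1 k2] k3] cycle_int_add[OF c1 oS1 k1 k2] by simp
    also have "\<dots> = cycle_int gs1 (\<lambda>z. F z * R z)"
      by (rule cycle_int_cong[OF c1]) (simp add: R_def algebra_simps)
    also have "\<dots> = cycle_int gs1 (\<lambda>z. F z * G z * e z)"
      by (rule nested_cycle_int[OF F(1,2) G(1,2) eh a2 a1 1])
    also have "\<dots> = ?c * L (q, 0)"
      unfolding e_def by (rule calc_cycle_int[OF q a1fg oFG FG L])
    finally show "L (q, 0) = L ((b o\<^sub>L c) + (a o\<^sub>L d) - (b o\<^sub>L (2 *\<^sub>R T0) o\<^sub>L d), 0)" by simp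
  qed
  then show ?thesis by simp
qed

text \<open>\<open>Q(z)\<close> times its inverse integrates to zero, which expresses the second moment of \<open>G\<close> by the lower ones.\<close>

lemma calc_second_moment:
  assumes D: "open D" and G: "G holomorphic_on D" and d: "calc D G d" and c: "calc D (\<lambda>z. z * G z) c"
  shows "calc D (\<lambda>z. z * (z * G z)) (((2 *\<^sub>R T0) o\<^sub>L c) - (NT o\<^sub>L d))"
  unfolding calc_def
proof (intro allI impI)
  fix V gs assume a: "adm D V gs"
  note cy = adm_cycle_in_spec[OF a] and oS = open_Diff_spec[OF D]
  have zG: "(\<lambda>z. z * G z) holomorphic_on D" and zzG: "(\<lambda>z. z * (z * G z)) holomorphic_on D"
    by (intro holomorphic_intros G)+
  show "vcycle_int gs (\<lambda>z. cs (z * (z * G z)) (Qi z)) = cs (2 * of_real pi * \<i>) (((2 *\<^sub>R T0) o\<^sub>L c) - (NT o\<^sub>L d), 0)"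
  proof (rule clinear_funs_separate)
    fix L :: "'x cop \<Rightarrow> complex" assume L: "clinear_fun L"
    interpret L: bounded_linear L using L by (rule clinear_funD)
    let ?T = "\<lambda>x. cm (2 *\<^sub>R T0, 0) x" and ?N = "\<lambda>x. cm (NT, 0) x"
    note L1 = clinear_fun_cm_left[OF L, of "(2 *\<^sub>R T0, 0)"] and L2 = clinear_fun_cm_left[OF L, of "(NT, 0)"]
    have h: "(\<lambda>z. K z * M (Qi z)) holomorphic_on D - spec" if "clinear_fun M" "K holomorphic_on D" for M K
      using vhol_on_holomorphic[OF vhol_on_integrand[OF D that(2)] that(1)] by (simp add: clinear_funD(2)[OF that(1)])
    have h0: "(\<lambda>z. L cunit * G z) holomorphic_on D"
      using G by (intro holomorphic_intros)
    then have h0': "(\<lambda>z. L cunit * G z) holomorphic_on D - spec" by (rule holomorphic_on_subset) auto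
    have "L (vcycle_int gs (\<lambda>z. cs (z * (z * G z)) (Qi z))) = cycle_int gs (\<lambda>z. L (cs (z * (z * G z)) (Qi z)))"
      by (rule clinear_fun_vcycle_int[OF oS vhol_on_integrand[OF D zzG] cy L])
    also have "\<dots> = cycle_int gs (\<lambda>z. L cunit * G z + z * G z * L (?T (Qi z)) - G z * L (?N (Qi z)))"
    proof (rule cycle_int_cong[OF cy])
      fix z assume "z \<in> D - spec"
      then have "L cunit = L (cm (Q z) (Qi z))" using Qi[of z] by (simp add: cinverse_def)
      also have "\<dots> = z\<^sup>2 * L (Qi z) - z * L (?T (Qi z)) + L (?N (Qi z))"
        by (simp add: Q_def cm.diff_left cm.add_left cm_cs L.add L.diff clinear_funD(2)[OF L])
      finally have e: "L cunit = z\<^sup>2 * L (Qi z) - z * L (?T (Qi z)) + L (?N (Qi z))" .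
      show "L (cs (z * (z * G z)) (Qi z)) = L cunit * G z + z * G z * L (?T (Qi z)) - G z * L (?N (Qi z))"
        unfolding e clinear_funD(2)[OF L] by (simp add: algebra_simps power2_eq_square)
    qed
    also have "\<dots> = cycle_int gs (\<lambda>z. L cunit * G z) + cycle_int gs (\<lambda>z. z * G z * L (?T (Qi z)))
        - cycle_int gs (\<lambda>z. G z * L (?N (Qi z)))"
      using cycle_int_diff[OF cy oS holomorphic_on_add[OF h0' h[OF L1 zG]] h[OF L2 G]]
        cycle_int_add[OF cy oS h0' h[OF L1 zG]] by simp
    also have "cycle_int gs (\<lambda>z. L cunit * G z) = 0"
      using cy by (intro Cauchy_cycle[OF D _ h0] adm_cycle_ind_out[OF a]) (auto intro: cycle_in_mono)
    also have "0 + cycle_int gs (\<lambda>z. z * G z * L (?T (Qi z))) - cycle_int gs (\<lambda>z. G z * L (?N (Qi z)))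
        = 2 * of_real pi * \<i> * (L (?T (c, 0)) - L (?N (d, 0)))"
      using calc_cycle_int[OF c a D zG L1] calc_cycle_int[OF d a D G L2] by (simp add: algebra_simps)
    also have "L (?T (c, 0)) - L (?N (d, 0)) = L (((2 *\<^sub>R T0) o\<^sub>L c) - (NT o\<^sub>L d), 0)"
      by (simp add: cm_def blinfun_compose_simps flip: L.diff)
    finally show "L (vcycle_int gs (\<lambda>z. cs (z * (z * G z)) (Qi z))) =
        L (cs (2 * of_real pi * \<i>) (((2 *\<^sub>R T0) o\<^sub>L c) - (NT o\<^sub>L d), 0))"
      by (simp only: clinear_funD(2)[OF L])
  qed
qed

text \<open>This is \<open>calc_product\<close> for \<open>F\<close> and \<open>z * G\<close>. The
  second moment of \<open>G\<close> contributes \<open>2 T0 c\<close>, which cancels against the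
  correction term of the product formula.\<close>

lemma calc_product_first_moment:
  assumes F: "F holomorphic_on Df" "open Df" "spec \<subseteq> Df" and G: "G holomorphic_on Dg" "open Dg" "spec \<subseteq> Dg"
    and b: "calc Df F b" and a: "calc Df (\<lambda>z. z * F z) a"
    and d: "calc Dg G d" and c: "calc Dg (\<lambda>z. z * G z) c" and p: "calc (Df \<inter> Dg) (\<lambda>z. z * (F z * G z)) p"
  shows "p = (a o\<^sub>L c) - (b o\<^sub>L NT o\<^sub>L d)"
proof -
  have "(\<lambda>z. z * (F z * G z)) = (\<lambda>z. F z * (z * G z))" by (simp add: fun_eq_iff)
  with p have p': "calc (Df \<inter> Dg) (\<lambda>z. F z * (z * G z)) p" by simp
  have "(\<lambda>z. z * G z) holomorphic_on Dg" using G(1) by (intro holomorphic_intros)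
  from calc_product[OF F this G(2,3) b a c calc_second_moment[OF G(2,1) d c] p']
  show ?thesis by (simp add: blinfun_compose_simps)
qed

end

section \<open>Quaternionic operators\<close>

lemma opmul_proj:
  "opmul a b =
     ((fst a o\<^sub>L fst b) - (fst (snd a) o\<^sub>L fst (snd b)) - (fst (snd (snd a)) o\<^sub>L fst (snd (snd b))) - (snd (snd (snd a)) o\<^sub>L snd (snd (snd b))),
      (fst a o\<^sub>L fst (snd b)) + (fst (snd a) o\<^sub>L fst b) + (fst (snd (snd a)) o\<^sub>L snd (snd (snd b))) - (snd (snd (snd a)) o\<^sub>L fst (snd (snd b))),
      (fst a o\<^sub>L fst (snd (snd b))) - (fst (snd a) o\<^sub>L snd (snd (snd b))) + (fst (snd (snd a)) o\<^sub>L fst b) + (snd (snd (snd a)) o\<^sub>L fst (snd b)),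
      (fst a o\<^sub>L snd (snd (snd b))) + (fst (snd a) o\<^sub>L fst (snd (snd b))) - (fst (snd (snd a)) o\<^sub>L fst (snd b)) + (snd (snd (snd a)) o\<^sub>L fst b))"
  by (cases a; cases b) simp

lemma opmul_assoc: "opmul (opmul a b) c = opmul a (opmul b c)"
  by (simp add: opmul_proj blinfun_compose_simps algebra_simps)

lemma opmul_simps:
  "opmul (a + b) c = opmul a c + opmul b c" "opmul a (b + c) = opmul a b + opmul a c"
  "opmul (a - b) c = opmul a c - opmul b c" "opmul a (b - c) = opmul a b - opmul a c"
  "opmul (r *\<^sub>R a) c = r *\<^sub>R opmul a c" "opmul a (r *\<^sub>R c) = r *\<^sub>R opmul a c"
  "opmul opI a = a" "opmul a opI = a"
  by (simp_all add: opmul_proj blinfun_compose_simps algebra_simps opI_def prod_eq_iff)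

lemmas bounded_linear_comp_ops =
  bounded_linear_compose[OF bounded_bilinear.bounded_linear_right[OF bounded_bilinear_blinfun_compose]]
  bounded_linear_compose[OF bounded_bilinear.bounded_linear_left[OF bounded_bilinear_blinfun_compose]]

lemma bounded_linear_opmul_right: "bounded_linear (opmul a)"
proof -
  have "bounded_linear (\<lambda>b. opmul a b)" unfolding opmul_proj
    by (intro bounded_linear_Pair bounded_linear_add bounded_linear_sub bounded_linear_comp_ops
      bounded_linear_fst_comp bounded_linear_snd_comp bounded_linear_ident)
  then show ?thesis by simp
qed

lemma bounded_linear_opmul_left: "bounded_linear (\<lambda>a. opmul a b)"
  unfolding opmul_proj
  by (intro bounded_linear_Pair bounded_linear_add bounded_linear_sub bounded_linear_comp_ops
    bounded_linear_fst_comp bounded_linear_snd_comp bounded_linear_ident)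

lemma op_inverse_eqI:
  assumes "opmul A B = opI" "opmul B A = opI"
  shows "op_inverse A = B"
  unfolding op_inverse_def
proof (rule the_equality)
  fix C assume C: "opmul A C = opI \<and> opmul C A = opI"
  have "C = opmul (opmul B A) C" using assms by (simp add: opmul_simps)
  also have "\<dots> = B" using C by (simp add: opmul_assoc opmul_simps)
  finally show "C = B" .
qed (use assms in simp)

lemma qscal_simps:
  "qscal (p + q) = qscal p + qscal q" "qscal (qmul p q) = opmul (qscal p) (qscal q)"
proof -
  obtain a b c d a' b' c' d' where p: "p = (a, b, c, d)" and q: "q = (a', b', c', d')"
    by (metis prod.collapse)
  show "qscal (p + q) = qscal p + qscal q" "qscal (qmul p q) = opmul (qscal p) (qscal q)"
    unfolding p q by (simp_all add: blinfun_compose_simps algebra_simps)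
qed

lemma qmul_assoc: "qmul (qmul p q) r = qmul p (qmul q r)"
  by (cases p; cases q; cases r) (simp add: algebra_simps)

lemma qmul_add_right: "qmul p (q + r) = qmul p q + qmul p r"
  by (cases p; cases q; cases r) (simp add: algebra_simps)

text \<open>For each imaginary unit \<open>J\<close>, the complexified algebra embeds by \<open>A + i B \<mapsto> A + J B\<close>.\<close>

definition embJ :: "quat \<Rightarrow> 'x::real_normed_vector cop \<Rightarrow> 'x qop" where
  "embJ J a = (fst a, fst (snd J) *\<^sub>R snd a, fst (snd (snd J)) *\<^sub>R snd a, snd (snd (snd J)) *\<^sub>R snd a)"

definition opre :: "('x::real_normed_vector \<Rightarrow>\<^sub>L 'x) \<Rightarrow> 'x qop" where
  "opre A = (A, 0, 0, 0)"

lemma qsphereE: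
  assumes "J \<in> qsphere"
  obtains j1 j2 j3 where "J = (0, j1, j2, j3)" "j1 * j1 + j2 * j2 + j3 * j3 = 1"
  using assms by (auto simp: qsphere_def power2_eq_square)

lemma embJ_linear: "embJ J (a + b) = embJ J a + embJ J b" "embJ J (a - b) = embJ J a - embJ J b"
  "embJ J (r *\<^sub>R a) = r *\<^sub>R embJ J a"
  by (simp_all add: embJ_def algebra_simps)

lemma embJ_real [simp]: "embJ J (A, 0) = opre A"
  by (simp add: embJ_def opre_def)

lemma bounded_linear_embJ: "bounded_linear (embJ J)"
proof -
  have "bounded_linear (\<lambda>a :: 'x::real_normed_vector cop. embJ J a)"
    unfolding embJ_def
    by (intro bounded_linear_Pair bounded_linear_fst bounded_linear_snd
      bounded_linear_compose[OF bounded_linear_scaleR_right bounded_linear_snd])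
  then show ?thesis by simp
qed

lemma embJ_cm:
  assumes "J \<in> qsphere"
  shows "embJ J (cm a b) = opmul (embJ J a) (embJ J b)"
proof -
  obtain j1 j2 j3 where J: "J = (0, j1, j2, j3)" "j1 * j1 + j2 * j2 + j3 * j3 = 1"
    using assms by (rule qsphereE)
  define X where "X = snd a o\<^sub>L snd b"
  have "(j1 * j1) *\<^sub>R X + (j2 * j2) *\<^sub>R X + (j3 * j3) *\<^sub>R X = X"
    using J(2) by (simp flip: scaleR_left.add)
  then have "(fst a o\<^sub>L fst b) - X = (fst a o\<^sub>L fst b) - ((j1 * j1) *\<^sub>R X + (j2 * j2) *\<^sub>R X + (j3 * j3) *\<^sub>R X)"
    by simp
  then have "(fst a o\<^sub>L fst b) - X = (fst a o\<^sub>L fst b) - (j1 * j1) *\<^sub>R X - (j2 * j2) *\<^sub>R X - (j3 * j3) *\<^sub>R X"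
    by (simp add: diff_diff_eq add.assoc)
  then show ?thesis
    by (simp add: embJ_def cm_def J(1) opmul_proj blinfun_compose_simps mult.commute scaleR_add_right add.commute flip: X_def)
qed

lemma embJ_inject:
  assumes "J \<in> qsphere" "embJ J a = embJ J b"
  shows "a = b"
proof -
  obtain j1 j2 j3 where J: "J = (0, j1, j2, j3)" "j1 * j1 + j2 * j2 + j3 * j3 = 1"
    using assms(1) by (rule qsphereE)
  then have "j1 \<noteq> 0 \<or> j2 \<noteq> 0 \<or> j3 \<noteq> 0" by auto
  then show ?thesis using assms(2) by (auto simp: embJ_def J(1) prod_eq_iff)
qed

lemma qscal_cJ:
  assumes "J \<in> qsphere"
  shows "qscal (cJ J z) = embJ J (cs z cunit)"
  using assms by (elim qsphereE) (simp add: cJ_def qJ_def qreal_def embJ_def cs_def cunit_def mult.commute)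

lemma cJ_mult:
  assumes "J \<in> qsphere"
  shows "qmul (cJ J z) (cJ J w) = cJ J (z * w)"
proof -
  obtain j1 j2 j3 where J: "J = (0, j1, j2, j3)" "j1 * j1 + j2 * j2 + j3 * j3 = 1"
    using assms by (rule qsphereE)
  have e: "j1 * (j1 * y) + (j2 * (j2 * y) + j3 * (j3 * y)) = y" for y
    using J(2) by algebra
  show ?thesis
    by (simp add: cJ_def qJ_def qreal_def J(1) algebra_simps e)
qed

lemma cJ_uminus: "cJ J (- \<i>) = - J" if "J \<in> qsphere"
  using that by (elim qsphereE) (simp add: cJ_def qJ_def qreal_def)

text \<open>From \<open>B\<close> only its real part and its component along \<open>J\<close> are
  kept. This projection respects right multiplication by the image of \<open>embJ J\<close>, so it
  sends a left inverse to a left inverse.\<close>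

lemma opmul_embJ_inverse:
  assumes J: "J \<in> qsphere" and B: "opmul B (embJ J q) = opI"
  shows "\<exists>b. cm b q = cunit"
proof -
  obtain j1 j2 j3 where J: "J = (0, j1, j2, j3)" "j1 * j1 + j2 * j2 + j3 * j3 = 1"
    using J by (rule qsphereE)
  obtain b0 b1 b2 b3 where b: "B = (b0, b1, b2, b3)" by (metis prod.collapse)
  obtain P R where q: "q = (P, R)" by (cases q)
  have e: "(b0 o\<^sub>L P) - j1 *\<^sub>R (b1 o\<^sub>L R) - j2 *\<^sub>R (b2 o\<^sub>L R) - j3 *\<^sub>R (b3 o\<^sub>L R) = id_blinfun"
    "j1 *\<^sub>R (b0 o\<^sub>L R) + (b1 o\<^sub>L P) + j3 *\<^sub>R (b2 o\<^sub>L R) - j2 *\<^sub>R (b3 o\<^sub>L R) = 0"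
    "j2 *\<^sub>R (b0 o\<^sub>L R) - j3 *\<^sub>R (b1 o\<^sub>L R) + (b2 o\<^sub>L P) + j1 *\<^sub>R (b3 o\<^sub>L R) = 0"
    "j3 *\<^sub>R (b0 o\<^sub>L R) + j2 *\<^sub>R (b1 o\<^sub>L R) - j1 *\<^sub>R (b2 o\<^sub>L R) + (b3 o\<^sub>L P) = 0"
    using B by (simp_all add: b q J(1) embJ_def opI_def blinfun_compose_simps)
  define c where "c = j1 *\<^sub>R b1 + j2 *\<^sub>R b2 + j3 *\<^sub>R b3"
  have "j1 *\<^sub>R (j1 *\<^sub>R (b0 o\<^sub>L R) + (b1 o\<^sub>L P) + j3 *\<^sub>R (b2 o\<^sub>L R) - j2 *\<^sub>R (b3 o\<^sub>L R))
    + j2 *\<^sub>R (j2 *\<^sub>R (b0 o\<^sub>L R) - j3 *\<^sub>R (b1 o\<^sub>L R) + (b2 o\<^sub>L P) + j1 *\<^sub>R (b3 o\<^sub>L R))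
    + j3 *\<^sub>R (j3 *\<^sub>R (b0 o\<^sub>L R) + j2 *\<^sub>R (b1 o\<^sub>L R) - j1 *\<^sub>R (b2 o\<^sub>L R) + (b3 o\<^sub>L P))
    = (j1 * j1 + j2 * j2 + j3 * j3) *\<^sub>R (b0 o\<^sub>L R) + (c o\<^sub>L P)"
    by (simp add: c_def blinfun_compose_simps algebra_simps)
  then have "(b0 o\<^sub>L R) + (c o\<^sub>L P) = 0" unfolding e J(2) by simp
  moreover have "(b0 o\<^sub>L P) - (c o\<^sub>L R) = id_blinfun"
    using e(1) by (simp add: c_def blinfun_compose_simps algebra_simps)
  ultimately have "cm (b0, c) q = cunit" by (simp add: cm_def cunit_def q)
  then show ?thesis by blast
qed

text \<open>An inverse taken among all quaternionic operators already lies in the image of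
  \<open>embJ J\<close>. The S-spectrum can therefore be computed in the complexified
  algebra.\<close>

lemma op_invertible_embJ:
  assumes J: "J \<in> qsphere"
  shows "op_invertible (embJ J q) \<longleftrightarrow> (\<exists>b. cinverse q b)"
proof
  have emb1: "embJ J cunit = opI" by (simp add: cunit_def opre_def opI_def)
  {
    assume "op_invertible (embJ J q)"
    then obtain B where B: "opmul (embJ J q) B = opI" "opmul B (embJ J q) = opI"
      unfolding op_invertible_def by blast
    obtain b where b: "cm b q = cunit" using opmul_embJ_inverse[OF J B(2)] by blast
    have "embJ J b = opmul (embJ J b) (opmul (embJ J q) B)" using B(1) by (simp add: opmul_simps)
    also have "\<dots> = B" by (simp add: b emb1 opmul_simps flip: opmul_assoc embJ_cm[OF J])
    finally have "embJ J (cm q b) = embJ J cunit" using B(1) by (simp add: embJ_cm[OF J] emb1)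
    then have "cm q b = cunit" by (rule embJ_inject[OF J])
    then show "\<exists>b. cinverse q b" using b unfolding cinverse_def by blast
  }
  assume "\<exists>b. cinverse q b"
  then obtain b where "cinverse q b" by blast
  then have "opmul (embJ J q) (embJ J b) = opI" "opmul (embJ J b) (embJ J q) = opI"
    by (simp_all add: cinverse_def emb1 flip: embJ_cm[OF J])
  then show "op_invertible (embJ J q)" unfolding op_invertible_def by blast
qed

lemma qsphere_nonempty: "(0, 1, 0, 0) \<in> qsphere"
  by (simp add: qsphere_def)

lemma qsphere_uminus: "J \<in> qsphere \<Longrightarrow> - J \<in> qsphere"
  by (auto simp: qsphere_def)

lemma quat_eq_cJ:
  obtains J z where "J \<in> qsphere" "q = cJ J z"
proof -
  obtain a b c d where q: "q = (a, b, c, d)" by (metis prod.collapse)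
  define r where "r = sqrt (b\<^sup>2 + c\<^sup>2 + d\<^sup>2)"
  show thesis
  proof (cases "r = 0")
    case True
    then have "b = 0" "c = 0" "d = 0" by (auto simp: r_def real_sqrt_eq_zero_cancel_iff add_nonneg_eq_0_iff)
    then show thesis using that[OF qsphere_nonempty, of "of_real a"] by (simp add: q cJ_def qJ_def qreal_def)
  next
    case False
    have r2: "r\<^sup>2 = b\<^sup>2 + c\<^sup>2 + d\<^sup>2" by (simp add: r_def)
    have "(b / r)\<^sup>2 + (c / r)\<^sup>2 + (d / r)\<^sup>2 = (b\<^sup>2 + c\<^sup>2 + d\<^sup>2) / r\<^sup>2"
      by (simp add: power_divide add_divide_distrib)
    also have "\<dots> = 1" using False by (simp flip: r2)
    finally have "(0, b / r, c / r, d / r) \<in> qsphere" by (simp add: qsphere_def)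
    then show thesis using False that[of "(0, b / r, c / r, d / r)" "Complex a r"]
      by (simp add: q cJ_def qJ_def qreal_def)
  qed
qed

lemma continuous_cJ: "continuous_on S (cJ J)"
  unfolding cJ_def qJ_def qreal_def by (intro continuous_intros)

lemma cJ_cnj: "cJ J (cnj z) = cJ (- J) z"
  by (simp add: cJ_def qJ_def)

section \<open>Axially symmetric sets and their slices\<close>

definition pdom :: "quat set \<Rightarrow> complex set" where
  "pdom \<Omega> = {z. (Re z, Im z) \<in> param_dom \<Omega>}"

lemma pdom_iff: "axially_symmetric \<Omega> \<Longrightarrow> J \<in> qsphere \<Longrightarrow> z \<in> pdom \<Omega> \<longleftrightarrow> cJ J z \<in> \<Omega>"
  unfolding pdom_def param_dom_def axially_symmetric_def cJ_def by blast

lemma pdom_eq_slice: "axially_symmetric \<Omega> \<Longrightarrow> J \<in> qsphere \<Longrightarrow> pdom \<Omega> = slice \<Omega> J"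
  by (intro set_eqI) (simp add: pdom_iff slice_def)

lemma pdom_Int: "pdom (\<Omega> \<inter> \<Omega>') = pdom \<Omega> \<inter> pdom \<Omega>'"
  by (auto simp: pdom_def param_dom_def)

lemma pdom_cnj: "axially_symmetric \<Omega> \<Longrightarrow> z \<in> pdom \<Omega> \<Longrightarrow> cnj z \<in> pdom \<Omega>"
  using pdom_iff[OF _ qsphere_nonempty] pdom_iff[OF _ qsphere_uminus[OF qsphere_nonempty]] cJ_cnj by metis

lemma open_pdom:
  assumes "axially_symmetric \<Omega>" "open \<Omega>"
  shows "open (pdom \<Omega>)"
proof -
  have "open (cJ (0, 1, 0, 0) -` \<Omega>)"
    by (rule open_vimage[OF assms(2) continuous_cJ])
  moreover have "pdom \<Omega> = cJ (0, 1, 0, 0) -` \<Omega>"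
    by (intro set_eqI) (simp only: vimage_eq pdom_iff[OF assms(1) qsphere_nonempty])
  ultimately show ?thesis by simp
qed

lemma axially_symmetric_Int: "axially_symmetric \<Omega> \<Longrightarrow> axially_symmetric \<Omega>' \<Longrightarrow> axially_symmetric (\<Omega> \<inter> \<Omega>')"
  unfolding axially_symmetric_def by blast

text \<open>\<open>rot V\<close> is the axially symmetric set with slices \<open>V\<close>.\<close>

definition qmod :: "quat \<Rightarrow> complex" where
  "qmod q = Complex (fst q) (norm (snd q))"

definition rot :: "complex set \<Rightarrow> quat set" where
  "rot V = qmod -` V"

lemma continuous_qmod: "continuous_on S qmod"
  unfolding qmod_def Complex_eq by (intro continuous_intros)

lemma qmod_cJ:
  assumes "J \<in> qsphere"
  shows "qmod (cJ J z) = Complex (Re z) \<bar>Im z\<bar>"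
proof -
  obtain j1 j2 j3 where J: "J = (0, j1, j2, j3)" "j1 * j1 + j2 * j2 + j3 * j3 = 1"
    using assms by (rule qsphereE)
  have "norm (j1, j2, j3) = 1" using J(2) by (simp add: norm_Pair power2_eq_square)
  then have "norm (Im z *\<^sub>R (j1, j2, j3)) = \<bar>Im z\<bar>" by (simp only: norm_scaleR)
  then show ?thesis by (simp add: qmod_def cJ_def qJ_def qreal_def J(1))
qed

lemma rot_iff:
  assumes "J \<in> qsphere" "\<And>z. z \<in> V \<Longrightarrow> cnj z \<in> V"
  shows "cJ J z \<in> rot V \<longleftrightarrow> z \<in> V"
proof -
  have "Complex (Re z) \<bar>Im z\<bar> = z \<or> Complex (Re z) \<bar>Im z\<bar> = cnj z" by (auto simp: complex_eq_iff abs_if)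
  moreover have "cnj z \<in> V \<longleftrightarrow> z \<in> V" using assms(2)[of z] assms(2)[of "cnj z"] by auto
  ultimately show ?thesis unfolding rot_def using qmod_cJ[OF assms(1)] by auto
qed

lemma slice_rot: "J \<in> qsphere \<Longrightarrow> (\<And>z. z \<in> V \<Longrightarrow> cnj z \<in> V) \<Longrightarrow> slice (rot V) J = V"
  using rot_iff by (auto simp: slice_def)

lemma axially_symmetric_rot: "axially_symmetric (rot V)"
  unfolding axially_symmetric_def
proof (intro allI impI)
  fix u v J K assume "J \<in> qsphere" "K \<in> qsphere" "qJ J u v \<in> rot V"
  then show "qJ K u v \<in> rot V"
    using qmod_cJ[of J "Complex u v"] qmod_cJ[of K "Complex u v"] by (simp add: rot_def cJ_def)
qed

lemma closure_rot: "closure (rot V) \<subseteq> rot (closure V)"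
proof (rule closure_minimal)
  show "rot V \<subseteq> rot (closure V)" using closure_subset by (auto simp: rot_def)
  show "closed (rot (closure V))" unfolding rot_def by (rule closed_vimage[OF closed_closure continuous_qmod])
qed

lemma bounded_rot:
  assumes "bounded V"
  shows "bounded (rot V)"
proof -
  obtain B where B: "\<And>z. z \<in> V \<Longrightarrow> norm z \<le> B" using assms by (auto simp: bounded_iff)
  have "norm q = norm (qmod q)" for q by (cases q) (simp add: qmod_def norm_Pair cmod_def)
  then show ?thesis unfolding bounded_iff rot_def using B by (intro exI[of _ B]) auto
qed

section \<open>The S-spectrum and admissible domains in the parameter plane\<close>

context commuting_op
begin

abbreviation Top :: "'x qop" where "Top \<equiv> (T0, T1, T2, T3)"

text \<open>In \<open>T\<close> times its conjugate the mixed products cancel by commutativity. Both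
  operator coefficients of the polynomial are then real, so its value lies in the image of
  \<open>embJ J\<close>.\<close>

lemma Qcs_eq:
  assumes "J \<in> qsphere"
  shows "Qcs Top (cJ J z) = embJ J (Q z)"
proof -
  have sum: "Top + opconj Top = embJ J (2 *\<^sub>R T0, 0)"
    by (simp add: embJ_def scaleR_2)
  have prod: "opmul Top (opconj Top) = embJ J (NT, 0)"
    using comm by (simp add: embJ_def NT_def blinfun_compose_simps)
  have "qscal (qmul (cJ J z) (cJ J z)) = embJ J (cs (z\<^sup>2) cunit)"
    by (simp add: cJ_mult assms qscal_cJ power2_eq_square)
  then show ?thesis
    unfolding Qcs_def sum prod
    by (simp add: qscal_cJ[OF assms] Q_def embJ_linear cm_cs flip: embJ_cm[OF assms] del: embJ_real)
qed

lemma S_spectrum_iff: "J \<in> qsphere \<Longrightarrow> cJ J z \<in> S_spectrum Top \<longleftrightarrow> z \<in> spec"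
  by (simp add: S_spectrum_def Qcs_eq op_invertible_embJ spec_def)

lemma op_inverse_Qcs:
  assumes "J \<in> qsphere" "z \<notin> spec"
  shows "op_inverse (Qcs Top (cJ J z)) = embJ J (Qi z)"
proof (rule op_inverse_eqI)
  show "opmul (Qcs Top (cJ J z)) (embJ J (Qi z)) = opI" "opmul (embJ J (Qi z)) (Qcs Top (cJ J z)) = opI"
    using Qi[OF assms(2)]
    by (simp_all add: Qcs_eq[OF assms(1)] cinverse_def cunit_def opre_def opI_def flip: embJ_cm[OF assms(1)])
qed

lemma spec_subset_pdom:
  assumes "axially_symmetric \<Omega>" "S_spectrum Top \<subseteq> \<Omega>"
  shows "spec \<subseteq> pdom \<Omega>"
  using assms(2) S_spectrum_iff[OF qsphere_nonempty] pdom_iff[OF assms(1) qsphere_nonempty] by blast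

lemma admissible_imp_adm:
  assumes \<Omega>: "axially_symmetric \<Omega>" and a: "admissible Top \<Omega> (U, J, gs)"
  shows "J \<in> qsphere" "adm (pdom \<Omega>) (slice U J) gs"
proof -
  have J: "J \<in> qsphere" and U: "open U" "axially_symmetric U" "bounded U" "S_spectrum Top \<subseteq> U" "closure U \<subseteq> \<Omega>"
    and pb: "pos_boundary (slice U J) gs"
    using a by (auto simp: admissible_def slice_cauchy_domain_def)
  show "J \<in> qsphere" by (rule J)
  have sl: "slice U J = pdom U" using pdom_eq_slice[OF U(2) J] by simp
  have sv: "slice U J = cJ J -` U" by (auto simp: slice_def)
  have "bounded (pdom U)"
  proof -
    obtain B where B: "\<And>q. q \<in> U \<Longrightarrow> norm q \<le> B" using U(3) by (auto simp: bounded_iff)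
    have "norm z \<le> B" if "z \<in> pdom U" for z
    proof -
      have "norm (qmod (cJ J z)) = norm z" by (simp add: qmod_cJ[OF J] cmod_def)
      moreover have "norm q = norm (qmod q)" for q by (cases q) (simp add: qmod_def norm_Pair cmod_def)
      ultimately show ?thesis using B[of "cJ J z"] that pdom_iff[OF U(2) J] by simp
    qed
    then show ?thesis by (auto simp: bounded_iff)
  qed
  moreover have "closure (pdom U) \<subseteq> pdom \<Omega>"
  proof -
    have "closure (slice U J) \<subseteq> cJ J -` closure U" unfolding sv
    proof (rule closure_minimal)
      show "cJ J -` U \<subseteq> cJ J -` closure U" using closure_subset by auto
      show "closed (cJ J -` closure U)" by (rule closed_vimage[OF closed_closure continuous_cJ])
    qed
    then show ?thesis using U(5) pdom_iff[OF \<Omega> J] unfolding sl by blast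
  qed
  ultimately show "adm (pdom \<Omega>) (slice U J) gs"
    unfolding adm_def sl using open_pdom[OF U(2,1)] pdom_cnj[OF U(2)] spec_subset_pdom[OF U(2,4)] pb
    by (simp add: sl)
qed

text \<open>The calculi pick a contour by \<open>SOME\<close>, and only existence makes the pick
  admissible. The quaternionic domain is the planar one rotated about the real axis.\<close>

lemma admissible_exists:
  assumes \<Omega>: "axially_symmetric \<Omega>" "open \<Omega>" "S_spectrum Top \<subseteq> \<Omega>"
  shows "\<exists>d. admissible Top \<Omega> d"
proof -
  obtain V gs where a: "adm (pdom \<Omega>) V gs"
    using adm_exists[OF open_pdom[OF \<Omega>(1,2)] spec_subset_pdom[OF \<Omega>(1,3)]] by blast
  then have V: "open V" "bounded V" "\<And>z. z \<in> V \<Longrightarrow> cnj z \<in> V" "spec \<subseteq> V" "closure V \<subseteq> pdom \<Omega>" "pos_boundary V gs"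
    by (auto simp: adm_def)
  let ?J = "(0, 1, 0, 0) :: quat"
  have sl: "slice (rot V) J = V" if "J \<in> qsphere" for J by (rule slice_rot[OF that V(3)])
  have "open (rot V)" unfolding rot_def by (rule open_vimage[OF V(1) continuous_qmod])
  then have "slice_cauchy_domain (rot V)"
    unfolding slice_cauchy_domain_def using axially_symmetric_rot bounded_rot[OF V(2)] sl V(6) by auto
  moreover have "S_spectrum Top \<subseteq> rot V"
  proof
    fix q assume "q \<in> S_spectrum Top"
    moreover obtain J z where "J \<in> qsphere" "q = cJ J z" by (rule quat_eq_cJ)
    ultimately show "q \<in> rot V" using S_spectrum_iff rot_iff[OF _ V(3)] V(4) by auto
  qed
  moreover have "closure (rot V) \<subseteq> \<Omega>"
  proof
    fix q assume "q \<in> closure (rot V)"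
    then have q: "qmod q \<in> pdom \<Omega>" using closure_rot V(5) by (auto simp: rot_def)
    obtain J z where Jz: "J \<in> qsphere" "q = cJ J z" by (rule quat_eq_cJ)
    have "qmod q = z \<or> qmod q = cnj z" unfolding Jz(2) qmod_cJ[OF Jz(1)] by (auto simp: complex_eq_iff abs_if)
    then have "z \<in> pdom \<Omega>" using q pdom_cnj[OF \<Omega>(1), of "cnj z"] by auto
    then show "q \<in> \<Omega>" using pdom_iff[OF \<Omega>(1) Jz(1)] Jz(2) by simp
  qed
  ultimately have "admissible Top \<Omega> (rot V, ?J, gs)"
    unfolding admissible_def using qsphere_nonempty sl[OF qsphere_nonempty] V(6) by simp
  then show ?thesis by blast
qed

end

section \<open>The calculi in terms of the intrinsic calculus\<close>

definition qe :: "nat \<Rightarrow> quat" where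
  "qe k = (if k = 0 then (1, 0, 0, 0) else if k = 1 then (0, 1, 0, 0) else if k = 2 then (0, 0, 1, 0) else (0, 0, 0, 1))"

definition qc :: "nat \<Rightarrow> quat \<Rightarrow> real" where
  "qc k q = (if k = 0 then fst q else if k = 1 then fst (snd q) else if k = 2 then fst (snd (snd q)) else snd (snd (snd q)))"

lemma sum_lessThan_4: "(\<Sum>k<(4::nat). f k) = f 0 + f 1 + f 2 + (f 3 :: 'a::comm_monoid_add)"
  by (simp add: numeral_eq_Suc)

lemma bounded_linear_qc: "bounded_linear (qc k)"
proof -
  have "bounded_linear (\<lambda>q :: quat. fst q)" "bounded_linear (\<lambda>q :: quat. fst (snd q))"
    "bounded_linear (\<lambda>q :: quat. fst (snd (snd q)))" "bounded_linear (\<lambda>q :: quat. snd (snd (snd q)))"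
    by (intro bounded_linear_fst_comp bounded_linear_snd_comp bounded_linear_ident)+
  then show ?thesis
    by (cases "k = 0"; cases "k = 1"; cases "k = 2") (simp_all add: qc_def[abs_def])
qed

text \<open>A left slice function amounts to four intrinsic holomorphic functions, one for each quaternionic
  unit on the right: \<open>h(u + J v) = (H_0 + H_1 e_1 + H_2 e_2 + H_3 e_3)(u + J v)\<close>.\<close>

definition holo_rep :: "quat set \<Rightarrow> (quat \<Rightarrow> quat) \<Rightarrow> (nat \<Rightarrow> complex \<Rightarrow> complex) \<Rightarrow> bool" where
  "holo_rep \<Omega> h H \<longleftrightarrow>
     (\<forall>k<4. H k holomorphic_on pdom \<Omega> \<and> (\<forall>z\<in>pdom \<Omega>. H k (cnj z) = cnj (H k z))) \<and>
     (\<forall>J\<in>qsphere. \<forall>z\<in>pdom \<Omega>. h (cJ J z) = (\<Sum>k<4. qmul (cJ J (H k z)) (qe k)))"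

lemma holo_repD:
  assumes "holo_rep \<Omega> h H"
  shows "k < 4 \<Longrightarrow> H k holomorphic_on pdom \<Omega>"
    and "k < 4 \<Longrightarrow> z \<in> pdom \<Omega> \<Longrightarrow> H k (cnj z) = cnj (H k z)"
    and "J \<in> qsphere \<Longrightarrow> z \<in> pdom \<Omega> \<Longrightarrow> h (cJ J z) = (\<Sum>k<4. qmul (cJ J (H k z)) (qe k))"
  using assms unfolding holo_rep_def by blast+

text \<open>With the units on the right, \<open>J\<close> stays on their left and \<open>h\<close>
  splits into the terms \<open>\<alpha>_k + J \<beta>_k\<close>. The Cauchy-Riemann equations and
  the parity conditions pass to each of these.\<close>

lemma slice_repr_imp_holo_rep:
  assumes "slice_repr \<Omega> h \<alpha> \<beta>"
  shows "holo_rep \<Omega> h (\<lambda>k z. Complex (qc k (\<alpha> (Re z, Im z))) (qc k (\<beta> (Re z, Im z))))"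
  unfolding holo_rep_def
proof (intro conjI allI impI ballI)
  obtain D\<alpha> D\<beta> where D: "\<And>p. p \<in> param_dom \<Omega> \<Longrightarrow> (\<alpha> has_derivative D\<alpha> p) (at p)"
    "\<And>p. p \<in> param_dom \<Omega> \<Longrightarrow> (\<beta> has_derivative D\<beta> p) (at p)"
    "\<And>p. p \<in> param_dom \<Omega> \<Longrightarrow> D\<alpha> p (1,0) = D\<beta> p (0,1)" "\<And>p. p \<in> param_dom \<Omega> \<Longrightarrow> D\<alpha> p (0,1) = - D\<beta> p (1,0)"
    using assms unfolding slice_repr_def by blast
  have sym: "\<And>u v. (u,v) \<in> param_dom \<Omega> \<Longrightarrow> \<alpha> (u,-v) = \<alpha> (u,v) \<and> \<beta> (u,-v) = - \<beta> (u,v)"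
    using assms unfolding slice_repr_def by blast
  fix k :: nat
  interpret qc: bounded_linear "qc k" by (rule bounded_linear_qc)
  show "(\<lambda>z. Complex (qc k (\<alpha> (Re z, Im z))) (qc k (\<beta> (Re z, Im z)))) holomorphic_on pdom \<Omega>"
    unfolding holomorphic_on_def field_differentiable_def
  proof
    fix z assume "z \<in> pdom \<Omega>"
    then have p: "(Re z, Im z) \<in> param_dom \<Omega>" by (simp add: pdom_def)
    let ?p = "(Re z, Im z)"
    let ?a = "D\<alpha> ?p (1,0)" and ?b = "D\<alpha> ?p (0,1)"
    have lin: "L (x, y) = x *\<^sub>R L (1,0) + y *\<^sub>R L (0,1)" if "linear L" for L :: "real \<times> real \<Rightarrow> quat" and x y
    proof -
      have "L (x, y) = L (x *\<^sub>R (1,0) + y *\<^sub>R (0,1))" by simp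
      then show ?thesis by (simp only: linear_add[OF that] linear_scale[OF that])
    qed
    have pr: "((\<lambda>z. (Re z, Im z)) has_derivative (\<lambda>h. (Re h, Im h))) (at z)"
      by (intro derivative_intros)
    have "((\<lambda>z. qc k (\<alpha> (Re z, Im z))) has_derivative (\<lambda>h. qc k (D\<alpha> ?p (Re h, Im h)))) (at z)"
      "((\<lambda>z. qc k (\<beta> (Re z, Im z))) has_derivative (\<lambda>h. qc k (D\<beta> ?p (Re h, Im h)))) (at z)"
      by (intro qc.has_derivative has_derivative_compose[OF pr] D p)+
    then have "((\<lambda>z. of_real (qc k (\<alpha> (Re z, Im z))) + \<i> * of_real (qc k (\<beta> (Re z, Im z)))) has_derivative
      (\<lambda>h. of_real (qc k (D\<alpha> ?p (Re h, Im h))) + \<i> * of_real (qc k (D\<beta> ?p (Re h, Im h))))) (at z)"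
      by (intro derivative_intros)
    \<comment> \<open>By the Cauchy-Riemann equations the complex derivative is the u-derivative of
      \<alpha> minus i times its v-derivative, taken in component \<open>k\<close>.\<close>
    moreover have "of_real (qc k (D\<alpha> ?p (Re h, Im h))) + \<i> * of_real (qc k (D\<beta> ?p (Re h, Im h)))
        = Complex (qc k ?a) (- qc k ?b) * h" for h
      unfolding lin[OF has_derivative_linear[OF D(1)[OF p]], of "Re h"] lin[OF has_derivative_linear[OF D(2)[OF p]], of "Re h"]
      using D(3)[OF p, symmetric] D(4)[OF p]
      by (simp add: complex_eq_iff qc.add qc.diff qc.scaleR qc.neg algebra_simps)
    ultimately have "((\<lambda>z. Complex (qc k (\<alpha> (Re z, Im z))) (qc k (\<beta> (Re z, Im z)))) has_field_derivative
        Complex (qc k ?a) (- qc k ?b)) (at z)"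
      by (simp add: has_field_derivative_def Complex_eq)
    then show "\<exists>D. ((\<lambda>z. Complex (qc k (\<alpha> (Re z, Im z))) (qc k (\<beta> (Re z, Im z)))) has_field_derivative D) (at z within pdom \<Omega>)"
      using has_field_derivative_at_within by blast
  qed
  show "Complex (qc k (\<alpha> (Re (cnj z), Im (cnj z)))) (qc k (\<beta> (Re (cnj z), Im (cnj z)))) =
      cnj (Complex (qc k (\<alpha> (Re z, Im z))) (qc k (\<beta> (Re z, Im z))))" if "z \<in> pdom \<Omega>" for z
    using sym[of "Re z" "Im z"] that by (simp add: pdom_def complex_eq_iff qc.neg)
next
  fix J z assume J: "J \<in> qsphere" and z: "z \<in> pdom \<Omega>"
  have rep: "h (cJ J z) = \<alpha> (Re z, Im z) + qmul J (\<beta> (Re z, Im z))"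
    using assms J z unfolding slice_repr_def pdom_def cJ_def by blast
  obtain a0 a1 a2 a3 b0 b1 b2 b3 where ab: "\<alpha> (Re z, Im z) = (a0, a1, a2, a3)" "\<beta> (Re z, Im z) = (b0, b1, b2, b3)"
    by (metis prod.collapse)
  show "h (cJ J z) = (\<Sum>k<4. qmul (cJ J (Complex (qc k (\<alpha> (Re z, Im z))) (qc k (\<beta> (Re z, Im z))))) (qe k))"
    using J unfolding rep ab
    by (elim qsphereE) (simp add: sum_lessThan_4 qc_def qe_def cJ_def qJ_def qreal_def)
qed

lemma left_slice_hol_holo_rep:
  assumes "left_slice_hol \<Omega> h"
  obtains H where "holo_rep \<Omega> h H"
  using assms slice_repr_imp_holo_rep unfolding left_slice_hol_def by blast

lemma intrinsic_holo_rep: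
  assumes "intrinsic \<Omega> f"
  obtains F where "holo_rep \<Omega> f (\<lambda>k. if k = 0 then F else (\<lambda>z. 0))"
proof -
  obtain \<alpha> \<beta> where r: "slice_repr \<Omega> f \<alpha> \<beta>" and real: "\<And>p. p \<in> param_dom \<Omega> \<Longrightarrow> \<alpha> p \<in> range qreal \<and> \<beta> p \<in> range qreal"
    using assms unfolding intrinsic_def by blast
  define H where "H k z = Complex (qc k (\<alpha> (Re z, Im z))) (qc k (\<beta> (Re z, Im z)))" for k z
  have H: "holo_rep \<Omega> f H" using slice_repr_imp_holo_rep[OF r] by (simp add: H_def[abs_def])
  have H0: "H k z = 0" if "k \<noteq> 0" "z \<in> pdom \<Omega>" for k z
  proof -
    have "\<alpha> (Re z, Im z) \<in> range qreal" "\<beta> (Re z, Im z) \<in> range qreal"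
      using real that(2) by (auto simp: pdom_def)
    then show ?thesis using that(1) by (auto simp: H_def qc_def qreal_def complex_eq_iff)
  qed
  \<comment> \<open>For nonzero \<open>k\<close> the component \<open>H k\<close> is known to vanish
    on \<open>pdom \<Omega>\<close> only, so it is replaced by the zero function.\<close>
  have "f (cJ J z) = (\<Sum>k<4. qmul (cJ J ((if k = 0 then H 0 else (\<lambda>z. 0)) z)) (qe k))"
    if "J \<in> qsphere" "z \<in> pdom \<Omega>" for J z
  proof -
    have "f (cJ J z) = (\<Sum>k<4. qmul (cJ J (H k z)) (qe k))" using H that unfolding holo_rep_def by blast
    also have "\<dots> = (\<Sum>k<4. qmul (cJ J ((if k = 0 then H 0 else (\<lambda>z. 0)) z)) (qe k))"
      using H0 that(2) by (intro sum.cong) auto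
    finally show ?thesis .
  qed
  then have "holo_rep \<Omega> f (\<lambda>k. if k = 0 then H 0 else (\<lambda>z. 0))"
    using H unfolding holo_rep_def by auto
  then show thesis by (rule that)
qed

lemma qmul_sum_right: "qmul p (\<Sum>k<(4::nat). f k) = (\<Sum>k<4. qmul p (f k))"
  by (simp add: sum_lessThan_4 qmul_add_right)

lemma holo_rep_mult_id:
  assumes "holo_rep \<Omega> h H"
  shows "holo_rep \<Omega> (\<lambda>q. qmul q (h q)) (\<lambda>k z. z * H k z)"
  using assms unfolding holo_rep_def
  by (auto intro!: holomorphic_intros simp: qmul_sum_right cJ_mult simp flip: qmul_assoc)

lemma holo_rep_intrinsic_eval:
  assumes "holo_rep \<Omega> f (\<lambda>k. if k = 0 then F else (\<lambda>z. 0))" "J \<in> qsphere" "z \<in> pdom \<Omega>"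
  shows "f (cJ J z) = cJ J (F z)"
proof -
  have one: "qmul q (1, 0, 0, 0) = q" for q by (cases q) simp
  have "cJ J 0 = 0" "qmul 0 q = 0" for q by (cases q; simp add: cJ_def qJ_def qreal_def zero_prod_def)+
  then show ?thesis using assms by (simp add: holo_rep_def sum_lessThan_4 qe_def one)
qed

text \<open>An intrinsic \<open>f\<close> maps each slice into itself and stands on the left, so it
  multiplies every component of \<open>g\<close> like a complex number, with no unit in
  between.\<close>

lemma holo_rep_mult:
  assumes "holo_rep \<Omega> f (\<lambda>k. if k = 0 then F else (\<lambda>z. 0))" "holo_rep \<Omega>' g G"
  shows "holo_rep (\<Omega> \<inter> \<Omega>') (\<lambda>q. qmul (f q) (g q)) (\<lambda>k z. F z * G k z)"
proof -
  have F: "F holomorphic_on pdom \<Omega>" "\<And>z. z \<in> pdom \<Omega> \<Longrightarrow> F (cnj z) = cnj (F z)"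
    using holo_repD(1)[OF assms(1), of 0] holo_repD(2)[OF assms(1), of 0] by simp_all
  have G: "G k holomorphic_on pdom \<Omega>'" "z \<in> pdom \<Omega>' \<Longrightarrow> G k (cnj z) = cnj (G k z)" if "k < 4" for k z
    using assms(2) that unfolding holo_rep_def by blast+
  have "qmul (f (cJ J z)) (g (cJ J z)) = (\<Sum>k<4. qmul (cJ J (F z * G k z)) (qe k))"
    if "J \<in> qsphere" "z \<in> pdom \<Omega>" "z \<in> pdom \<Omega>'" for J z
  proof -
    have "g (cJ J z) = (\<Sum>k<4. qmul (cJ J (G k z)) (qe k))" using assms(2) that unfolding holo_rep_def by blast
    then show ?thesis
      by (simp only: holo_rep_intrinsic_eval[OF assms(1) that(1,2)] qmul_sum_right cJ_mult[OF that(1)] flip: qmul_assoc)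
  qed
  then show ?thesis unfolding holo_rep_def pdom_Int
    by (auto intro!: holomorphic_on_mult holomorphic_on_subset[OF F(1)] holomorphic_on_subset[OF G(1)] simp: F G)
qed

lemma qscal_sum: "qscal (\<Sum>k<(4::nat). f k) = (\<Sum>k<4. qscal (f k))"
  by (simp add: sum_lessThan_4 qscal_simps)

lemma opmul_sum_right: "opmul a (\<Sum>k<(4::nat). f k) = (\<Sum>k<4. opmul a (f k))"
  by (simp add: sum_lessThan_4 opmul_simps)

context commuting_op
begin

text \<open>The factor \<open>- i\<close> encodes \<open>ds_J = ds (- J)\<close>.\<close>

definition comp_op :: "quat \<Rightarrow> nat \<Rightarrow> 'x cop \<Rightarrow> 'x qop" where
  "comp_op J k a = opmul (embJ J (cs (- \<i>) a)) (qscal (qe k))"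

lemma bounded_linear_comp_op: "bounded_linear (comp_op J k)"
  unfolding comp_op_def[abs_def]
  by (intro bounded_linear_compose[OF bounded_linear_opmul_left] bounded_linear_compose[OF bounded_linear_embJ]
    cs.bounded_linear_right)

text \<open>All factors but the last unit lie in the image of \<open>embJ J\<close>, where they
  multiply as in the complexified algebra and complex scalars move freely.\<close>

lemma integrand_D:
  assumes J: "J \<in> qsphere" and z: "z \<notin> spec"
  shows "opmul (opmul (op_inverse (Qcs Top (cJ J z))) (qscal (qmul (cJ J w) (- J)))) (qscal (\<Sum>k<4. qmul (cJ J (c k)) (qe k)))
    = (\<Sum>k<4. comp_op J k (cs w (cs (c k) (Qi z))))"
proof -
  have "opmul (opmul (embJ J (Qi z)) (qscal (qmul (cJ J w) (- J)))) (qscal (qmul (cJ J v) (qe k)))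
    = comp_op J k (cs w (cs v (Qi z)))" for v k
  proof -
    have *: "qscal (qmul (cJ J w) (- J)) = embJ J (cs (w * - \<i>) (cunit :: 'x cop))"
      by (simp only: cJ_uminus[OF J, symmetric] cJ_mult[OF J] qscal_cJ[OF J])
    have "opmul (opmul (embJ J (Qi z)) (qscal (qmul (cJ J w) (- J)))) (qscal (qmul (cJ J v) (qe k)))
      = opmul (embJ J (cm (cm (Qi z) (cs (w * - \<i>) cunit)) (cs v cunit))) (qscal (qe k))"
      by (simp only: * qscal_simps(2)[of "cJ J v" "qe k"] qscal_cJ[OF J] embJ_cm[OF J] opmul_assoc)
    then show ?thesis by (simp add: cm_cs cs_cs comp_op_def mult_ac)
  qed
  then show ?thesis unfolding op_inverse_Qcs[OF J z] qscal_sum opmul_sum_right by simp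
qed

text \<open>The resolvent is \<open>s\<close> times the inverse minus the conjugate of
  \<open>T\<close> times the inverse. That conjugate need not lie in the image of
  \<open>embJ J\<close>, so it stays outside as a left factor.\<close>

lemma integrand_S:
  assumes J: "J \<in> qsphere" and z: "z \<notin> spec"
  shows "opmul (opmul (SL_resolvent (cJ J z) Top) (qscal (qmul (cJ J w) (- J)))) (qscal (\<Sum>k<4. qmul (cJ J (c k)) (qe k)))
    = (\<Sum>k<4. comp_op J k (cs w (cs (z * c k) (Qi z)))) - opmul (opconj Top) (\<Sum>k<4. comp_op J k (cs w (cs (c k) (Qi z))))"
proof -
  have "opmul (qscal (cJ J z)) (\<Sum>k<4. comp_op J k (cs w (cs (c k) (Qi z)))) = (\<Sum>k<4. comp_op J k (cs w (cs (z * c k) (Qi z))))"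
    unfolding opmul_sum_right
  proof (rule sum.cong)
    fix k
    have "opmul (embJ J (cs z cunit)) (opmul (embJ J (cs (- \<i>) (cs w (cs (c k) (Qi z))))) (qscal (qe k)))
      = opmul (embJ J (cm (cs z cunit) (cs (- \<i>) (cs w (cs (c k) (Qi z)))))) (qscal (qe k))"
      by (simp only: embJ_cm[OF J] opmul_assoc)
    then show "opmul (qscal (cJ J z)) (comp_op J k (cs w (cs (c k) (Qi z)))) = comp_op J k (cs w (cs (z * c k) (Qi z)))"
      unfolding qscal_cJ[OF J] comp_op_def by (simp add: cm_cs cs_cs mult_ac)
  qed simp
  moreover have "opmul (opmul (SL_resolvent (cJ J z) Top) (qscal (qmul (cJ J w) (- J)))) (qscal (\<Sum>k<4. qmul (cJ J (c k)) (qe k)))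
    = opmul (qscal (cJ J z)) (\<Sum>k<4. comp_op J k (cs w (cs (c k) (Qi z))))
      - opmul (opconj Top) (\<Sum>k<4. comp_op J k (cs w (cs (c k) (Qi z))))"
    unfolding SL_resolvent_def integrand_D[OF J z, symmetric] by (simp only: opmul_assoc opmul_simps(3))
  ultimately show ?thesis by simp
qed

context
  fixes \<Omega> :: "quat set" and h :: "quat \<Rightarrow> quat" and H :: "nat \<Rightarrow> complex \<Rightarrow> complex"
  assumes \<Omega>: "axially_symmetric \<Omega>" "open \<Omega>" "S_spectrum Top \<subseteq> \<Omega>" and rep: "holo_rep \<Omega> h H"
begin

lemma comp_op_has_integral:
  assumes "K holomorphic_on pdom \<Omega>" and g: "valid_path g" "path_image g \<subseteq> pdom \<Omega> - spec"
  shows "((\<lambda>t. comp_op J k (cs (vector_derivative g (at t within {0..1})) (cs (K (g t)) (Qi (g t)))))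
    has_integral comp_op J k (vpath_int g (\<lambda>z. cs (K z) (Qi z)))) {0..1}"
proof -
  have o: "open (pdom \<Omega>)" by (rule open_pdom[OF \<Omega>(1,2)])
  have "(\<lambda>t. cs (vector_derivative g (at t within {0..1})) (cs (K (g t)) (Qi (g t)))) integrable_on {0..1}"
    by (rule vhol_on_path_integrable[OF open_Diff_spec[OF o] vhol_on_integrand[OF o assms(1)] g])
  from has_integral_linear[OF integrable_integral[OF this] bounded_linear_comp_op]
  show ?thesis by (simp add: vpath_int_def o_def)
qed

lemma H_holomorphic: "k < 4 \<Longrightarrow> H k holomorphic_on pdom \<Omega>" "k < 4 \<Longrightarrow> (\<lambda>z. z * H k z) holomorphic_on pdom \<Omega>"
  using rep by (auto simp: holo_rep_def intro!: holomorphic_intros)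

lemma path_int_D:
  assumes J: "J \<in> qsphere" and g: "valid_path g" "path_image g \<subseteq> pdom \<Omega> - spec"
  shows "path_int J g (\<lambda>s. op_inverse (Qcs Top s)) h = (\<Sum>k<4. comp_op J k (vpath_int g (\<lambda>z. cs (H k z) (Qi z))))"
proof -
  have I: "((\<lambda>t. \<Sum>k<4. comp_op J k (cs (vector_derivative g (at t within {0..1})) (cs (H k (g t)) (Qi (g t)))))
    has_integral (\<Sum>k<4. comp_op J k (vpath_int g (\<lambda>z. cs (H k z) (Qi z))))) {0..1}"
    by (intro has_integral_sum comp_op_has_integral g H_holomorphic) auto
  have eq: "opmul (opmul (op_inverse (Qcs Top (cJ J (g t)))) (qscal (qmul (cJ J (vector_derivative g (at t within {0..1}))) (- J))))
      (qscal (h (cJ J (g t)))) = (\<Sum>k<4. comp_op J k (cs (vector_derivative g (at t within {0..1})) (cs (H k (g t)) (Qi (g t)))))"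
    if "t \<in> {0..1}" for t
  proof -
    have "g t \<in> path_image g" using that by (simp add: path_image_def)
    then have gt: "g t \<in> pdom \<Omega>" "g t \<notin> spec" using g(2) by auto
    then have "h (cJ J (g t)) = (\<Sum>k<4. qmul (cJ J (H k (g t))) (qe k))" using rep J unfolding holo_rep_def by blast
    then show ?thesis by (simp only: integrand_D[OF J gt(2)])
  qed
  show ?thesis unfolding path_int_def
    by (rule integral_unique, rule has_integral_eq[OF eq[symmetric] I])
qed

lemma path_int_S:
  assumes J: "J \<in> qsphere" and g: "valid_path g" "path_image g \<subseteq> pdom \<Omega> - spec"
  shows "path_int J g (\<lambda>s. SL_resolvent s Top) h = (\<Sum>k<4. comp_op J k (vpath_int g (\<lambda>z. cs (z * H k z) (Qi z))))
    - opmul (opconj Top) (\<Sum>k<4. comp_op J k (vpath_int g (\<lambda>z. cs (H k z) (Qi z))))"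
proof -
  have 1: "((\<lambda>t. \<Sum>k<4. comp_op J k (cs (vector_derivative g (at t within {0..1})) (cs (H k (g t)) (Qi (g t)))))
    has_integral (\<Sum>k<4. comp_op J k (vpath_int g (\<lambda>z. cs (H k z) (Qi z))))) {0..1}"
    by (intro has_integral_sum comp_op_has_integral g H_holomorphic) auto
  have 2: "((\<lambda>t. \<Sum>k<4. comp_op J k (cs (vector_derivative g (at t within {0..1})) (cs (g t * H k (g t)) (Qi (g t)))))
    has_integral (\<Sum>k<4. comp_op J k (vpath_int g (\<lambda>z. cs (z * H k z) (Qi z))))) {0..1}"
    by (intro has_integral_sum comp_op_has_integral[where K = "\<lambda>z. z * H k z" for k] g H_holomorphic) auto
  note I = has_integral_diff[OF 2 has_integral_linear[OF 1 bounded_linear_opmul_right[of "opconj Top"], unfolded o_def]]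
  have eq: "opmul (opmul (SL_resolvent (cJ J (g t)) Top) (qscal (qmul (cJ J (vector_derivative g (at t within {0..1}))) (- J))))
      (qscal (h (cJ J (g t)))) = (\<Sum>k<4. comp_op J k (cs (vector_derivative g (at t within {0..1})) (cs (g t * H k (g t)) (Qi (g t)))))
      - opmul (opconj Top) (\<Sum>k<4. comp_op J k (cs (vector_derivative g (at t within {0..1})) (cs (H k (g t)) (Qi (g t)))))"
    if "t \<in> {0..1}" for t
  proof -
    have "g t \<in> path_image g" using that by (simp add: path_image_def)
    then have gt: "g t \<in> pdom \<Omega>" "g t \<notin> spec" using g(2) by auto
    then have "h (cJ J (g t)) = (\<Sum>k<4. qmul (cJ J (H k (g t))) (qe k))" using rep J unfolding holo_rep_def by blast
    then show ?thesis by (simp only: integrand_S[OF J gt(2)])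
  qed
  show ?thesis unfolding path_int_def
    by (rule integral_unique, rule has_integral_eq[OF eq[symmetric] I])
qed

lemma sum_comp_op_add:
  "(\<Sum>k<4. comp_op J k (a k + b k)) = (\<Sum>k<4. comp_op J k (a k)) + (\<Sum>k<4. comp_op J k (b k))"
  by (simp add: linear_add[OF bounded_linear.linear[OF bounded_linear_comp_op]] sum.distrib)

lemma sum_comp_op_zero: "(\<Sum>k<4. comp_op J k 0) = 0"
  by (simp add: linear_0[OF bounded_linear.linear[OF bounded_linear_comp_op]])

lemma bdry_int_D:
  assumes J: "J \<in> qsphere" and gs: "cycle_in (pdom \<Omega> - spec) gs"
  shows "bdry_int J gs (\<lambda>s. op_inverse (Qcs Top s)) h = (\<Sum>k<4. comp_op J k (vcycle_int gs (\<lambda>z. cs (H k z) (Qi z))))"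
  using gs
  by (induction gs) (simp_all add: bdry_int_def vcycle_int_def sum_comp_op_zero sum_comp_op_add path_int_D[OF J])

lemma bdry_int_S:
  assumes J: "J \<in> qsphere" and gs: "cycle_in (pdom \<Omega> - spec) gs"
  shows "bdry_int J gs (\<lambda>s. SL_resolvent s Top) h = (\<Sum>k<4. comp_op J k (vcycle_int gs (\<lambda>z. cs (z * H k z) (Qi z))))
    - opmul (opconj Top) (\<Sum>k<4. comp_op J k (vcycle_int gs (\<lambda>z. cs (H k z) (Qi z))))"
  using gs
proof (induction gs)
  case Nil
  show ?case
    by (simp add: bdry_int_def vcycle_int_def sum_comp_op_zero linear_0[OF bounded_linear.linear[OF bounded_linear_opmul_right]]
      del: opconj.simps)
next
  case (Cons g gs)
  then have "bdry_int J (g # gs) (\<lambda>s. SL_resolvent s Top) h =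
    (\<Sum>k<4. comp_op J k (vpath_int g (\<lambda>z. cs (z * H k z) (Qi z))))
    - opmul (opconj Top) (\<Sum>k<4. comp_op J k (vpath_int g (\<lambda>z. cs (H k z) (Qi z)))) +
    ((\<Sum>k<4. comp_op J k (vcycle_int gs (\<lambda>z. cs (z * H k z) (Qi z))))
    - opmul (opconj Top) (\<Sum>k<4. comp_op J k (vcycle_int gs (\<lambda>z. cs (H k z) (Qi z)))))"
    by (simp add: bdry_int_def path_int_S[OF J] del: opconj.simps)
  also have "\<dots> = (\<Sum>k<4. comp_op J k (vcycle_int (g # gs) (\<lambda>z. cs (z * H k z) (Qi z))))
    - opmul (opconj Top) (\<Sum>k<4. comp_op J k (vcycle_int (g # gs) (\<lambda>z. cs (H k z) (Qi z))))"
    by (simp add: vcycle_int_def sum_comp_op_add opmul_simps(2) del: opconj.simps)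
  finally show ?case .
qed

text \<open>The factor - i turns 2 pi i into 2 pi, and \<open>J\<close> disappears: the value is the
  same on every slice. The prefactors -1/pi and 1/(2 pi) of the two calculi turn 2 pi into -2 and
  1.\<close>

lemma sum_comp_op_calc:
  "(\<Sum>k<4. comp_op J k (cs (2 * of_real pi * \<i>) (A k, 0))) = (2 * pi) *\<^sub>R (A 0, A 1, A 2, A 3)"
proof -
  have "comp_op J k (cs (2 * of_real pi * \<i>) (A k, 0)) = (2 * pi) *\<^sub>R opmul (opre (A k)) (qscal (qe k))" for k
  proof -
    have "cs (- \<i>) (cs (2 * of_real pi * \<i>) (A k, 0)) = (2 * pi) *\<^sub>R (A k, 0 :: 'x \<Rightarrow>\<^sub>L 'x)"
      by (simp add: cs_cs cs_def)
    then show ?thesis by (simp only: comp_op_def embJ_linear embJ_real opmul_simps)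
  qed
  then show ?thesis
    by (simp add: sum_lessThan_4 qe_def opre_def blinfun_compose_simps flip: scaleR_add_right)
qed

lemma D_calc_eq:
  assumes A: "\<And>k. k < 4 \<Longrightarrow> calc (pdom \<Omega>) (H k) (A k)"
  shows "D_calc Top \<Omega> h = - 2 *\<^sub>R (A 0, A 1, A 2, A 3)"
proof -
  obtain U J gs where d: "(SOME d. admissible Top \<Omega> d) = (U, J, gs)" by (metis prod.collapse)
  have "admissible Top \<Omega> (U, J, gs)" unfolding d[symmetric] by (rule someI_ex[OF admissible_exists[OF \<Omega>]])
  note J = admissible_imp_adm(1)[OF \<Omega>(1) this] and a = admissible_imp_adm(2)[OF \<Omega>(1) this]
  have "D_calc Top \<Omega> h = (- 1 / pi) *\<^sub>R bdry_int J gs (\<lambda>s. op_inverse (Qcs Top s)) h"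
    unfolding D_calc_def d by simp
  also have "bdry_int J gs (\<lambda>s. op_inverse (Qcs Top s)) h = (\<Sum>k<4. comp_op J k (cs (2 * of_real pi * \<i>) (A k, 0)))"
    unfolding bdry_int_D[OF J adm_cycle_in_spec[OF a]] using A a by (intro sum.cong) (auto simp: calc_def)
  also have "\<dots> = (2 * pi) *\<^sub>R (A 0, A 1, A 2, A 3)" by (rule sum_comp_op_calc)
  finally show ?thesis by simp
qed

lemma S_calc_eq:
  assumes A: "\<And>k. k < 4 \<Longrightarrow> calc (pdom \<Omega>) (H k) (A k)" and B: "\<And>k. k < 4 \<Longrightarrow> calc (pdom \<Omega>) (\<lambda>z. z * H k z) (B k)"
  shows "S_calc Top \<Omega> h = (B 0, B 1, B 2, B 3) - opmul (opconj Top) (A 0, A 1, A 2, A 3)"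
proof -
  obtain U J gs where d: "(SOME d. admissible Top \<Omega> d) = (U, J, gs)" by (metis prod.collapse)
  have "admissible Top \<Omega> (U, J, gs)" unfolding d[symmetric] by (rule someI_ex[OF admissible_exists[OF \<Omega>]])
  note J = admissible_imp_adm(1)[OF \<Omega>(1) this] and a = admissible_imp_adm(2)[OF \<Omega>(1) this]
  have "S_calc Top \<Omega> h = (1 / (2 * pi)) *\<^sub>R bdry_int J gs (\<lambda>s. SL_resolvent s Top) h"
    unfolding S_calc_def d by simp
  also have "bdry_int J gs (\<lambda>s. SL_resolvent s Top) h = (\<Sum>k<4. comp_op J k (cs (2 * of_real pi * \<i>) (B k, 0)))
      - opmul (opconj Top) (\<Sum>k<4. comp_op J k (cs (2 * of_real pi * \<i>) (A k, 0)))"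
    unfolding bdry_int_S[OF J adm_cycle_in_spec[OF a]] using A B a
    by (intro arg_cong2[of _ _ _ _ minus] arg_cong[of _ _ "opmul (opconj Top)"] sum.cong) (auto simp: calc_def)
  also have "\<dots> = (2 * pi) *\<^sub>R (B 0, B 1, B 2, B 3) - (2 * pi) *\<^sub>R opmul (opconj Top) (A 0, A 1, A 2, A 3)"
    by (simp only: sum_comp_op_calc opmul_simps)
  finally show ?thesis by (simp add: scaleR_diff_right del: opconj.simps opmul.simps scaleR_Pair)
qed

lemma holo_rep_calc_exists:
  obtains A B where "\<And>k. k < 4 \<Longrightarrow> calc (pdom \<Omega>) (H k) (A k)" "\<And>k. k < 4 \<Longrightarrow> calc (pdom \<Omega>) (\<lambda>z. z * H k z) (B k)"
proof -
  note ex = calc_exists[OF open_pdom[OF \<Omega>(1,2)] spec_subset_pdom[OF \<Omega>(1,3)] _ pdom_cnj[OF \<Omega>(1)]]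
  have "\<forall>k. \<exists>A. k < 4 \<longrightarrow> calc (pdom \<Omega>) (H k) A" "\<forall>k. \<exists>B. k < 4 \<longrightarrow> calc (pdom \<Omega>) (\<lambda>z. z * H k z) B"
    using ex[OF H_holomorphic(1)] ex[OF H_holomorphic(2)] rep unfolding holo_rep_def
    by (metis complex_cnj_mult)+
  then show thesis using that by metis
qed

end

end

section \<open>The product rule\<close>

context commuting_op
begin

lemma NT_commute:
  assumes "A \<in> {T0, T1, T2, T3}"
  shows "A o\<^sub>L NT = NT o\<^sub>L A"
proof -
  have "A o\<^sub>L (B o\<^sub>L B) = B o\<^sub>L (B o\<^sub>L A)" if "B \<in> {T0, T1, T2, T3}" for B
  proof -
    have "A o\<^sub>L (B o\<^sub>L B) = (A o\<^sub>L B) o\<^sub>L B" by (simp only: blinfun_compose_simps(13))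
    also have "\<dots> = B o\<^sub>L (A o\<^sub>L B)" by (simp only: comm[OF assms that] blinfun_compose_simps(13))
    finally show ?thesis by (simp only: comm[OF assms that])
  qed
  then show ?thesis by (simp add: NT_def blinfun_compose_simps)
qed

lemma opmul_opre: "opmul (opre x) (a, b, c, d) = (x o\<^sub>L a, x o\<^sub>L b, x o\<^sub>L c, x o\<^sub>L d)"
  by (simp add: opre_def blinfun_compose_simps)

lemma opre_opconj_commute:
  assumes "\<And>X. X \<in> {T0, T1, T2, T3} \<Longrightarrow> X o\<^sub>L A = A o\<^sub>L X"
  shows "opmul (opconj Top) (opre A) = opmul (opre A) (opconj Top)"
  using assms by (simp add: opre_def blinfun_compose_simps)

text \<open>The quaternionic Cayley-Hamilton identity with trace \<open>2 T0\<close> and norm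
  \<open>NT\<close>; it carries over to operators because the components commute.\<close>

lemma opconj_square:
  "opmul (opconj Top) (opconj Top) = opmul (opre (2 *\<^sub>R T0)) (opconj Top) - opre NT"
  using comm by (simp add: opre_def NT_def blinfun_compose_simps scaleR_2 algebra_simps)

text \<open>The conjugate of \<open>T\<close> moves past \<open>a\<close> and \<open>b\<close>, and
  its square is reduced by \<open>opconj_square\<close>. By the two moment formulas the right side
  is the first moment of the product minus the conjugate times the zeroth one, so this is the
  product rule for the S-functional calculus.\<close>

lemma S_calc_product_identity:
  defines "TB \<equiv> opconj Top"
  assumes a: "\<And>X. X \<in> {T0, T1, T2, T3} \<Longrightarrow> X o\<^sub>L a = a o\<^sub>L X"
    and b: "\<And>X. X \<in> {T0, T1, T2, T3} \<Longrightarrow> X o\<^sub>L b = b o\<^sub>L X"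
  shows "opmul (opre a - opmul TB (opre b)) (c - opmul TB d)
    = (opmul (opre a) c - opmul (opre b) (opmul (opre NT) d))
      - opmul TB (opmul (opre b) c + opmul (opre a) d - opmul (opre b) (opmul (opre (2 *\<^sub>R T0)) d))"
proof -
  have A: "opmul TB (opmul (opre a) x) = opmul (opre a) (opmul TB x)" for x
    using opre_opconj_commute[OF a] unfolding TB_def[symmetric] by (simp flip: opmul_assoc)
  have B: "opmul TB (opmul (opre b) x) = opmul (opre b) (opmul TB x)" for x
    using opre_opconj_commute[OF b] unfolding TB_def[symmetric] by (simp flip: opmul_assoc)
  have "X o\<^sub>L (2 *\<^sub>R T0) = (2 *\<^sub>R T0) o\<^sub>L X" if "X \<in> {T0, T1, T2, T3}" for X
    using comm[OF that, of T0] by (simp add: blinfun_compose_simps)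
  from opre_opconj_commute[OF this]
  have C: "opmul TB (opmul (opre (2 *\<^sub>R T0)) x) = opmul (opre (2 *\<^sub>R T0)) (opmul TB x)" for x
    unfolding TB_def[symmetric] by (simp flip: opmul_assoc)
  have D: "opmul TB (opmul TB x) = opmul (opre (2 *\<^sub>R T0)) (opmul TB x) - opmul (opre NT) x" for x
    using arg_cong[OF opconj_square, of "\<lambda>u. opmul u x"] unfolding TB_def[symmetric]
    by (simp only: opmul_assoc opmul_simps)
  show ?thesis
    by (simp only: opmul_simps opmul_assoc A B C D) simp
qed

end

theorem theorem8p4:
  fixes T :: "'x::banach qop"
    and \<Omega>f \<Omega>g :: "quat set" and f g :: "quat \<Rightarrow> quat"
  assumes "BC T"
    and "(\<Omega>f, f) \<in> N_intr (S_spectrum T)"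
    and "(\<Omega>g, g) \<in> SH_L (S_spectrum T)"
  shows "2 *\<^sub>R (D_calc T (\<Omega>f \<inter> \<Omega>g) (\<lambda>q. qmul (qmul q (f q)) (g q))
                 - opmul (opconj T) (D_calc T (\<Omega>f \<inter> \<Omega>g) (\<lambda>q. qmul (f q) (g q))))
       = opmul (S_calc T \<Omega>f f) (D_calc T \<Omega>g (\<lambda>q. qmul q (g q)))
         - opmul (opmul (S_calc T \<Omega>f f) (opconj T)) (D_calc T \<Omega>g g)
         + opmul (D_calc T \<Omega>f (\<lambda>q. qmul (f q) q)) (S_calc T \<Omega>g g)
         - opmul (opmul (D_calc T \<Omega>f f) (opconj T)) (S_calc T \<Omega>g g)"
proof -
  obtain T0 T1 T2 T3 where T: "T = (T0, T1, T2, T3)" by (metis prod.collapse)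
  interpret commuting_op T0 T1 T2 T3
    using assms(1) unfolding T BC.simps by unfold_locales blast
  have f: "axially_symmetric \<Omega>f" "open \<Omega>f" "S_spectrum Top \<subseteq> \<Omega>f" "intrinsic \<Omega>f f"
    using assms(2) unfolding T N_intr_def intrinsic_def by auto
  have g: "axially_symmetric \<Omega>g" "open \<Omega>g" "S_spectrum Top \<subseteq> \<Omega>g" "left_slice_hol \<Omega>g g"
    using assms(3) unfolding T SH_L_def left_slice_hol_def by auto
  have fg: "axially_symmetric (\<Omega>f \<inter> \<Omega>g)" "open (\<Omega>f \<inter> \<Omega>g)" "S_spectrum Top \<subseteq> \<Omega>f \<inter> \<Omega>g"
    using f g by (auto intro: axially_symmetric_Int)
  obtain F where rf: "holo_rep \<Omega>f f (\<lambda>k. if k = 0 then F else (\<lambda>z. 0))"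
    using f(4) by (rule intrinsic_holo_rep)
  obtain G where rg: "holo_rep \<Omega>g g G" using g(4) by (rule left_slice_hol_holo_rep)
  note rgq = holo_rep_mult_id[OF rg] and rfg = holo_rep_mult[OF rf rg]
  have rqfg: "holo_rep (\<Omega>f \<inter> \<Omega>g) (\<lambda>q. qmul (qmul q (f q)) (g q)) (\<lambda>k z. z * (F z * G k z))"
    using holo_rep_mult_id[OF rfg] by (simp only: qmul_assoc)
  \<comment> \<open>On each slice both factors lie in the same commutative plane, so the two orders
    of multiplication have one representation.\<close>
  have rfq: "holo_rep \<Omega>f (\<lambda>q. qmul (f q) q) (\<lambda>k z. z * (if k = 0 then F else (\<lambda>z. 0)) z)"
  proof -
    have "qmul (f (cJ J z)) (cJ J z) = qmul (cJ J z) (f (cJ J z))" if "J \<in> qsphere" "z \<in> pdom \<Omega>f" for J z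
      using holo_rep_intrinsic_eval[OF rf that] cJ_mult[OF that(1)] by (simp add: mult.commute)
    then show ?thesis using holo_rep_mult_id[OF rf] unfolding holo_rep_def by simp
  qed
  obtain A B where AB: "\<And>k :: nat. k < 4 \<Longrightarrow> calc (pdom \<Omega>f) (if k = 0 then F else (\<lambda>z. 0)) (A k)"
    "\<And>k :: nat. k < 4 \<Longrightarrow> calc (pdom \<Omega>f) (\<lambda>z. z * (if k = 0 then F else (\<lambda>z. 0)) z) (B k)"
    using holo_rep_calc_exists[OF f(1-3) rf] by blast
  obtain a b where b: "calc (pdom \<Omega>f) F b" and a: "calc (pdom \<Omega>f) (\<lambda>z. z * F z) a"
    using AB(1)[of 0] AB(2)[of 0] by simp
  \<comment> \<open>The zero components of \<open>f\<close> have the moment 0, so the tuples for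
    \<open>f\<close> become \<open>opre b\<close> and \<open>opre a\<close>.\<close>
  have bk: "calc (pdom \<Omega>f) (if k = 0 then F else (\<lambda>z. 0)) (if k = 0 then b else 0)"
    and ak: "calc (pdom \<Omega>f) (\<lambda>z. z * (if k = 0 then F else (\<lambda>z. 0)) z) (if k = 0 then a else 0)" for k :: nat
    using a b calc_zero by simp_all
  obtain d c where d: "\<And>k. k < 4 \<Longrightarrow> calc (pdom \<Omega>g) (G k) (d k)"
    and c: "\<And>k. k < 4 \<Longrightarrow> calc (pdom \<Omega>g) (\<lambda>z. z * G k z) (c k)"
    using holo_rep_calc_exists[OF g(1-3) rg] by blast
  obtain q p where q: "\<And>k. k < 4 \<Longrightarrow> calc (pdom (\<Omega>f \<inter> \<Omega>g)) (\<lambda>z. F z * G k z) (q k)"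
    and p: "\<And>k. k < 4 \<Longrightarrow> calc (pdom (\<Omega>f \<inter> \<Omega>g)) (\<lambda>z. z * (F z * G k z)) (p k)"
    using holo_rep_calc_exists[OF fg rfg] by blast
  note df = open_pdom[OF f(1,2)] spec_subset_pdom[OF f(1,3)] and dg = open_pdom[OF g(1,2)] spec_subset_pdom[OF g(1,3)]
  have F: "F holomorphic_on pdom \<Omega>f" using holo_repD(1)[OF rf, of 0] by simp
  then have zF: "(\<lambda>z. z * F z) holomorphic_on pdom \<Omega>f" by (intro holomorphic_intros)
  have prod: "q k = (b o\<^sub>L c k) + (a o\<^sub>L d k) - (b o\<^sub>L (2 *\<^sub>R T0) o\<^sub>L d k)" "p k = (a o\<^sub>L c k) - (b o\<^sub>L NT o\<^sub>L d k)"
    if k: "k < 4" for k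
    using calc_product[OF F df holo_repD(1)[OF rg k] dg b a d[OF k] c[OF k] q[OF k, unfolded pdom_Int]]
      calc_product_first_moment[OF F df holo_repD(1)[OF rg k] dg b a d[OF k] c[OF k] p[OF k, unfolded pdom_Int]] .
  \<comment> \<open>Each component of \<open>T\<close> commutes with \<open>T0\<close> and
    \<open>NT\<close>, hence with the inverse of \<open>Q\<close> under the integral.\<close>
  have comm_ab: "X o\<^sub>L a = a o\<^sub>L X" "X o\<^sub>L b = b o\<^sub>L X" if "X \<in> {T0, T1, T2, T3}" for X
    using calc_commute[OF a df zF _ NT_commute[OF that]] calc_commute[OF b df F _ NT_commute[OF that]] comm[OF that, of T0]
    by simp_all
  define TB where "TB = opconj Top"
  define c4 d4 where "c4 = (c 0, c 1, c 2, c 3)" and "d4 = (d 0, d 1, d 2, d 3)"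
  define p4 q4 where "p4 = (p 0, p 1, p 2, p 3)" and "q4 = (q 0, q 1, q 2, q 3)"
  have p4: "p4 = opmul (opre a) c4 - opmul (opre b) (opmul (opre NT) d4)"
    and q4: "q4 = opmul (opre b) c4 + opmul (opre a) d4 - opmul (opre b) (opmul (opre (2 *\<^sub>R T0)) d4)"
    by (simp_all add: p4_def q4_def c4_def d4_def opmul_opre prod blinfun_compose_simps)
  have Df: "D_calc Top \<Omega>f f = - 2 *\<^sub>R opre b"
    unfolding D_calc_eq[OF f(1-3) rf bk] by (simp add: opre_def)
  have Dfq: "D_calc Top \<Omega>f (\<lambda>q. qmul (f q) q) = - 2 *\<^sub>R opre a"
    unfolding D_calc_eq[OF f(1-3) rfq ak] by (simp add: opre_def)
  have Dg: "D_calc Top \<Omega>g g = - 2 *\<^sub>R d4"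
    unfolding d4_def by (rule D_calc_eq[OF g(1-3) rg d])
  have Dgq: "D_calc Top \<Omega>g (\<lambda>q. qmul q (g q)) = - 2 *\<^sub>R c4"
    unfolding c4_def by (rule D_calc_eq[OF g(1-3) rgq c])
  have Dfg: "D_calc Top (\<Omega>f \<inter> \<Omega>g) (\<lambda>q. qmul (f q) (g q)) = - 2 *\<^sub>R q4"
    unfolding q4_def by (rule D_calc_eq[OF fg rfg q])
  have Dqfg: "D_calc Top (\<Omega>f \<inter> \<Omega>g) (\<lambda>q. qmul (qmul q (f q)) (g q)) = - 2 *\<^sub>R p4"
    unfolding p4_def by (rule D_calc_eq[OF fg rqfg p])
  have Sf: "S_calc Top \<Omega>f f = opre a - opmul TB (opre b)"
    unfolding S_calc_eq[OF f(1-3) rf bk ak] TB_def by (simp add: opre_def del: opconj.simps opmul.simps)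
  have Sg: "S_calc Top \<Omega>g g = c4 - opmul TB d4"
    unfolding c4_def d4_def TB_def by (rule S_calc_eq[OF g(1-3) rg d c])
  \<comment> \<open>The product rule: f(T) g(T) = (f g)(T).\<close>
  have SS: "opmul (opre a - opmul TB (opre b)) (c4 - opmul TB d4) = p4 - opmul TB q4"
    unfolding p4 q4 TB_def by (rule S_calc_product_identity[OF comm_ab])
  \<comment> \<open>Moves the conjugate of \<open>T\<close> to the left of \<open>b\<close>, so that
    the last two terms on the right combine to - 2 f(T) g(T) as well.\<close>
  have "opmul (opre b) TB = opmul TB (opre b)"
    using opre_opconj_commute[OF comm_ab(2)] by (simp add: TB_def)
  then have "opmul (- 2 *\<^sub>R opre a) (c4 - opmul TB d4) - opmul (opmul (- 2 *\<^sub>R opre b) TB) (c4 - opmul TB d4)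
      = - 2 *\<^sub>R opmul (opre a - opmul TB (opre b)) (c4 - opmul TB d4)"
    by (simp only: opmul_simps scaleR_diff_right) (simp add: algebra_simps)
  moreover have "opmul (opre a - opmul TB (opre b)) (- 2 *\<^sub>R c4) - opmul (opmul (opre a - opmul TB (opre b)) TB) (- 2 *\<^sub>R d4)
      = - 2 *\<^sub>R opmul (opre a - opmul TB (opre b)) (c4 - opmul TB d4)"
    by (simp only: opmul_simps(4,6) opmul_assoc scaleR_diff_right)
  \<comment> \<open>The left side is - 4 (f g)(T), split into two halves to match the two products
    on the right.\<close>
  moreover have "2 *\<^sub>R (- 2 *\<^sub>R p4 - opmul TB (- 2 *\<^sub>R q4)) = - 2 *\<^sub>R (p4 - opmul TB q4) + - 2 *\<^sub>R (p4 - opmul TB q4)"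
    by (simp only: opmul_simps(6) scaleR_diff_right flip: scaleR_2)
  ultimately show ?thesis
    unfolding T Df Dfq Dg Dgq Dfg Dqfg Sf Sg TB_def[symmetric] add_diff_eq[symmetric] by (simp only: SS)
qed

end
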